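(* For all integers $d,k,t\geq 1$ and $q\geq 2$, if $k(q-1)>dt+d+q-1$, then there is a measurable $k$-coloring of $\mathbb{R}^d$ such that no $d$-dimensional necklace has a fair $q$-splitting using at most $t$ arbitrary hyperplane cuts. The set of such colorings is dense in the metric space $\mathcal{M}$ of measurable $k$-colorings of $\mathbb{R}^d$.
   Context: A measurable $k$-coloring of $\mathbb{R}^d$ is a map $f:\mathbb{R}^d\to\{1,\dots,k\}$ with each $f^{-1}(i)$ Lebesgue measurable. $\mathcal{M}$ is the space of measurable $k$-colorings of $\mathbb{R}^d$, where colorings that differ only on a set of measure zero are identified, with metric $d(f,g)=\sum_{n=1}^\infty 2^{-n}\,\mathcal{L}(\{x\in[-n,n]^d:f(x)\neq g(x)\})/(2n)^d$, where $\mathcal{L}$ is Lebesgue measure. Given a coloring of $\mathbb{R}^d$, a $d$-dimensional necklace is a nontrivial axis-aligned cube $[\alpha_1,\alpha_1+\alpha_0]\times\dots\times[\alpha_d,\alpha_d+\alpha_0]$, $\alpha_0>0$, with the induced coloring. A fair $q$-splitting of a necklace using $t$ arbitrary hyperplane cuts is a division of the necklace by $t$ affine hyperplanes (not necessarily axis-aligned) of $\mathbb{R}^d$ into pieces (the parts of the cube lying in the regions determined by the hyperplanes), together with a distribution of the pieces into $q$ parts such that each part captures exactly $1/q$ of the total measure of every color in the necklace. *)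

theory Defs
  imports "HOL-Analysis.Analysis"
begin

section \<open>The space of measurable colorings\<close>

definition colorings :: "nat \<Rightarrow> (real ^ 'n \<Rightarrow> nat) set" where
  "colorings k = {f. range f \<subseteq> {1..k} \<and> (\<forall>i\<in>{1..k}. f -` {i} \<in> sets lebesgue)}"

definition coloring_rel :: "nat \<Rightarrow> ((real ^ 'n \<Rightarrow> nat) \<times> (real ^ 'n \<Rightarrow> nat)) set" where
  "coloring_rel k =
     {(f, g). f \<in> colorings k \<and> g \<in> colorings k \<and> {x. f x \<noteq> g x} \<in> null_sets lebesgue}"

definition coloring_space :: "nat \<Rightarrow> (real ^ 'n \<Rightarrow> nat) set set" where
  "coloring_space k = colorings k // coloring_rel k"

definition origin_cube :: "nat \<Rightarrow> (real ^ 'n) set" where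
  "origin_cube n = cbox (\<chi> i. - real n) (\<chi> i. real n)"

text \<open>The series starts at \<^term>\<open>1::nat\<close>, hence the shift by \<^term>\<open>Suc\<close>.\<close>

definition coloring_dist_term :: "(real ^ 'n \<Rightarrow> nat) \<Rightarrow> (real ^ 'n \<Rightarrow> nat) \<Rightarrow> nat \<Rightarrow> real" where
  "coloring_dist_term f g n =
     (1/2) ^ n * (measure lebesgue {x \<in> origin_cube n. f x \<noteq> g x} / (2 * real n) ^ CARD('n))"

definition coloring_dist :: "(real ^ 'n \<Rightarrow> nat) \<Rightarrow> (real ^ 'n \<Rightarrow> nat) \<Rightarrow> real" where
  "coloring_dist f g = (\<Sum>n. coloring_dist_term f g (Suc n))"

text \<open>The metric on classes; it does not depend on the representatives chosen, see
  \<open>class_dist_eq\<close> below.\<close>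

definition class_dist :: "(real ^ 'n \<Rightarrow> nat) set \<Rightarrow> (real ^ 'n \<Rightarrow> nat) set \<Rightarrow> real" where
  "class_dist F G = coloring_dist (SOME f. f \<in> F) (SOME g. g \<in> G)"


section \<open>Necklaces and fair splittings\<close>

definition is_necklace :: "(real ^ 'n) set \<Rightarrow> bool" where
  "is_necklace N \<longleftrightarrow> (\<exists>a r. r > 0 \<and> N = cbox a (a + (\<chi> i. r)))"

definition is_hyperplane :: "(real ^ 'n) set \<Rightarrow> bool" where
  "is_hyperplane H \<longleftrightarrow> (\<exists>a b. a \<noteq> 0 \<and> H = {x. a \<bullet> x = b})"

text \<open>The regions determined by the hyperplanes are taken to be open; the points of the cube lying
  on a hyperplane form a null set and belong to no piece.\<close>

definition pieces :: "(real ^ 'n) set \<Rightarrow> (real ^ 'n) set set \<Rightarrow> (real ^ 'n) set set" where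
  "pieces N \<H> = {N \<inter> R | R. R \<in> components (- \<Union>\<H>) \<and> N \<inter> R \<noteq> {}}"

text \<open>\<^term>\<open>\<sigma>\<close> assigns each piece to one of the parts \<open>1, \<dots>, q\<close>; a part may be empty.\<close>

definition fair_distribution ::
    "nat \<Rightarrow> nat \<Rightarrow> (real ^ 'n \<Rightarrow> nat) \<Rightarrow> (real ^ 'n) set \<Rightarrow> (real ^ 'n) set set
      \<Rightarrow> ((real ^ 'n) set \<Rightarrow> nat) \<Rightarrow> bool" where
  "fair_distribution k q f N \<P> \<sigma> \<longleftrightarrow>
     \<sigma> ` \<P> \<subseteq> {1..q} \<and>
     (\<forall>j\<in>{1..q}. \<forall>i\<in>{1..k}.
        measure lebesgue (\<Union>{P \<in> \<P>. \<sigma> P = j} \<inter> f -` {i}) = measure lebesgue (N \<inter> f -` {i}) / q)"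

definition has_fair_splitting ::
    "nat \<Rightarrow> nat \<Rightarrow> (real ^ 'n \<Rightarrow> nat) \<Rightarrow> (real ^ 'n) set \<Rightarrow> nat \<Rightarrow> bool" where
  "has_fair_splitting k q f N t \<longleftrightarrow>
     (\<exists>\<H> \<sigma>. finite \<H> \<and> card \<H> = t \<and> (\<forall>H\<in>\<H>. is_hyperplane H) \<and>
        fair_distribution k q f N (pieces N \<H>) \<sigma>)"

definition unsplittable_colorings :: "nat \<Rightarrow> nat \<Rightarrow> nat \<Rightarrow> (real ^ 'n \<Rightarrow> nat) set" where
  "unsplittable_colorings k q t =
     {f \<in> colorings k. \<forall>N. is_necklace N \<longrightarrow> \<not> (\<exists>s\<le>t. has_fair_splitting k q f N s)}"

text \<open>Unsplittability depends only on the class of a coloring, see \<open>unsplittable_colorings_cong\<close>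
  below.\<close>

definition unsplittable_classes :: "nat \<Rightarrow> nat \<Rightarrow> nat \<Rightarrow> (real ^ 'n \<Rightarrow> nat) set set" where
  "unsplittable_classes k q t = (\<lambda>f. coloring_rel k `` {f}) ` unsplittable_colorings k q t"


section \<open>Well-definedness\<close>

lemma equiv_coloring_rel: "equiv (colorings k) (coloring_rel k)"
proof (rule equivI)
  show "coloring_rel k \<subseteq> colorings k \<times> colorings k"
    by (auto simp: coloring_rel_def)
  show "refl_on (colorings k) (coloring_rel k)"
    by (auto simp: refl_on_def coloring_rel_def)
  show "sym (coloring_rel k)"
    by (auto simp: sym_def coloring_rel_def eq_commute)
  show "trans (coloring_rel k)"
  proof (rule transI)
    fix f g h assume fg: "(f, g) \<in> coloring_rel k" and gh: "(g, h) \<in> coloring_rel k"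
    have "{x. f x \<noteq> g x} \<union> {x. g x \<noteq> h x} \<in> null_sets lebesgue"
      using fg gh by (auto simp: coloring_rel_def)
    then have "{x. f x \<noteq> h x} \<in> null_sets lebesgue"
      by (rule null_sets_completion_subset[rotated]) auto
    then show "(f, h) \<in> coloring_rel k"
      using fg gh by (auto simp: coloring_rel_def)
  qed
qed

lemma coloring_measurable_vimage:
  assumes "f \<in> colorings k" shows "f -` A \<in> sets lebesgue"
proof -
  have "f -` A = (\<Union>i\<in>A \<inter> {1..k}. f -` {i})"
    using assms by (auto simp: colorings_def)
  also have "\<dots> \<in> sets lebesgue"
    using assms by (intro sets.finite_UN) (auto simp: colorings_def)
  finally show ?thesis .
qed

lemma coloring_neq_measurable:
  assumes "f \<in> colorings k" "g \<in> colorings k" shows "{x. f x \<noteq> g x} \<in> sets lebesgue"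
proof -
  have "{x. f x \<noteq> g x} = (\<Union>i\<in>{1..k}. f -` {i} \<inter> g -` (- {i}))"
    using assms by (fastforce simp: colorings_def)
  also have "\<dots> \<in> sets lebesgue"
    using assms by (intro sets.finite_UN sets.Int coloring_measurable_vimage[of f k] coloring_measurable_vimage[of g k]) auto
  finally show ?thesis .
qed

lemma origin_cube_lmeasurable: "origin_cube n \<in> lmeasurable"
  by (simp add: origin_cube_def)

lemma measure_origin_cube:
  "measure lebesgue (origin_cube n :: (real ^ 'n) set) = (2 * real n) ^ CARD('n)"
proof -
  have "measure lebesgue (origin_cube n :: (real ^ 'n) set) = (\<Prod>i\<in>(UNIV::'n set). 2 * real n)"
    unfolding origin_cube_def measure_completion[OF borel_closed[OF closed_cbox, folded sets_lborel]]
    by (subst content_cbox_cart) (simp_all add: interval_ne_empty_cart)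
  then show ?thesis by simp
qed

lemma neq_in_cube_lmeasurable:
  assumes "f \<in> colorings k" "g \<in> colorings k"
  shows "{x \<in> origin_cube n. f x \<noteq> g x} \<in> lmeasurable"
proof -
  have "{x \<in> origin_cube n. f x \<noteq> g x} = origin_cube n \<inter> {x. f x \<noteq> g x}" by auto
  then show ?thesis
    using fmeasurable_Int_fmeasurable[OF origin_cube_lmeasurable coloring_neq_measurable[OF assms]]
    by simp
qed

lemma coloring_dist_term_nonneg: "0 \<le> coloring_dist_term f g n"
  by (simp add: coloring_dist_term_def)

lemma measure_subset_origin_cube_le:
  fixes A :: "(real ^ 'n) set"
  assumes "A \<subseteq> origin_cube n"
  shows "measure lebesgue A \<le> (2 * real n) ^ CARD('n)"
proof (cases "A \<in> sets lebesgue")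
  case True
  then show ?thesis
    unfolding measure_origin_cube[symmetric]
    using assms origin_cube_lmeasurable by (intro measure_mono_fmeasurable) auto
next
  case False
  then show ?thesis by (simp add: measure_notin_sets)
qed

lemma coloring_dist_term_le:
  fixes f g :: "real ^ 'n \<Rightarrow> nat"
  shows "coloring_dist_term f g n \<le> (1/2) ^ n"
proof -
  let ?c = "(2 * real n) ^ CARD('n)"
  have "measure lebesgue {x \<in> origin_cube n. f x \<noteq> g x} / ?c \<le> ?c / ?c"
    by (rule divide_right_mono[OF measure_subset_origin_cube_le]) auto
  also have "\<dots> \<le> 1"
    by (rule divide_self_if[THEN ord_eq_le_trans]) simp
  finally show ?thesis
    unfolding coloring_dist_term_def by (intro mult_left_le) simp_all
qed

lemma summable_coloring_dist: "summable (\<lambda>n. coloring_dist_term f g (Suc n))"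
proof (rule summable_comparison_test')
  show "summable (\<lambda>n. (1/2::real) ^ Suc n)"
    by (subst summable_Suc_iff) (rule summable_geometric, simp)
  show "norm (coloring_dist_term f g (Suc n)) \<le> (1/2) ^ Suc n" if "n \<ge> 0" for n
    using coloring_dist_term_le[of f g "Suc n"] coloring_dist_term_nonneg[of f g "Suc n"] by simp
qed

lemma coloring_dist_nonneg: "0 \<le> coloring_dist f g"
  unfolding coloring_dist_def
  by (intro suminf_nonneg summable_coloring_dist coloring_dist_term_nonneg)

lemma coloring_dist_commute: "coloring_dist f g = coloring_dist g f"
  by (simp add: coloring_dist_def coloring_dist_term_def eq_commute)

lemma coloring_dist_triangle:
  assumes "f \<in> colorings k" "g \<in> colorings k" "h \<in> colorings k"
  shows "coloring_dist f h \<le> coloring_dist f g + coloring_dist g h"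
proof -
  have "coloring_dist_term f h n \<le> coloring_dist_term f g n + coloring_dist_term g h n" for n
  proof -
    let ?D = "\<lambda>f g. {x \<in> origin_cube n. f x \<noteq> g x}"
    have "measure lebesgue (?D f h) \<le> measure lebesgue (?D f g \<union> ?D g h)"
      using assms
      by (intro measure_mono_fmeasurable fmeasurable.Un neq_in_cube_lmeasurable fmeasurableD) auto
    also have "\<dots> \<le> measure lebesgue (?D f g) + measure lebesgue (?D g h)"
      using assms by (intro measure_Un_le fmeasurableD neq_in_cube_lmeasurable)
    finally show ?thesis
      unfolding coloring_dist_term_def
      by (simp add: divide_right_mono flip: distrib_left add_divide_distrib)
  qed
  then show ?thesis
    unfolding coloring_dist_def using assms
    by (subst suminf_add) (auto intro!: suminf_le summable_add summable_coloring_dist)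
qed

lemma coloring_dist_eq_0_iff:
  fixes f g :: "real ^ 'n \<Rightarrow> nat"
  assumes "f \<in> colorings k" "g \<in> colorings k"
  shows "coloring_dist f g = 0 \<longleftrightarrow> (f, g) \<in> coloring_rel k"
proof
  assume "coloring_dist f g = 0"
  then have "coloring_dist_term f g (Suc n) = 0" for n
    unfolding coloring_dist_def
    by (subst (asm) suminf_eq_zero_iff)
       (auto intro: summable_coloring_dist coloring_dist_term_nonneg)
  then have "measure lebesgue {x \<in> origin_cube (Suc n). f x \<noteq> g x} = 0" for n
    by (simp add: coloring_dist_term_def del: of_nat_Suc)
  then have null: "{x \<in> origin_cube (Suc n). f x \<noteq> g x} \<in> null_sets lebesgue" for n
    using neq_in_cube_lmeasurable[OF assms]
    by (simp add: negligible_iff_measure flip: negligible_iff_null_sets)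
  have "{x. f x \<noteq> g x} = (\<Union>n. {x \<in> origin_cube (Suc n). f x \<noteq> g x})"
  proof -
    have "\<exists>n. x \<in> origin_cube (Suc n)" for x :: "real ^ 'n"
    proof -
      obtain n where n: "norm x \<le> real n" using real_arch_simple by blast
      have "\<bar>x $ i\<bar> \<le> real (Suc n)" for i
        using component_le_norm_cart[of x i] n by simp
      then have "x \<in> origin_cube (Suc n)"
        unfolding origin_cube_def mem_box_cart abs_le_iff vec_lambda_beta by (metis minus_le_iff)
      then show ?thesis ..
    qed
    then show ?thesis by auto
  qed
  then have "{x. f x \<noteq> g x} \<in> null_sets lebesgue"
    using null by auto
  then show "(f, g) \<in> coloring_rel k"
    using assms by (simp add: coloring_rel_def)
next
  assume "(f, g) \<in> coloring_rel k"
  then have null: "{x. f x \<noteq> g x} \<in> null_sets lebesgue" by (simp add: coloring_rel_def)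
  have "measure lebesgue {x \<in> origin_cube n. f x \<noteq> g x} = 0" for n
  proof -
    have "{x \<in> origin_cube n. f x \<noteq> g x} \<in> null_sets lebesgue"
      by (rule null_sets_completion_subset[OF _ null]) auto
    then show ?thesis by (rule measure_eq_0_null_sets)
  qed
  then show "coloring_dist f g = 0"
    by (simp add: coloring_dist_def coloring_dist_term_def)
qed

lemma class_some:
  assumes "F \<in> coloring_space k"
  shows "(SOME f. f \<in> F) \<in> F" "F \<subseteq> colorings k"
proof -
  show "(SOME f. f \<in> F) \<in> F"
    using in_quotient_imp_non_empty[OF equiv_coloring_rel] assms
    unfolding coloring_space_def by (metis some_in_eq)
  show "F \<subseteq> colorings k"
    using in_quotient_imp_subset[OF equiv_coloring_rel] assms
    unfolding coloring_space_def by blast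
qed

lemma class_dist_eq:
  assumes "F \<in> coloring_space k" "G \<in> coloring_space k" "f \<in> F" "g \<in> G"
  shows "class_dist F G = coloring_dist f g"
proof -
  define f' where "f' = (SOME f. f \<in> F)"
  define g' where "g' = (SOME g. g \<in> G)"
  have in': "f' \<in> F" "g' \<in> G"
    using assms(1,2) class_some(1) unfolding f'_def g'_def by blast+
  have col: "f \<in> colorings k" "g \<in> colorings k" "f' \<in> colorings k" "g' \<in> colorings k"
    using assms in' class_some(2) by blast+
  have "(f, f') \<in> coloring_rel k" "(g, g') \<in> coloring_rel k"
    using assms in' in_quotient_imp_in_rel[OF equiv_coloring_rel]
    unfolding coloring_space_def by blast+
  then have z: "coloring_dist f f' = 0" "coloring_dist g g' = 0"
    using coloring_dist_eq_0_iff col by blast+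
  have "coloring_dist f g = coloring_dist f' g'"
    using coloring_dist_triangle[of f k f' g] coloring_dist_triangle[of f' k g' g]
      coloring_dist_triangle[of f' k f g'] coloring_dist_triangle[of f k g g'] col z
      coloring_dist_commute[of f f'] coloring_dist_commute[of g g']
    by linarith
  then show ?thesis by (simp add: class_dist_def f'_def g'_def)
qed

lemma Metric_space_colorings: "Metric_space (coloring_space k) class_dist"
proof
  fix F G H :: "(real ^ 'n \<Rightarrow> nat) set"
  show "class_dist F G = class_dist G F"
    by (simp add: class_dist_def coloring_dist_commute)
  show "0 \<le> class_dist F G"
    by (simp add: class_dist_def coloring_dist_nonneg)
  assume F: "F \<in> coloring_space k" and G: "G \<in> coloring_space k"
  obtain f g where fg: "f \<in> F" "g \<in> G" using F G class_some(1) by blast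
  then have col: "f \<in> colorings k" "g \<in> colorings k" using F G class_some(2) by blast+
  show "class_dist F G = 0 \<longleftrightarrow> F = G"
    using class_dist_eq[OF F G fg] coloring_dist_eq_0_iff[OF col]
      quotient_eq_iff[OF equiv_coloring_rel _ _ fg] F G
    unfolding coloring_space_def by simp
  assume H: "H \<in> coloring_space k"
  obtain h where h: "h \<in> H" using H class_some(1) by blast
  then have "h \<in> colorings k" using H class_some(2) by blast
  then show "class_dist F H \<le> class_dist F G + class_dist G H"
    using coloring_dist_triangle[OF col, of h] class_dist_eq F G H fg h by metis
qed

lemma measure_color_cong:
  assumes "(f, g) \<in> coloring_rel k"
  shows "measure lebesgue (A \<inter> f -` {i}) = measure lebesgue (A \<inter> g -` {i})"
proof -
  have null: "{x. f x \<noteq> g x} \<in> null_sets lebesgue"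
    using assms by (simp add: coloring_rel_def)
  have ae: "AE x in lebesgue. x \<in> A \<inter> f -` {i} \<longleftrightarrow> x \<in> A \<inter> g -` {i}"
    by (rule AE_I'[OF null]) auto
  have ae': "AE x in lebesgue. x \<in> A \<inter> g -` {i} \<longleftrightarrow> x \<in> A \<inter> f -` {i}"
    using ae by (auto elim: eventually_mono)
  have iff: "A \<inter> f -` {i} \<in> sets lebesgue \<longleftrightarrow> A \<inter> g -` {i} \<in> sets lebesgue"
  proof
    show "A \<inter> g -` {i} \<in> sets lebesgue" if "A \<inter> f -` {i} \<in> sets lebesgue"
      by (rule completion.in_sets_AE[OF ae that]) simp
    show "A \<inter> f -` {i} \<in> sets lebesgue" if "A \<inter> g -` {i} \<in> sets lebesgue"
      by (rule completion.in_sets_AE[OF ae' that]) simp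
  qed
  show ?thesis
  proof (cases "A \<inter> f -` {i} \<in> sets lebesgue")
    case True
    then show ?thesis using iff by (intro measure_eq_AE[OF ae]) blast+
  next
    case False
    then show ?thesis using iff by (simp add: measure_notin_sets)
  qed
qed

lemma unsplittable_colorings_cong:
  assumes "(f, g) \<in> coloring_rel k"
  shows "f \<in> unsplittable_colorings k q t \<longleftrightarrow> g \<in> unsplittable_colorings k q t"
proof -
  have "f \<in> colorings k" "g \<in> colorings k"
    using assms by (simp_all add: coloring_rel_def)
  then show ?thesis
    by (simp add: unsplittable_colorings_def has_fair_splitting_def fair_distribution_def
        measure_color_cong[OF assms])
qed

end

theory Submission
  imports Defs
begin

text \<open>
  The proof compares the number of parameters with the number of equations. Write \<open>d\<close> for the
  dimension. A necklace is given by \<open>d + 1\<close> numbers and each hyperplane by \<open>d\<close> numbers, so a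
  necklace with \<open>t\<close> cuts has \<open>m = d t + d + 1\<close> parameters; a labelling of the regions by
  \<open>1, \<dots>, q\<close> adds only finitely many choices.

  Recolor many tiny cubes of a given coloring in such a way that in each of them the amounts of
  the first \<open>k - 1\<close> colors can be prescribed. In a nearly fair splitting every part is large,
  hence contains one of these cubes entirely (\<open>large_part_contains_cube\<close>). If everything else is
  fixed, then fairness determines the amounts of the first \<open>k - 1\<close> colors in the cubes of the parts
  \<open>2, \<dots>, q\<close>, and these \<open>D = (k - 1) (q - 1)\<close> numbers are Lipschitz functions of the \<open>m\<close> parameters
  (\<open>framed_part_perturb\<close>, \<open>parameters_close\<close>). So if each amount is taken from \<open>K\<close> equally spaced
  values, then of the \<open>K ^ D\<close> choices only about as many can be bad as there are cells of size
  \<open>1 / K\<close> needed to cover the relevant parameters, up to a constant factor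
  (\<open>count_functions_le\<close>). The space of all parameters needs about \<open>K ^ m\<close> cells, and the hypothesis
  says exactly that \<open>D \<ge> m\<close>, which falls short by one dimension.

  The missing dimension comes from the volume: all parts have the same volume, an equation that
  does not involve the coloring. It has to be shown that it is satisfied only for a thin set of
  parameters, one that meets \<open>o (K ^ m)\<close> cells (\<open>nearly_fair_covering\<close>). To this end the coordinate
  axes are rescaled. Taking the first hyperplane to be \<open>\<Sum>i. z\<^sub>i y\<^sub>i = 1\<close> in coordinates in
  which the necklace is the unit cube, and then scaling the coordinates by \<open>z\<close>, turns the necklace
  into the box \<open>[0, z]\<close> and the first hyperplane into a fixed one. The parameters now are the
  corner and the size of the necklace, the other hyperplanes, and \<open>z\<close>. For fixed hyperplanes a part
  is the intersection of the box with a fixed union \<open>P\<close> of regions. If for many \<open>z\<close> the set \<open>P\<close>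
  took the share \<open>1 / q\<close> of \<open>[0, z]\<close>, then this would be so for all corners \<open>z\<close> of some small box
  that is not cut by the hyperplanes. Alternating sums over the corners would show that \<open>P\<close> takes
  the share \<open>1 / q\<close> of this small box, but it contains all or nothing of it
  (\<open>fair_boxes_thin\<close>). Scaling breaks down if some \<open>z\<^sub>i\<close> is very small, but such parameters are
  few for a trivial reason.

  This yields, arbitrarily close to any coloring, a coloring without nearly fair splittings of the
  necklaces of a bounded range of positions and sizes (\<open>exists_robust_perturbation\<close>). Absence of
  nearly fair splittings survives small changes of the coloring. So one can treat larger and
  larger ranges one after the other, with changes that become small so quickly that the limit has
  no fair splitting of any necklace (\<open>exists_unsplittable_near\<close>).
\<close>

section \<open>Overlapping translates and thin strips around hyperplanes\<close>

lemma sum_measure_le_overlap: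
  fixes m :: nat
  assumes E: "\<And>j. j < m \<Longrightarrow> E j \<in> lmeasurable"
  shows "(\<Sum>j<m. measure lebesgue (E j)) \<le> measure lebesgue (\<Union>j<m. E j)
           + (\<Sum>j<m. \<Sum>i<j. measure lebesgue (E i \<inter> E j))"
  using E
proof (induction m)
  case 0
  then show ?case by simp
next
  case (Suc m)
  let ?\<mu> = "measure lebesgue" and ?U = "\<Union>j<m. E j"
  have U: "?U \<in> lmeasurable" and Em: "E m \<in> lmeasurable"
    using Suc.prems by (auto intro!: fmeasurable.finite_UN)
  have "?\<mu> (\<Union>j<Suc m. E j) = ?\<mu> ?U + ?\<mu> (E m) - ?\<mu> (?U \<inter> E m)"
    using measure_Un3[OF U Em] by (simp add: lessThan_Suc Un_commute)
  moreover have "?\<mu> (?U \<inter> E m) \<le> (\<Sum>i<m. ?\<mu> (E i \<inter> E m))"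
  proof -
    have "?U \<inter> E m = (\<Union>i<m. E i \<inter> E m)" by blast
    moreover have "E i \<inter> E m \<in> sets lebesgue" if "i < m" for i
      using Suc.prems that by (intro sets.Int fmeasurableD) auto
    ultimately show ?thesis
      using measure_UNION_le[of "{..<m}" "\<lambda>i. E i \<inter> E m" lebesgue] by simp
  qed
  ultimately show ?case
    using Suc.IH Suc.prems by simp
qed

text \<open>Pigeonhole principle for the translates of a set: if \<open>m\<close> of them fit into a region whose
  measure is less than \<open>m\<close> times that of the set, then two of them overlap substantially.\<close>

lemma translates_overlap:
  fixes E :: "'a::euclidean_space set"
  assumes E: "E \<in> lmeasurable" and B: "B \<in> lmeasurable"
    and sub: "\<And>j. j < m \<Longrightarrow> (+) (real j *\<^sub>R v) ` E \<subseteq> B"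
    and large: "measure lebesgue B + (real m)\<^sup>2 * \<kappa> < m * measure lebesgue E"
    and \<kappa>: "0 \<le> \<kappa>"
  obtains j where "0 < j" "j < m" "\<kappa> < measure lebesgue (E \<inter> (+) (real j *\<^sub>R v) ` E)"
proof -
  define T where "T j = (+) (real j *\<^sub>R v) ` E" for j :: nat
  have T: "T j \<in> lmeasurable" "measure lebesgue (T j) = measure lebesgue E" for j
    using E by (auto simp: T_def measure_translation intro: measurable_translation)
  have "\<exists>i j. i < j \<and> j < m \<and> \<kappa> < measure lebesgue (T i \<inter> T j)"
  proof (rule ccontr)
    assume "\<not> ?thesis"
    then have small: "measure lebesgue (T i \<inter> T j) \<le> \<kappa>" if "i < j" "j < m" for i j
      using that by (meson not_le)
    have "m * measure lebesgue E \<le> measure lebesgue (\<Union>j<m. T j)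
           + (\<Sum>j<m. \<Sum>i<j. measure lebesgue (T i \<inter> T j))"
      using sum_measure_le_overlap[of m T] T by simp
    also have "measure lebesgue (\<Union>j<m. T j) \<le> measure lebesgue B"
      using sub T by (intro measure_mono_fmeasurable B) (auto simp: T_def)
    also have "(\<Sum>j<m. \<Sum>i<j. measure lebesgue (T i \<inter> T j)) \<le> (\<Sum>j<m. \<Sum>i<j. \<kappa>)"
      using small by (intro sum_mono) auto
    also have "\<dots> \<le> (\<Sum>j<m. m * \<kappa>)"
      using \<kappa> by (intro sum_mono) (simp add: mult_right_mono)
    finally show False
      using large by (simp add: power2_eq_square)
  qed
  then obtain i j where ij: "i < j" "j < m" "\<kappa> < measure lebesgue (T i \<inter> T j)"
    by blast
  have "T i \<inter> T j = (+) (real i *\<^sub>R v) ` (E \<inter> T (j - i))"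
  proof -
    have "T j = (+) (real i *\<^sub>R v) ` T (j - i)"
      using ij by (simp add: T_def image_image algebra_simps of_nat_diff)
    then show ?thesis
      by (simp add: T_def image_Int)
  qed
  then have "\<kappa> < measure lebesgue (E \<inter> T (j - i))"
    using ij by (simp add: measure_translation)
  then show ?thesis
    using ij that[of "j - i"] by (simp add: T_def)
qed

text \<open>Passing from \<open>y\<close> to \<^term>\<open>reflect A y\<close> is the change of coordinates from the corner \<open>0\<close> of the unit
  cube to the corner whose coordinates are \<open>1\<close> on \<open>A\<close> and \<open>0\<close> elsewhere.\<close>

definition reflect :: "'n set \<Rightarrow> real ^ 'n \<Rightarrow> real ^ 'n" where
  "reflect A y = (\<chi> i. if i \<in> A then 1 - y $ i else y $ i)"

text \<open>Hyperplanes are described by coefficients with respect to a corner of the unit cube,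
  normalized so that the right-hand side of the equation is \<open>1\<close>. The number \<open>s\<close> is \<open>1\<close> or \<open>- 1\<close>
  and orients the hyperplane.\<close>

definition side :: "'n set \<Rightarrow> real \<Rightarrow> real ^ 'n \<Rightarrow> real ^ 'n \<Rightarrow> real" where
  "side A s \<zeta> y = s * (\<zeta> \<bullet> reflect A y - 1)"

definition big_cube :: "real \<Rightarrow> (real ^ 'n) set" where
  "big_cube R = cbox (\<chi> i. - R) (\<chi> i. R)"

lemma mem_big_cube: "y \<in> big_cube R \<longleftrightarrow> (\<forall>i. \<bar>y $ i\<bar> \<le> R)"
  by (auto simp: big_cube_def mem_box_cart abs_le_iff minus_le_iff)

lemma big_cube_lmeasurable [simp]: "big_cube R \<in> lmeasurable"
  by (simp add: big_cube_def)

lemma inner_cart_sum: "x \<bullet> y = (\<Sum>i\<in>UNIV. x $ i * y $ i)" for x y :: "real ^ 'n"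
  by (simp add: inner_vec_def)

lemma continuous_on_reflect [continuous_intros]:
  "continuous_on S (\<lambda>y. reflect A y :: real ^ 'n)"
  unfolding reflect_def
  proof (rule continuous_on_vec_lambda)
  show "continuous_on S (\<lambda>x. if i \<in> A then 1 - x $ i else x $ i)" for i
    by (cases "i \<in> A") (auto intro!: continuous_intros)
qed

lemma closed_strip: "closed {y. \<bar>\<zeta> \<bullet> reflect A y - 1\<bar> \<le> \<eta>}"
  by (intro closed_Collect_le continuous_intros)

definition strip :: "'n set \<Rightarrow> real ^ 'n \<Rightarrow> real \<Rightarrow> (real ^ 'n) set" where
  "strip A \<zeta> \<eta> = {y \<in> big_cube 10. \<bar>\<zeta> \<bullet> reflect A y - 1\<bar> \<le> \<eta>}"

lemma strip_lmeasurable [simp]: "strip A \<zeta> \<eta> \<in> lmeasurable"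
proof -
  have "strip A \<zeta> \<eta> = big_cube 10 \<inter> {y. \<bar>\<zeta> \<bullet> reflect A y - 1\<bar> \<le> \<eta>}"
    by (auto simp: strip_def)
  moreover have "compact (big_cube 10 \<inter> {y. \<bar>\<zeta> \<bullet> reflect A y - 1\<bar> \<le> \<eta>})"
    by (intro compact_Int_closed closed_strip) (simp add: big_cube_def)
  ultimately show ?thesis
    by (simp add: lmeasurable_compact)
qed

lemma reflect_add_axis:
  "reflect A (y + c *\<^sub>R axis i 1) = reflect A y + (if i \<in> A then - c else c) *\<^sub>R axis i 1"
  by (simp add: reflect_def vec_eq_iff axis_def)

text \<open>If some coefficient is not small, then translating the strip along the corresponding axis gives
  many disjoint strips in a bounded region, so a thin strip has small volume. If all coefficients
  are small, then the hyperplane misses the cube, and so does a thin strip.\<close>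

lemma measure_strip_le:
  "\<exists>C>0. \<forall>A (\<zeta> :: real ^ 'n) \<eta>. \<eta> > 0 \<longrightarrow> (\<forall>i. 0 \<le> \<zeta> $ i) \<longrightarrow>
      measure lebesgue (strip A \<zeta> \<eta>) \<le> C * \<eta>"
proof -
  define d where "d = real CARD('n)"
  \<comment> \<open>coefficients below \<open>c\<close> count as small: the linear form is then at most \<open>1 / 2\<close> on the cube, where the
    reflected coordinates are at most \<open>11\<close>\<close>
  define c where "c = 1 / (22 * d)"
  define V where "V = measure lebesgue (big_cube 11 :: (real ^ 'n) set)"
  have d: "d \<ge> 1" by (simp add: d_def Suc_leI)
  have c: "c > 0" using d by (simp add: c_def)
  have V: "V \<ge> 0" by (simp add: V_def)
  have "measure lebesgue (strip A \<zeta> \<eta>) \<le> (6 * V / c + 2 * V + 1) * \<eta>"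
    if \<eta>: "\<eta> > 0" and nn: "\<And>i. 0 \<le> \<zeta> $ i" for A and \<zeta> :: "real ^ 'n" and \<eta>
  proof -
    let ?S = "strip A \<zeta> \<eta>"
    have SV: "measure lebesgue ?S \<le> V"
      unfolding V_def
    proof (rule measure_mono_fmeasurable)
      show "?S \<subseteq> big_cube 11"
        unfolding strip_def mem_big_cube subset_eq by (smt (verit) mem_Collect_eq mem_big_cube)
    qed (auto intro: fmeasurableD)
    consider "\<forall>i. \<zeta> $ i < c" | i where "\<zeta> $ i \<ge> c"
      by (meson not_less)
    then show ?thesis
    proof cases
      case 1
      show ?thesis
      proof (cases "\<eta> < 1/2")
        case True
        have "?S = {}"
        proof -
          have "\<bar>\<zeta> \<bullet> reflect A y\<bar> \<le> 1/2" if y: "y \<in> big_cube 10" for y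
          proof -
            have "\<bar>\<zeta> \<bullet> reflect A y\<bar> \<le> (\<Sum>i\<in>UNIV. \<bar>\<zeta> $ i * reflect A y $ i\<bar>)"
              unfolding inner_cart_sum by (rule sum_abs)
            also have "\<dots> \<le> (\<Sum>i\<in>(UNIV::'n set). c * 11)"
            proof (rule sum_mono)
              fix i
              have "\<bar>reflect A y $ i\<bar> \<le> 11"
                using y[unfolded mem_big_cube, rule_format, of i] by (auto simp: reflect_def)
              then show "\<bar>\<zeta> $ i * reflect A y $ i\<bar> \<le> c * 11"
                using 1 nn unfolding abs_mult by (intro mult_mono) (auto simp: less_imp_le c less_eq_real_def)
            qed
            also have "\<dots> = 1/2" using d by (simp add: c_def d_def)
            finally show ?thesis .
          qed
          then show ?thesis using True unfolding strip_def by fastforce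
        qed
        then show ?thesis using V c \<eta> by simp
      next
        case False
        have "V \<le> 2 * V * \<eta>" using False V mult_left_mono[of "1/2" \<eta> "2*V"] by simp
        also have "\<dots> \<le> (6 * V / c + 2 * V + 1) * \<eta>"
          using V c \<eta> by (intro mult_right_mono) auto
        finally show ?thesis using SV by linarith
      qed
    next
      case 2
      \<comment> \<open>each translation changes the linear form by \<open>3 \<eta>\<close>, more than the width \<open>2 \<eta>\<close> of the strip, and
        the total length of the \<open>m\<close> translations is at most \<open>1\<close>\<close>
      define m where "m = nat \<lfloor>\<zeta> $ i / (3 * \<eta>)\<rfloor>"
      define v where "v = (3 * \<eta> / \<zeta> $ i) *\<^sub>R (axis i 1 :: real ^ 'n)"
      have zi: "\<zeta> $ i > 0" using 2 c by linarith
      have m_le: "real m \<le> \<zeta> $ i / (3 * \<eta>)"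
        unfolding m_def using zi \<eta> by simp
      have jle: "real j * (3 * \<eta> / \<zeta> $ i) \<le> 1" if "j < m" for j
      proof -
        have "real j \<le> \<zeta> $ i / (3 * \<eta>)" using that m_le by linarith
        then show ?thesis using zi \<eta> by (simp add: field_simps)
      qed
      have "m * measure lebesgue ?S \<le> V"
      proof (rule ccontr)
        assume "\<not> ?thesis"
        then have large: "V < m * measure lebesgue ?S" by simp
        obtain j where j: "0 < j" "j < m" "0 < measure lebesgue (?S \<inter> (+) (real j *\<^sub>R v) ` ?S)"
        proof (rule translates_overlap[of ?S "big_cube 11" m v 0], goal_cases)
          case (3 j)
          have "\<bar>(real j *\<^sub>R v + y) $ l\<bar> \<le> 11" if "y \<in> ?S" for y l
          proof -
            have "\<bar>y $ l\<bar> \<le> 10" using that by (simp add: strip_def mem_big_cube)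
            moreover have "\<bar>(real j *\<^sub>R v) $ l\<bar> \<le> 1"
              using jle[OF 3(2)] zi \<eta> by (simp add: v_def axis_def)
            ultimately show ?thesis by simp
          qed
          then show ?case by (auto simp: mem_big_cube)
        next
          case (6 j)
          then show ?case by blast
        qed (use large in \<open>auto simp: V_def\<close>)
        then obtain y where y: "y \<in> ?S" "real j *\<^sub>R v + y \<in> ?S"
          by (metis (no_types, lifting) Int_iff all_not_in_conv imageE less_irrefl measure_empty)
        have "\<bar>\<zeta> \<bullet> reflect A (real j *\<^sub>R v + y) - \<zeta> \<bullet> reflect A y\<bar> = real j * (3 * \<eta>)"
        proof -
          have eq: "real j *\<^sub>R v + y = y + (real j * (3 * \<eta> / \<zeta> $ i)) *\<^sub>R axis i 1"
            by (simp add: v_def)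
          show ?thesis
            unfolding eq reflect_add_axis using zi \<eta> by (simp add: inner_add_right inner_axis)
        qed
        moreover have "real j * (3 * \<eta>) \<ge> 3 * \<eta>" using j \<eta> by simp
        moreover have "\<bar>\<zeta> \<bullet> reflect A (real j *\<^sub>R v + y) - 1\<bar> \<le> \<eta>" "\<bar>\<zeta> \<bullet> reflect A y - 1\<bar> \<le> \<eta>"
          using y by (auto simp: strip_def)
        ultimately show False
          using \<eta> by linarith
      qed
      show ?thesis
      proof (cases "\<zeta> $ i \<ge> 3 * \<eta>")
        case True
        then have "\<zeta> $ i / (3 * \<eta>) \<ge> 1" using \<eta> by simp
        moreover have "\<zeta> $ i / (6 * \<eta>) = (\<zeta> $ i / (3 * \<eta>)) / 2" by simp
        moreover have "real m > \<zeta> $ i / (3 * \<eta>) - 1"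
          unfolding m_def using \<open>\<zeta> $ i / (3 * \<eta>) \<ge> 1\<close> by linarith+
        moreover have "real m \<ge> 1"
          using \<open>\<zeta> $ i / (3 * \<eta>) \<ge> 1\<close> by (cases m) (use \<open>real m > \<zeta> $ i / (3 * \<eta>) - 1\<close> in auto)
        ultimately have "real m \<ge> \<zeta> $ i / (6 * \<eta>)"
          by linarith
        then have "\<zeta> $ i / (6 * \<eta>) * measure lebesgue ?S \<le> V"
          using \<open>m * measure lebesgue ?S \<le> V\<close> mult_right_mono[of "\<zeta> $ i / (6 * \<eta>)" "real m" "measure lebesgue ?S"]
          by simp
        then have "measure lebesgue ?S \<le> 6 * V / \<zeta> $ i * \<eta>"
          using zi \<eta> by (simp add: field_simps)
        also have "\<dots> \<le> (6 * V / c) * \<eta>"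
          using 2 c V \<eta> by (intro mult_right_mono divide_left_mono) auto
        also have "\<dots> \<le> (6 * V / c + 2 * V + 1) * \<eta>"
          using V c \<eta> by (intro mult_right_mono) auto
        finally show ?thesis .
      next
        case False
        then have "1 \<le> 3 * \<eta> / c" using 2 c by (simp add: field_simps)
        then have "V \<le> 3 * \<eta> / c * V" using V mult_right_mono[of 1 "3 * \<eta> / c" V] by simp
        also have "\<dots> \<le> (6 * V / c) * \<eta>" using V c \<eta> by (simp add: field_simps)
        also have "\<dots> \<le> (6 * V / c + 2 * V + 1) * \<eta>"
          using V c \<eta> by (intro mult_right_mono) auto
        finally show ?thesis using SV by linarith
      qed
    qed
  qed
  then show ?thesis
    using V c by (intro exI[of _ "6 * V / c + 2 * V + 1"]) (auto simp: add_pos_nonneg add_nonneg_pos)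
qed

section \<open>Boxes of which a union of regions takes a given share\<close>

lemma abs_side_diff_le:
  fixes \<zeta> \<zeta>' y y' :: "real ^ 'n"
  shows "\<bar>side A s \<zeta> y - side A s \<zeta>' y'\<bar>
    \<le> \<bar>s\<bar> * (\<Sum>i\<in>UNIV. \<bar>\<zeta> $ i\<bar> * \<bar>y $ i - y' $ i\<bar> + \<bar>\<zeta> $ i - \<zeta>' $ i\<bar> * (1 + \<bar>y' $ i\<bar>))"
proof -
  have "side A s \<zeta> y - side A s \<zeta>' y'
      = s * (\<Sum>i\<in>UNIV. \<zeta> $ i * (reflect A y $ i - reflect A y' $ i) + (\<zeta> $ i - \<zeta>' $ i) * reflect A y' $ i)"
    by (simp add: side_def inner_cart_sum algebra_simps sum.distrib sum_subtractf)
  also have "\<bar>\<dots>\<bar> \<le> \<bar>s\<bar> * (\<Sum>i\<in>UNIV. \<bar>\<zeta> $ i * (reflect A y $ i - reflect A y' $ i) + (\<zeta> $ i - \<zeta>' $ i) * reflect A y' $ i\<bar>)"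
    unfolding abs_mult by (intro mult_left_mono sum_abs) auto
  also have "\<dots> \<le> \<bar>s\<bar> * (\<Sum>i\<in>UNIV. \<bar>\<zeta> $ i\<bar> * \<bar>y $ i - y' $ i\<bar> + \<bar>\<zeta> $ i - \<zeta>' $ i\<bar> * (1 + \<bar>y' $ i\<bar>))"
  proof (intro mult_left_mono sum_mono)
    fix i
    have "\<bar>reflect A y $ i - reflect A y' $ i\<bar> = \<bar>y $ i - y' $ i\<bar>" "\<bar>reflect A y' $ i\<bar> \<le> 1 + \<bar>y' $ i\<bar>"
      by (auto simp: reflect_def)
    then have "\<bar>\<zeta> $ i * (reflect A y $ i - reflect A y' $ i)\<bar> \<le> \<bar>\<zeta> $ i\<bar> * \<bar>y $ i - y' $ i\<bar>"
      "\<bar>(\<zeta> $ i - \<zeta>' $ i) * reflect A y' $ i\<bar> \<le> \<bar>\<zeta> $ i - \<zeta>' $ i\<bar> * (1 + \<bar>y' $ i\<bar>)"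
      by (simp_all add: abs_mult mult_left_mono)
    then show "\<bar>\<zeta> $ i * (reflect A y $ i - reflect A y' $ i) + (\<zeta> $ i - \<zeta>' $ i) * reflect A y' $ i\<bar>
       \<le> \<bar>\<zeta> $ i\<bar> * \<bar>y $ i - y' $ i\<bar> + \<bar>\<zeta> $ i - \<zeta>' $ i\<bar> * (1 + \<bar>y' $ i\<bar>)"
      by linarith
  qed auto
  finally show ?thesis .
qed

text \<open>The pattern of a point records on which side of the \<open>t\<close> hyperplanes it lies; the parts of a
  splitting are given by sets of patterns.\<close>

definition pattern :: "nat \<Rightarrow> (nat \<Rightarrow> 'n set) \<Rightarrow> (nat \<Rightarrow> real) \<Rightarrow> (nat \<Rightarrow> real ^ 'n) \<Rightarrow> real ^ 'n \<Rightarrow> nat set" where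
  "pattern t As ss Zs y = {j. j < t \<and> side (As j) (ss j) (Zs j) y > 0}"

lemma borel_measurable_side [measurable]: "side A s \<zeta> \<in> borel_measurable borel"
  unfolding side_def by (intro borel_measurable_continuous_onI continuous_intros)

lemma sets_borel_pattern: "{y. L (pattern t As ss Zs y)} \<in> sets borel"
proof -
  have "{y. L (pattern t As ss Zs y)} =
      (\<Union>X\<in>{X\<in>Pow {..<t}. L X}. {y. \<forall>j\<in>{..<t}. (side (As j) (ss j) (Zs j) y > 0) = (j \<in> X)})"
    (is "?l = ?r")
  proof (intro equalityI subsetI)
    fix y assume "y \<in> ?l"
    then show "y \<in> ?r"
      by (intro UN_I[of "pattern t As ss Zs y"]) (auto simp: pattern_def)
  next
    fix y assume "y \<in> ?r"
    then obtain X where X: "X \<subseteq> {..<t}" "L X" "\<forall>j\<in>{..<t}. (side (As j) (ss j) (Zs j) y > 0) = (j \<in> X)"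
      by auto
    then have "pattern t As ss Zs y = X" by (auto simp: pattern_def)
    with X show "y \<in> ?l" by simp
  qed
  also have "\<dots> \<in> sets borel"
    by (intro sets.finite_UN) auto
  finally show ?thesis .
qed

lemma sets_pattern: "{y. L (pattern t As ss Zs y)} \<in> sets lebesgue"
  using sets_borel_pattern[of L t As ss Zs] by (auto intro: sets_completionI_sets)

text \<open>Every set of large measure contains all the corners of a box whose sides are neither too
  long nor too short: apply the pigeonhole principle to one coordinate after the other.\<close>

lemma boxes_in_large_sets:
  fixes \<epsilon> \<eta> :: real and S :: "'n::finite set"
  assumes "\<epsilon> > 0" "\<eta> > 0"
  shows "\<exists>\<kappa>>0. \<exists>h>0. \<forall>E :: (real ^ 'n) set. E \<in> lmeasurable \<longrightarrow> E \<subseteq> big_cube 3 \<longrightarrow> \<epsilon> \<le> measure lebesgue E \<longrightarrow>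
     (\<exists>w F. F \<in> lmeasurable \<and> \<kappa> \<le> measure lebesgue F \<and> (\<forall>i\<in>S. h \<le> w i \<and> w i \<le> \<eta>) \<and>
        (\<forall>z\<in>F. \<forall>I\<subseteq>S. z + (\<chi> i. if i \<in> I then w i else 0) \<in> E))"
  using finite[of S]
proof (induction S rule: finite_induct)
  case empty
  have z: "(\<chi> i. 0) = (0 :: real ^ 'n)" by (simp add: vec_eq_iff)
  show ?case
    using assms by (intro exI[of _ \<epsilon>] exI[of _ 1] conjI allI impI exI[of _ "\<lambda>_. 1"] exI[of _ "_::(real^'n) set"]) (auto simp: z)
next
  case (insert s S)
  from insert.IH obtain \<kappa> h where \<kappa>: "\<kappa> > 0" and h: "h > 0" and
    IH: "\<And>E :: (real ^ 'n) set. E \<in> lmeasurable \<Longrightarrow> E \<subseteq> big_cube 3 \<Longrightarrow> \<epsilon> \<le> measure lebesgue E \<Longrightarrow>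
     (\<exists>w F. F \<in> lmeasurable \<and> \<kappa> \<le> measure lebesgue F \<and> (\<forall>i\<in>S. h \<le> w i \<and> w i \<le> \<eta>) \<and>
        (\<forall>z\<in>F. \<forall>I\<subseteq>S. z + (\<chi> i. if i \<in> I then w i else 0) \<in> E))"
    by blast
  define V where "V = measure lebesgue (big_cube (3 + \<eta>) :: (real ^ 'n) set) + 1"
  obtain m :: nat where m: "2 * V / \<kappa> < m" using reals_Archimedean2 by blast
  have V: "V \<ge> 1" by (simp add: V_def)
  have "2 * V / \<kappa> > 0" using V \<kappa> by simp
  then have m0: "m > 0" using m by (cases m) auto
  define v :: "real ^ 'n" where "v = (\<eta> / m) *\<^sub>R axis s 1"
  \<comment> \<open>chosen such that \<open>m\<^sup>2 \<kappa>'\<close> and the volume of the region sum to less than \<open>m \<kappa>\<close>\<close>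
  define \<kappa>' where "\<kappa>' = V / m\<^sup>2"
  have \<kappa>': "\<kappa>' > 0" using V m0 by (simp add: \<kappa>'_def)
  have "\<exists>w F. F \<in> lmeasurable \<and> \<kappa>' \<le> measure lebesgue F \<and> (\<forall>i\<in>insert s S. min h (\<eta> / m) \<le> w i \<and> w i \<le> \<eta>) \<and>
        (\<forall>z\<in>F. \<forall>I\<subseteq>insert s S. z + (\<chi> i. if i \<in> I then w i else 0) \<in> E)"
    if E: "E \<in> lmeasurable" "E \<subseteq> big_cube 3" "\<epsilon> \<le> measure lebesgue E" for E :: "(real ^ 'n) set"
  proof -
    obtain w F where F: "F \<in> lmeasurable" "\<kappa> \<le> measure lebesgue F" and w: "\<And>i. i \<in> S \<Longrightarrow> h \<le> w i \<and> w i \<le> \<eta>"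
      and corners: "\<And>z I. z \<in> F \<Longrightarrow> I \<subseteq> S \<Longrightarrow> z + (\<chi> i. if i \<in> I then w i else 0) \<in> E"
      using IH[OF E] by blast
    have z0: "(\<chi> i. 0) = (0 :: real ^ 'n)" by (simp add: vec_eq_iff)
    have "F \<subseteq> E" using corners[of _ "{}"] by (auto simp: z0)
    have jm: "real j * (\<eta> / m) \<le> \<eta>" if "j < m" for j
      using that assms m0 by (simp add: field_simps)
    obtain j where j: "0 < j" "j < m" "\<kappa>' < measure lebesgue (F \<inter> (+) (real j *\<^sub>R v) ` F)"
    proof (rule translates_overlap[OF F(1) big_cube_lmeasurable[of "3 + \<eta>"], of m v \<kappa>'])
      fix j assume j: "j < m"
      show "(+) (real j *\<^sub>R v) ` F \<subseteq> big_cube (3 + \<eta>)"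
      proof (clarsimp simp: mem_big_cube)
        fix y i assume "y \<in> F"
        then have "\<bar>y $ i\<bar> \<le> 3" using \<open>F \<subseteq> E\<close> E(2) by (auto simp: subset_eq mem_big_cube)
        moreover have "\<bar>real j * v $ i\<bar> \<le> \<eta>"
          using jm[OF j] assms by (simp add: v_def axis_def)
        ultimately show "\<bar>real j * v $ i + y $ i\<bar> \<le> 3 + \<eta>" by linarith
      qed
    next
      have "2 * V < m * \<kappa>" using m \<kappa> by (simp add: field_simps)
      also have "\<dots> \<le> m * measure lebesgue F" using F by (intro mult_left_mono) auto
      finally show "measure lebesgue (big_cube (3 + \<eta>) :: (real ^ 'n) set) + (real m)\<^sup>2 * \<kappa>' < m * measure lebesgue F"
        using m0 by (simp add: \<kappa>'_def V_def)
    qed (use \<kappa>' in auto)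
    define F' where "F' = (+) (- (real j *\<^sub>R v)) ` (F \<inter> (+) (real j *\<^sub>R v) ` F)"
    have F': "z \<in> F" "z + real j *\<^sub>R v \<in> F" if "z \<in> F'" for z
    proof -
      have "z \<in> F \<and> real j *\<^sub>R v + z \<in> F" using that by (auto simp: F'_def)
      then show "z \<in> F" "z + real j *\<^sub>R v \<in> F" by (simp_all add: add.commute)
    qed
    define w' where "w' = w(s := j * (\<eta> / m))"
    have "z + (\<chi> i. if i \<in> I then w' i else 0) \<in> E" if z: "z \<in> F'" and I: "I \<subseteq> insert s S" for z I
    proof (cases "s \<in> I")
      case True
      have eq: "z + (\<chi> i. if i \<in> I then w' i else 0)
          = (z + real j *\<^sub>R v) + (\<chi> i. if i \<in> I - {s} then w i else 0)"
        using True by (auto simp: vec_eq_iff v_def axis_def w'_def)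
      show ?thesis unfolding eq by (rule corners[OF F'(2)[OF z]]) (use I in auto)
    next
      case False
      then have "(\<chi> i. if i \<in> I then w' i else 0) = (\<chi> i. if i \<in> I then w i else 0)"
        by (auto simp: vec_eq_iff w'_def)
      then show ?thesis using corners[OF F'(1)[OF z], of I] I False by auto
    qed
    moreover have "F' \<in> lmeasurable" "\<kappa>' \<le> measure lebesgue F'"
    proof -
      have "F \<inter> (+) (real j *\<^sub>R v) ` F \<in> lmeasurable"
        using F(1) by (intro fmeasurable.Int measurable_translation)
      then show "F' \<in> lmeasurable" unfolding F'_def by (rule measurable_translation)
      show "\<kappa>' \<le> measure lebesgue F'" using j unfolding F'_def measure_translation by simp
    qed
    moreover have "min h (\<eta> / m) \<le> w' i \<and> w' i \<le> \<eta>" if "i \<in> insert s S" for i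
    proof (cases "i = s")
      case True
      have "\<eta> / m \<le> j * (\<eta> / m)" using j assms m0 by (simp add: field_simps)
      then show ?thesis using True jm[OF j(2)] by (auto simp: w'_def)
    next
      case False
      then show ?thesis using w[of i] that by (auto simp: w'_def)
    qed
    ultimately show ?thesis by blast
  qed
  moreover have "min h (\<eta> / m) > 0" using h m0 assms by simp
  ultimately show ?case
    using \<kappa>' by blast
qed

definition half_open_box :: "'n set \<Rightarrow> real ^ 'n \<Rightarrow> ('n \<Rightarrow> real) \<Rightarrow> 'n set \<Rightarrow> (real ^ 'n) set" where
  "half_open_box T z w I = {x. \<forall>i. if i \<in> T then z $ i < x $ i \<and> x $ i \<le> z $ i + w i
     else 0 \<le> x $ i \<and> x $ i \<le> z $ i + (if i \<in> I then w i else 0)}"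

text \<open>For the signed measure \<open>\<rho>\<close>, the alternating sum of \<open>\<rho> [0, z + w\<^sub>I]\<close> over the corners
  \<open>z + w\<^sub>I\<close> of a box is the value of \<open>\<rho>\<close> on the box. The induction treats the coordinates one by
  one: each step is a difference of two sets that agree in all other coordinates.\<close>

lemma mixed_difference_bound:
  fixes c :: real and P :: "(real ^ 'n) set" and z :: "real ^ 'n" and w :: "'n \<Rightarrow> real"
  defines "\<rho> \<equiv> \<lambda>X. measure lebesgue (P \<inter> X) - c * measure lebesgue X"
  assumes P: "P \<in> sets lebesgue" and z: "\<And>i. 0 \<le> z $ i" and w: "\<And>i. 0 \<le> w i"
    and corner: "\<And>I. \<bar>\<rho> (cbox 0 (z + (\<chi> i. if i \<in> I then w i else 0)))\<bar> \<le> \<delta>"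
  shows "half_open_box T z w I \<in> lmeasurable \<and>
    (I \<inter> T = {} \<longrightarrow> \<bar>\<rho> (half_open_box T z w I)\<bar> \<le> 2 ^ card T * \<delta>)"
  using finite[of T]
proof (induction T arbitrary: I rule: finite_induct)
  case empty
  have "half_open_box {} z w I = cbox 0 (z + (\<chi> i. if i \<in> I then w i else 0))"
    unfolding half_open_box_def mem_box_cart set_eq_iff by simp
  then show ?case using corner[of I] by simp
next
  case (insert s T)
  let ?X = "half_open_box T z w (insert s I)" and ?Y = "half_open_box T z w (I - {s})"
  have X: "?X \<in> lmeasurable" and Y: "?Y \<in> lmeasurable" using insert.IH by auto
  have XY: "?Y \<subseteq> ?X" 
    using z w unfolding half_open_box_def
    by (auto split: if_splits) (smt (verit, best))+
  have eq: "half_open_box (insert s T) z w I = ?X - ?Y"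
  proof (intro equalityI subsetI)
    fix x assume x: "x \<in> half_open_box (insert s T) z w I"
    have "x \<in> ?X"
      unfolding half_open_box_def
    proof (clarify)
      fix i
      show "if i \<in> T then z $ i < x $ i \<and> x $ i \<le> z $ i + w i
       else 0 \<le> x $ i \<and> x $ i \<le> z $ i + (if i \<in> insert s I then w i else 0)"
        using x[unfolded half_open_box_def, simplified, rule_format, of i] z[of i]
        by (auto split: if_splits)
    qed
    moreover have "x \<notin> ?Y"
      using x[unfolded half_open_box_def, simplified, rule_format, of s] insert.hyps
      by (auto simp: half_open_box_def intro!: exI[of _ s])
    ultimately show "x \<in> ?X - ?Y" by blast
  next
    fix x assume x: "x \<in> ?X - ?Y"
    have X: "if i \<in> T then z $ i < x $ i \<and> x $ i \<le> z $ i + w i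
       else 0 \<le> x $ i \<and> x $ i \<le> z $ i + (if i \<in> insert s I then w i else 0)" for i
      using spec[OF DiffD1[OF x, unfolded half_open_box_def mem_Collect_eq], of i] .
    have "\<not> x $ s \<le> z $ s"
    proof
      assume "x $ s \<le> z $ s"
      then have "x \<in> ?Y"
        unfolding half_open_box_def
      proof (clarify)
        fix i
        show "if i \<in> T then z $ i < x $ i \<and> x $ i \<le> z $ i + w i
          else 0 \<le> x $ i \<and> x $ i \<le> z $ i + (if i \<in> I - {s} then w i else 0)"
          using X[of i] \<open>x $ s \<le> z $ s\<close> by (auto split: if_splits)
      qed
      with x show False by blast
    qed
    then show "x \<in> half_open_box (insert s T) z w I"
      unfolding half_open_box_def
    proof (clarify)
      fix i
      show "if i \<in> insert s T then z $ i < x $ i \<and> x $ i \<le> z $ i + w i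
          else 0 \<le> x $ i \<and> x $ i \<le> z $ i + (if i \<in> I then w i else 0)"
        using X[of i] \<open>\<not> x $ s \<le> z $ s\<close> by (auto split: if_splits)
    qed
  qed
  have "\<bar>\<rho> (?X - ?Y)\<bar> \<le> 2 ^ card (insert s T) * \<delta>" if I: "I \<inter> insert s T = {}"
  proof -
    have "measure lebesgue (?X - ?Y) = measure lebesgue ?X - measure lebesgue ?Y"
      by (rule measurable_measure_Diff[OF X _ XY]) (use Y in auto)
    moreover have "measure lebesgue (P \<inter> (?X - ?Y)) = measure lebesgue (P \<inter> ?X) - measure lebesgue (P \<inter> ?Y)"
    proof -
      have "P \<inter> ?X \<in> lmeasurable" "P \<inter> ?Y \<in> lmeasurable"
        using fmeasurable_Int_fmeasurable[OF X P] fmeasurable_Int_fmeasurable[OF Y P]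
        by (simp_all add: Int_commute)
      then show ?thesis
        using measurable_measure_Diff[of "P \<inter> ?X" lebesgue "P \<inter> ?Y"] XY
        by (auto simp: Diff_Int_distrib)
    qed
    ultimately have "\<rho> (?X - ?Y) = \<rho> ?X - \<rho> ?Y"
      by (simp add: \<rho>_def right_diff_distrib)
    moreover have "\<bar>\<rho> ?X\<bar> \<le> 2 ^ card T * \<delta>" "\<bar>\<rho> ?Y\<bar> \<le> 2 ^ card T * \<delta>"
      using insert.IH I insert.hyps by auto
    ultimately show ?thesis
      using insert.hyps by simp
  qed
  then show ?case
    using X Y by (auto simp: eq fmeasurable.Diff)
qed

lemma measure_half_open_box:
  assumes "\<And>i. 0 < w i"
  shows "measure lebesgue (half_open_box UNIV z w I) = (\<Prod>i\<in>UNIV. w i)"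
proof -
  let ?B = "half_open_box UNIV z w I" and ?w = "z + (\<chi> i. w i)"
  have sub: "box z ?w \<subseteq> ?B" "?B \<subseteq> cbox z ?w"
    by (auto simp: half_open_box_def mem_box_cart less_imp_le)
  have c: "measure lebesgue (cbox z ?w) = (\<Prod>i\<in>UNIV. w i)"
    unfolding measure_completion[OF borel_closed[OF closed_cbox, folded sets_lborel]]
    using assms by (subst content_cbox_cart) (auto simp: interval_ne_empty_cart less_imp_le)
  have "negligible (cbox z ?w - box z ?w)" by (rule negligible_frontier_interval)
  then have "negligible (cbox z ?w - ?B \<union> (?B - cbox z ?w))"
    using sub by (auto elim: negligible_subset)
  then show ?thesis
    using measure_negligible_symdiff[OF lmeasurable_cbox, of z ?w ?B] c by simp
qed

text \<open>For a fixed arrangement, the equation that a union of regions takes the share \<open>c\<close> of the box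
  \<open>[0, z]\<close> determines a thin set of points \<open>z\<close>. Otherwise it would approximately hold at all corners of
  some box not met by the hyperplanes, and by taking the mixed difference the union would
  approximately take the share \<open>c\<close> of that box, of which it takes everything or nothing. The
  bound has to be uniform in the arrangement, because it will be applied to all the arrangements
  of a grid whose mesh depends on it.\<close>

lemma fair_boxes_thin:
  fixes c \<epsilon> :: real
  assumes c: "0 < c" "c < 1" and \<epsilon>: "\<epsilon> > 0"
  shows "\<exists>\<delta>>0. \<forall>As ss (Zs :: nat \<Rightarrow> real ^ 'n) L E.
     (\<forall>j<t. ss j \<in> {1, - 1} \<and> (\<forall>i. 0 \<le> Zs j $ i \<and> Zs j $ i \<le> 2)) \<longrightarrow>
     E \<in> lmeasurable \<longrightarrow> E \<subseteq> {z. \<forall>i. 0 \<le> z $ i \<and> z $ i \<le> 3} \<longrightarrow>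
     (\<forall>z\<in>E. \<bar>measure lebesgue ({y. L (pattern t As ss Zs y)} \<inter> cbox 0 z)
               - c * measure lebesgue (cbox 0 z)\<bar> \<le> \<delta>) \<longrightarrow>
     measure lebesgue E < \<epsilon>"
proof -
  define d where "d = real CARD('n)"
  have d: "d \<ge> 1" by (simp add: d_def Suc_leI)
  obtain C where C: "C > 0" "\<And>A (\<zeta> :: real ^ 'n) \<eta>. \<eta> > 0 \<Longrightarrow> (\<And>i. 0 \<le> \<zeta> $ i) \<Longrightarrow>
      measure lebesgue (strip A \<zeta> \<eta>) \<le> C * \<eta>"
    using measure_strip_le by metis
  define \<eta>\<^sub>0 where "\<eta>\<^sub>0 = \<epsilon> / (2 * (t * C + 1))"
  \<comment> \<open>a point at distance more than \<open>\<eta>\<^sub>0\<close> from the hyperplanes, in terms of \<^const>\<open>side\<close>, has the same pattern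
    as all points at distance at most \<open>\<eta>\<close> from it in each coordinate\<close>
  define \<eta> where "\<eta> = \<eta>\<^sub>0 / (4 * d)"
  have \<eta>0: "\<eta>\<^sub>0 > 0" using \<epsilon> C by (simp add: \<eta>\<^sub>0_def add_nonneg_pos)
  have \<eta>: "\<eta> > 0" using \<eta>0 d by (simp add: \<eta>_def)
  have half: "t * (C * \<eta>\<^sub>0) \<le> \<epsilon> / 2"
  proof -
    have "t * C / (t * C + 1) \<le> 1" using C by (simp add: add_nonneg_pos)
    then have "t * C / (t * C + 1) * (\<epsilon> / 2) \<le> 1 * (\<epsilon> / 2)" using \<epsilon> by (intro mult_right_mono) auto
    then show ?thesis by (simp add: \<eta>\<^sub>0_def field_simps)
  qed
  obtain \<kappa> h where \<kappa>: "\<kappa> > 0" and h: "h > 0" and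
    boxes: "\<And>E :: (real ^ 'n) set. E \<in> lmeasurable \<Longrightarrow> E \<subseteq> big_cube 3 \<Longrightarrow> \<epsilon> / 2 \<le> measure lebesgue E \<Longrightarrow>
     (\<exists>w F. F \<in> lmeasurable \<and> \<kappa> \<le> measure lebesgue F \<and> (\<forall>i\<in>UNIV. h \<le> w i \<and> w i \<le> \<eta>) \<and>
        (\<forall>z\<in>F. \<forall>I\<subseteq>UNIV. z + (\<chi> i. if i \<in> I then w i else 0) \<in> E))"
    using boxes_in_large_sets[of "\<epsilon> / 2" \<eta> "UNIV :: 'n set"] \<epsilon> \<eta> by auto
  define c' where "c' = min c (1 - c)"
  have c': "c' > 0" using c by (simp add: c'_def)
  define \<delta> where "\<delta> = c' * h ^ CARD('n) / (2 * 2 ^ CARD('n))"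
  have \<delta>: "\<delta> > 0" using c' h by (simp add: \<delta>_def)
  have key: "measure lebesgue E < \<epsilon>"
    if Z: "\<And>j. j < t \<Longrightarrow> ss j \<in> {1, - 1}" "\<And>j i. j < t \<Longrightarrow> 0 \<le> Zs j $ i \<and> Zs j $ i \<le> 2"
      and E: "E \<in> lmeasurable" "E \<subseteq> {z. \<forall>i. 0 \<le> z $ i \<and> z $ i \<le> 3}"
      and fair: "\<And>z. z \<in> E \<Longrightarrow> \<bar>measure lebesgue ({y. L (pattern t As ss Zs y)} \<inter> cbox 0 z)
               - c * measure lebesgue (cbox 0 z)\<bar> \<le> \<delta>"
    for As ss and Zs :: "nat \<Rightarrow> real ^ 'n" and L E
  proof (rule ccontr)
    assume "\<not> ?thesis"
    then have large: "measure lebesgue E \<ge> \<epsilon>" by simp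
    define P where "P = {y. L (pattern t As ss Zs y)}"
    define W where "W = (\<Union>j<t. strip (As j) (Zs j) \<eta>\<^sub>0)"
    have W: "W \<in> lmeasurable" unfolding W_def by (intro fmeasurable.finite_UN) auto
    have "measure lebesgue W \<le> (\<Sum>j<t. measure lebesgue (strip (As j) (Zs j) \<eta>\<^sub>0))"
      unfolding W_def by (intro measure_UNION_le) (auto intro: fmeasurableD)
    also have "\<dots> \<le> (\<Sum>j<t. C * \<eta>\<^sub>0)" using Z \<eta>0 by (intro sum_mono C) auto
    also have "\<dots> \<le> \<epsilon> / 2" using half by simp
    finally have W_le: "measure lebesgue W \<le> \<epsilon> / 2" .
    have "measure lebesgue E \<le> measure lebesgue ((E - W) \<union> W)"
      using E W by (intro measure_mono_fmeasurable fmeasurable.Un fmeasurable.Diff) auto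
    also have "\<dots> \<le> measure lebesgue (E - W) + measure lebesgue W"
      using E W by (intro measure_Un_le) auto
    finally have "\<epsilon> / 2 \<le> measure lebesgue (E - W)" using large W_le by linarith
    moreover have "E - W \<subseteq> big_cube 3" using E(2) by (force simp: mem_big_cube)
    moreover have "E - W \<in> lmeasurable" using E W by (intro fmeasurable.Diff) auto
    ultimately obtain w F where F: "F \<in> lmeasurable" "\<kappa> \<le> measure lebesgue F"
      and w': "\<forall>i\<in>UNIV. h \<le> w i \<and> w i \<le> \<eta>"
      and corners': "\<forall>z\<in>F. \<forall>I\<subseteq>UNIV. z + (\<chi> i. if i \<in> I then w i else 0) \<in> E - W"
      using boxes[of "E - W"] by blast
    have w: "h \<le> w i" "w i \<le> \<eta>" for i using w' by simp_all
    have corners: "z + (\<chi> i. if i \<in> I then w i else 0) \<in> E - W" if "z \<in> F" for z I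
      using corners' that by blast
    obtain z where "z \<in> F" using F \<kappa> by (metis all_not_in_conv measure_empty not_less)
    note corner = corners[OF this]
    have z0: "(\<chi> i. 0) = (0 :: real ^ 'n)" by (simp add: vec_eq_iff)
    have zE: "z \<in> E" "z \<notin> W" using corner[of "{}"] by (simp_all add: z0)
    have z: "0 \<le> z $ i" "z $ i \<le> 3" for i using zE E(2) by auto
    have w0: "w i > 0" for i using h w(1)[of i] by linarith
    let ?B = "half_open_box UNIV z w {}"
    have "P \<in> sets lebesgue" unfolding P_def by (rule sets_pattern)
    then have B: "?B \<in> lmeasurable"
      "\<bar>measure lebesgue (P \<inter> ?B) - c * measure lebesgue ?B\<bar> \<le> 2 ^ CARD('n) * \<delta>"
      using mixed_difference_bound[of P z w c \<delta> UNIV "{}"] z w0 fair corner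
      by (auto simp: P_def less_imp_le)
    have same: "pattern t As ss Zs y = pattern t As ss Zs z" if y: "y \<in> ?B" for y
    proof -
      have "(side (As j) (ss j) (Zs j) y > 0) = (side (As j) (ss j) (Zs j) z > 0)" if j: "j < t" for j
      proof -
        have "z \<notin> strip (As j) (Zs j) \<eta>\<^sub>0" using zE(2) j by (auto simp: W_def)
        moreover have "z \<in> big_cube 10" unfolding mem_big_cube
        proof
          show "\<bar>z $ i\<bar> \<le> 10" for i using z[of i] by linarith
        qed
        ultimately have "\<bar>side (As j) (ss j) (Zs j) z\<bar> > \<eta>\<^sub>0"
          using Z(1)[OF j] by (auto simp: strip_def side_def abs_mult)
        moreover have "\<bar>side (As j) (ss j) (Zs j) z - side (As j) (ss j) (Zs j) y\<bar> \<le> \<eta>\<^sub>0 / 2"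
        proof -
          have "\<bar>side (As j) (ss j) (Zs j) z - side (As j) (ss j) (Zs j) y\<bar>
              \<le> \<bar>ss j\<bar> * (\<Sum>i\<in>UNIV. \<bar>Zs j $ i\<bar> * \<bar>z $ i - y $ i\<bar>)"
            using abs_side_diff_le[of "As j" "ss j" "Zs j" z "Zs j" y] by simp
          also have "\<bar>ss j\<bar> = 1" using Z(1)[OF j] by auto
          also have "1 * (\<Sum>i\<in>UNIV. \<bar>Zs j $ i\<bar> * \<bar>z $ i - y $ i\<bar>) \<le> 1 * (\<Sum>i\<in>(UNIV::'n set). 2 * \<eta>)"
          proof (intro mult_mono sum_mono)
            fix i
            have "z $ i < y $ i" "y $ i \<le> z $ i + w i" using y by (auto simp: half_open_box_def)
            then show "\<bar>z $ i - y $ i\<bar> \<le> \<eta>" using w(2)[of i] by linarith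
          qed (use Z(2)[OF j] \<eta> in \<open>auto intro!: sum_nonneg\<close>)
          also have "\<dots> = \<eta>\<^sub>0 / 2" using d by (simp add: \<eta>_def d_def)
          finally show ?thesis .
        qed
        ultimately show ?thesis using \<eta>0 by linarith
      qed
      then show ?thesis by (auto simp: pattern_def)
    qed
    define \<beta> where "\<beta> = measure lebesgue ?B"
    have "\<beta> \<ge> 0" by (simp add: \<beta>_def)
    have "measure lebesgue (P \<inter> ?B) = \<beta> \<or> measure lebesgue (P \<inter> ?B) = 0"
    proof (cases "z \<in> P")
      case True
      then have "P \<inter> ?B = ?B" using same by (auto simp: P_def)
      then show ?thesis by (simp add: \<beta>_def)
    next
      case False
      then have "P \<inter> ?B = {}" using same by (auto simp: P_def)
      then show ?thesis by simp
    qed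
    moreover have "c' * \<beta> \<le> \<beta> - c * \<beta>" "c' * \<beta> \<le> c * \<beta>"
    proof -
      have "c' * \<beta> \<le> (1 - c) * \<beta>" "c' * \<beta> \<le> c * \<beta>"
        using \<open>\<beta> \<ge> 0\<close> unfolding c'_def by (intro mult_right_mono; simp)+
      then show "c' * \<beta> \<le> \<beta> - c * \<beta>" "c' * \<beta> \<le> c * \<beta>" by (simp_all add: left_diff_distrib)
    qed
    ultimately have "\<bar>measure lebesgue (P \<inter> ?B) - c * \<beta>\<bar> \<ge> c' * \<beta>"
      by linarith
    moreover have "\<beta> \<ge> h ^ CARD('n)"
      unfolding \<beta>_def measure_half_open_box[OF w0]
      using prod_mono[of UNIV "\<lambda>_. h" w] w h by (auto simp: less_imp_le)
    then have "c' * \<beta> \<ge> c' * h ^ CARD('n)"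
      using c' by (intro mult_left_mono) auto
    moreover have "2 ^ CARD('n) * \<delta> = c' * h ^ CARD('n) / 2"
      by (simp add: \<delta>_def)
    moreover have "c' * h ^ CARD('n) > 0" using c' h by simp
    ultimately show False using B(2) unfolding \<beta>_def[symmetric] by linarith
  qed
  show ?thesis
  proof (intro exI[of _ \<delta>] conjI allI impI \<delta>)
    fix As ss and Zs :: "nat \<Rightarrow> real ^ 'n" and L E
    assume "\<forall>j<t. ss j \<in> {1, - 1} \<and> (\<forall>i. 0 \<le> Zs j $ i \<and> Zs j $ i \<le> 2)"
      and "E \<in> lmeasurable" "E \<subseteq> {z. \<forall>i. 0 \<le> z $ i \<and> z $ i \<le> 3}"
      and "\<forall>z\<in>E. \<bar>measure lebesgue ({y. L (pattern t As ss Zs y)} \<inter> cbox 0 z)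
               - c * measure lebesgue (cbox 0 z)\<bar> \<le> \<delta>"
    then show "measure lebesgue E < \<epsilon>"
      using key[of ss Zs E L As] by blast
  qed
qed

section \<open>Parts of a necklace in adapted coordinates\<close>

definition ncube :: "real ^ 'n \<Rightarrow> real \<Rightarrow> (real ^ 'n) set" where
  "ncube a r = cbox a (a + (\<chi> i. r))"

text \<open>Coordinates in which the necklace with lower corner \<open>a\<close> and side \<open>r\<close> is the box \<open>[0, z]\<close>, the corner
  \<open>A\<^sub>0\<close> of the necklace being the origin.\<close>

definition coord :: "'n set \<Rightarrow> real ^ 'n \<Rightarrow> real \<Rightarrow> real ^ 'n \<Rightarrow> real ^ 'n \<Rightarrow> real ^ 'n" where
  "coord A\<^sub>0 a r z x = (\<chi> i. z $ i * reflect A\<^sub>0 ((1 / r) *\<^sub>R (x - a)) $ i)"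

definition framed_part :: "'n set \<Rightarrow> real ^ 'n \<Rightarrow> real \<Rightarrow> real ^ 'n \<Rightarrow> nat \<Rightarrow> (nat \<Rightarrow> 'n set) \<Rightarrow> (nat \<Rightarrow> real)
    \<Rightarrow> (nat \<Rightarrow> real ^ 'n) \<Rightarrow> (nat set \<Rightarrow> bool) \<Rightarrow> (real ^ 'n) set" where
  "framed_part A\<^sub>0 a r z t As ss Zs L = {x \<in> ncube a r. L (pattern t As ss Zs (coord A\<^sub>0 a r z x))}"

lemma ncube_lmeasurable [simp]: "ncube a r \<in> lmeasurable"
  by (simp add: ncube_def)

lemma mem_ncube:
  assumes "r > 0"
  shows "x \<in> ncube a r \<longleftrightarrow> (\<forall>i. 0 \<le> (x $ i - a $ i) / r \<and> (x $ i - a $ i) / r \<le> 1)"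
  using assms by (auto simp: ncube_def mem_box_cart field_simps)

lemma measure_ncube: "r > 0 \<Longrightarrow> measure lebesgue (ncube (a :: real ^ 'n) r) = r ^ CARD('n)"
  unfolding ncube_def measure_completion[OF borel_closed[OF closed_cbox, folded sets_lborel]]
  by (subst content_cbox_cart) (auto simp: interval_ne_empty_cart less_imp_le)

lemma coord_component: "coord A\<^sub>0 a r z x $ i =
    z $ i * (if i \<in> A\<^sub>0 then 1 - (x $ i - a $ i) / r else (x $ i - a $ i) / r)"
  by (simp add: coord_def reflect_def)

lemma borel_measurable_coord [measurable]: "coord A\<^sub>0 a r z \<in> borel_measurable borel"
proof -
  have "continuous_on UNIV (\<lambda>x. reflect A\<^sub>0 ((1 / r) *\<^sub>R (x - a)))"
    by (rule continuous_on_compose2[OF continuous_on_reflect[of UNIV]]) (auto intro!: continuous_intros)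
  then show ?thesis
    unfolding coord_def by (intro borel_measurable_continuous_onI continuous_intros)
qed

lemma framed_part_lmeasurable [simp]: "framed_part A\<^sub>0 a r z t As ss Zs L \<in> lmeasurable"
proof -
  have "coord A\<^sub>0 a r z -` {y. L (pattern t As ss Zs y)} \<in> sets borel"
    using measurable_sets_borel[OF borel_measurable_coord sets_borel_pattern] .
  then have "ncube a r \<inter> coord A\<^sub>0 a r z -` {y. L (pattern t As ss Zs y)} \<in> lmeasurable"
    by (intro fmeasurable_Int_fmeasurable) auto
  moreover have "framed_part A\<^sub>0 a r z t As ss Zs L = ncube a r \<inter> coord A\<^sub>0 a r z -` {y. L (pattern t As ss Zs y)}"
    by (auto simp: framed_part_def)
  ultimately show ?thesis by simp
qed

lemma measure_coord_vimage:
  fixes T :: "(real ^ 'n) set"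
  assumes T: "T \<in> lmeasurable" and r: "r > 0" and z: "\<And>i. z $ i > 0"
  shows "coord A\<^sub>0 a r z -` T \<in> lmeasurable"
    and "measure lebesgue (coord A\<^sub>0 a r z -` T) = (\<Prod>i\<in>UNIV. r / z $ i) * measure lebesgue T"
proof -
  define m where "m i = (if i \<in> A\<^sub>0 then - (r / z $ i) else r / z $ i)" for i
  define c :: "real ^ 'n" where "c = (\<chi> i. a $ i + (if i \<in> A\<^sub>0 then r else 0))"
  define g :: "real ^ 'n \<Rightarrow> real ^ 'n" where "g y = (\<chi> k. m k * y $ k)" for y
  have inv1: "coord A\<^sub>0 a r z (c + g y) = y" for y
    using r z by (simp add: vec_eq_iff coord_component c_def g_def m_def less_imp_neq[symmetric] field_simps)
  have inv2: "c + g (coord A\<^sub>0 a r z x) = x" for x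
    using r z by (simp add: vec_eq_iff coord_component c_def g_def m_def less_imp_neq[symmetric] field_simps)
  have eq: "coord A\<^sub>0 a r z -` T = (+) c ` g ` T"
  proof (intro equalityI subsetI)
    fix x assume "x \<in> coord A\<^sub>0 a r z -` T"
    then have "coord A\<^sub>0 a r z x \<in> T" by simp
    then show "x \<in> (+) c ` g ` T" using inv2[of x] by (metis imageI)
  next
    fix x assume "x \<in> (+) c ` g ` T"
    then show "x \<in> coord A\<^sub>0 a r z -` T" using inv1 by auto
  qed
  have g: "g ` T \<in> lmeasurable" "measure lebesgue (g ` T) = \<bar>prod m UNIV\<bar> * measure lebesgue T"
    using measurable_stretch[OF T, of m] measure_stretch[OF T, of m] by (simp_all add: g_def[abs_def])
  have "\<bar>prod m UNIV\<bar> = (\<Prod>i\<in>UNIV. r / z $ i)"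
    using r z by (auto simp: abs_prod m_def less_imp_le intro!: prod.cong)
  with g show "coord A\<^sub>0 a r z -` T \<in> lmeasurable"
    "measure lebesgue (coord A\<^sub>0 a r z -` T) = (\<Prod>i\<in>UNIV. r / z $ i) * measure lebesgue T"
    by (simp_all add: eq measurable_translation measure_translation)
qed

lemma coord_in_box_iff:
  assumes "r > 0" "\<And>i. z $ i > 0"
  shows "coord A\<^sub>0 a r z x \<in> cbox 0 z \<longleftrightarrow> x \<in> ncube a r"
proof -
  have "(0 \<le> coord A\<^sub>0 a r z x $ i \<and> coord A\<^sub>0 a r z x $ i \<le> z $ i)
     \<longleftrightarrow> (0 \<le> (x $ i - a $ i) / r \<and> (x $ i - a $ i) / r \<le> 1)" for i
    using assms(2)[of i] unfolding coord_component
    by (auto simp: zero_le_mult_iff mult_le_cancel_left1)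
  then show ?thesis
    unfolding mem_ncube[OF assms(1)] mem_box_cart by simp
qed

text \<open>This translates fairness of the volume into a condition on the box \<open>[0, z]\<close>, to which
  \<open>fair_boxes_thin\<close> applies.\<close>

lemma measure_framed_part:
  fixes z :: "real ^ 'n"
  assumes "r > 0" "\<And>i. z $ i > 0"
  shows "measure lebesgue (framed_part A\<^sub>0 a r z t As ss Zs L)
    = (\<Prod>i\<in>UNIV. r / z $ i) * measure lebesgue ({y. L (pattern t As ss Zs y)} \<inter> cbox 0 z)"
proof -
  have "framed_part A\<^sub>0 a r z t As ss Zs L = coord A\<^sub>0 a r z -` ({y. L (pattern t As ss Zs y)} \<inter> cbox 0 z)"
    using coord_in_box_iff[OF assms] by (auto simp: framed_part_def)
  moreover have "{y. L (pattern t As ss Zs y)} \<inter> cbox 0 z \<in> lmeasurable"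
    using fmeasurable_Int_fmeasurable[OF lmeasurable_cbox sets_pattern] by (simp add: Int_commute)
  ultimately show ?thesis
    using measure_coord_vimage(2)[OF _ assms] by metis
qed

definition symdiff :: "'a set \<Rightarrow> 'a set \<Rightarrow> 'a set" where
  "symdiff A B = (A - B) \<union> (B - A)"

lemma symdiff_commute: "symdiff A B = symdiff B A"
  by (auto simp: symdiff_def)

lemma symdiff_lmeasurable: "A \<in> lmeasurable \<Longrightarrow> B \<in> lmeasurable \<Longrightarrow> symdiff A B \<in> lmeasurable"
  unfolding symdiff_def by (intro fmeasurable.Un fmeasurable.Diff)

lemma measure_diff_le_symdiff:
  assumes A: "A \<in> lmeasurable" and B: "B \<in> lmeasurable"
  shows "\<bar>measure lebesgue A - measure lebesgue B\<bar> \<le> measure lebesgue (symdiff A B)"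
proof -
  have *: "measure lebesgue A \<le> measure lebesgue B + measure lebesgue (symdiff A B)"
    if "A \<in> lmeasurable" "B \<in> lmeasurable" for A B :: "'a set"
  proof -
    have "measure lebesgue A \<le> measure lebesgue (B \<union> symdiff A B)"
      using that by (intro measure_mono_fmeasurable fmeasurable.Un symdiff_lmeasurable) (auto simp: symdiff_def)
    also have "\<dots> \<le> measure lebesgue B + measure lebesgue (symdiff A B)"
      using that by (intro measure_Un_le fmeasurableD symdiff_lmeasurable)
    finally show ?thesis .
  qed
  show ?thesis using *[OF A B] *[OF B A] by (simp add: symdiff_commute)
qed

text \<open>A small change of all parameters moves the coordinates of a point, and thus its distance from
  each hyperplane, by a small amount. So it can change the pattern of the point, or its
  membership in the necklace, only near a hyperplane or near a face of the necklace. The numerical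
  factors come from crude bounds on the coordinates.\<close>

lemma symdiff_subset_strips:
  fixes R \<delta> r r' :: real and a a' z z' :: "real ^ 'n" and Zs Zs' :: "nat \<Rightarrow> real ^ 'n"
  assumes R: "R \<ge> 1" and \<delta>: "0 < \<delta>" "5 * R ^ 3 * \<delta> \<le> 1"
    and r: "1 / R \<le> r" "r \<le> R" "1 / R \<le> r'" "r' \<le> R" "\<bar>r - r'\<bar> \<le> \<delta>"
    and a: "\<And>i. \<bar>a $ i\<bar> \<le> R" "\<And>i. \<bar>a $ i - a' $ i\<bar> \<le> \<delta>"
    and z: "\<And>i. 0 < z $ i" "\<And>i. z $ i \<le> 2" "\<And>i. \<bar>z $ i - z' $ i\<bar> \<le> \<delta>"
    and ss: "\<And>j. j < t \<Longrightarrow> ss j \<in> {1, - 1}"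
    and Z: "\<And>j i. j < t \<Longrightarrow> 0 \<le> Zs j $ i \<and> Zs j $ i \<le> 2"
      "\<And>j i. j < t \<Longrightarrow> \<bar>Zs j $ i - Zs' j $ i\<bar> \<le> \<delta>"
  shows "symdiff (framed_part A\<^sub>0 a r z t As ss Zs L) (framed_part A\<^sub>0 a' r' z' t As ss Zs' L) \<subseteq>
     (\<Union>j<t. coord A\<^sub>0 a r z -` strip (As j) (Zs j) (75 * real CARD('n) * R ^ 3 * \<delta>)) \<union>
     (\<Union>i\<in>UNIV. coord {} a r (\<chi> i. 1) -` strip {} (axis i 1) (5 * R ^ 3 * \<delta>) \<union>
                 coord {} a r (\<chi> i. 1) -` strip {i} (axis i 1) (5 * R ^ 3 * \<delta>))"
    (is "?D \<subseteq> ?S")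
proof
  fix x assume x: "x \<in> ?D"
  define \<eta> where "\<eta> = 5 * R ^ 3 * \<delta>"
  have R3: "R ^ 3 \<ge> 1" "R \<le> R ^ 3"
    using R self_le_power[of R 3] one_le_power[of R 3] by simp_all
  have "\<delta> * 1 \<le> \<delta> * (5 * R ^ 3)" using R3 \<delta> by (intro mult_left_mono) auto
  then have \<eta>: "\<delta> \<le> \<eta>" "\<eta> \<le> 1" "\<eta> > 0" using \<delta> R by (simp_all add: \<eta>_def mult.commute)
  have \<delta>1: "\<delta> \<le> 1" using \<eta> by linarith
  have "1 / R > 0" using R by simp
  then have rp: "r > 0" "r' > 0" using r by linarith+
  define u where "u i = (x $ i - a $ i) / r" for i
  define u' where "u' i = (x $ i - a' $ i) / r'" for i
  have N: "x \<in> ncube a r \<longleftrightarrow> (\<forall>i. 0 \<le> u i \<and> u i \<le> 1)" "x \<in> ncube a' r' \<longleftrightarrow> (\<forall>i. 0 \<le> u' i \<and> u' i \<le> 1)"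
    using rp by (simp_all add: mem_ncube u_def u'_def)
  have xin: "x \<in> ncube a r \<or> x \<in> ncube a' r'" using x by (auto simp: symdiff_def framed_part_def)
  have xa: "\<bar>x $ i - a $ i\<bar> \<le> 4 * R" for i
    using xin
  proof
    assume "x \<in> ncube a r"
    then show ?thesis using r(2) R by (auto simp: ncube_def mem_box_cart) (smt (verit))
  next
    assume "x \<in> ncube a' r'"
    then have "0 \<le> x $ i - a' $ i" "x $ i - a' $ i \<le> r'" by (auto simp: ncube_def mem_box_cart) (smt (verit))
    then show ?thesis using r(4) R a(2)[of i] \<delta>1 by linarith
  qed
  have uu: "\<bar>u i - u' i\<bar> \<le> \<eta>" for i
  proof -
    have "u i - u' i = (a' $ i - a $ i) * (1 / r') + (x $ i - a $ i) * ((r' - r) * ((1 / r) * (1 / r')))"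
      using rp by (simp add: u_def u'_def field_simps)
    also have "\<bar>\<dots>\<bar> \<le> \<bar>a' $ i - a $ i\<bar> * (1 / r') + \<bar>x $ i - a $ i\<bar> * (\<bar>r' - r\<bar> * ((1 / r) * (1 / r')))"
      using rp by (intro order_trans[OF abs_triangle_ineq]) (simp add: abs_mult)
    also have "\<dots> \<le> \<delta> * R + (4 * R) * (\<delta> * (R * R))"
    proof -
      have "1 / r \<le> R" "1 / r' \<le> R" using r rp R by (simp_all add: field_simps)
      then show ?thesis
        using a(2)[of i] xa[of i] r(5) rp R \<delta>
        by (intro add_mono mult_mono) (auto simp: abs_minus_commute)
    qed
    also have "\<dots> \<le> \<delta> * R ^ 3 + 4 * R ^ 3 * \<delta>"
      using R3 \<delta> by (intro add_mono mult_left_mono) (auto simp: power3_eq_cube)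
    also have "\<dots> = \<eta>" by (simp add: \<eta>_def)
    finally show ?thesis .
  qed
  have ub: "- 1 \<le> u i" "u i \<le> 2" "- 1 \<le> u' i" "u' i \<le> 2" for i
    using xin N uu[of i] \<eta> by (smt (verit))+
  show "x \<in> ?S"
  proof (cases "x \<in> ncube a r \<longleftrightarrow> x \<in> ncube a' r'")
    case False
    then obtain i where "(0 \<le> u i \<and> u i \<le> 1) \<noteq> (0 \<le> u' i \<and> u' i \<le> 1)"
      using N by blast
    then have i: "\<bar>u i - 1\<bar> \<le> \<eta> \<or> \<bar>u i\<bar> \<le> \<eta>"
      using uu[of i] by linarith
    let ?y = "coord {} a r (\<chi> i. 1) x"
    have y: "?y $ j = u j" for j by (simp add: coord_component u_def)
    have "?y \<in> big_cube 10"
      unfolding mem_big_cube y using ub by (smt (verit))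
    moreover have "axis i 1 \<bullet> reflect {} ?y - 1 = u i - 1" "axis i 1 \<bullet> reflect {i} ?y - 1 = - u i"
      by (simp_all add: inner_axis' reflect_def y)
    ultimately have "?y \<in> strip {} (axis i 1) \<eta> \<or> ?y \<in> strip {i} (axis i 1) \<eta>"
      using i by (auto simp: strip_def)
    then show ?thesis unfolding \<eta>_def by blast
  next
    case True
    let ?y = "coord A\<^sub>0 a r z x" and ?y' = "coord A\<^sub>0 a' r' z' x"
    have "pattern t As ss Zs ?y \<noteq> pattern t As ss Zs' ?y'"
      using x True by (auto simp: symdiff_def framed_part_def)
    then obtain j where j: "j < t" "(side (As j) (ss j) (Zs j) ?y > 0) \<noteq> (side (As j) (ss j) (Zs' j) ?y' > 0)"
      by (auto simp: pattern_def)
    define w where "w i = (if i \<in> A\<^sub>0 then 1 - u i else u i)" for i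
    define w' where "w' i = (if i \<in> A\<^sub>0 then 1 - u' i else u' i)" for i
    have y: "?y $ i = z $ i * w i" "?y' $ i = z' $ i * w' i" for i
      by (simp_all add: coord_component w_def w'_def u_def u'_def)
    have w: "\<bar>w i\<bar> \<le> 2" "\<bar>w' i\<bar> \<le> 2" "\<bar>w i - w' i\<bar> \<le> \<eta>" for i
      using ub[of i] uu[of i] by (auto simp: w_def w'_def)
    have zb: "\<bar>z $ i\<bar> \<le> 2" "\<bar>z' $ i\<bar> \<le> 3" for i
      using z(1,2,3)[of i] \<delta>1 by linarith+
    have yb: "\<bar>?y $ i\<bar> \<le> 4" "\<bar>?y' $ i\<bar> \<le> 6" for i
      unfolding y abs_mult using mult_mono[OF zb(1) w(1), of i i] mult_mono[OF zb(2) w(2), of i i] by simp_all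
    have yy: "\<bar>?y $ i - ?y' $ i\<bar> \<le> 4 * \<eta>" for i
    proof -
      have "?y $ i - ?y' $ i = z $ i * (w i - w' i) + (z $ i - z' $ i) * w' i"
        by (simp add: y algebra_simps)
      also have "\<bar>\<dots>\<bar> \<le> \<bar>z $ i\<bar> * \<bar>w i - w' i\<bar> + \<bar>z $ i - z' $ i\<bar> * \<bar>w' i\<bar>"
        by (intro order_trans[OF abs_triangle_ineq]) (simp add: abs_mult)
      also have "\<dots> \<le> 2 * \<eta> + \<eta> * 2"
        using zb w[of i] z(3)[of i] \<eta> by (intro add_mono mult_mono) auto
      finally show ?thesis by simp
    qed
    have "\<bar>side (As j) (ss j) (Zs j) ?y - side (As j) (ss j) (Zs' j) ?y'\<bar>
       \<le> \<bar>ss j\<bar> * (\<Sum>i\<in>UNIV. \<bar>Zs j $ i\<bar> * \<bar>?y $ i - ?y' $ i\<bar> + \<bar>Zs j $ i - Zs' j $ i\<bar> * (1 + \<bar>?y' $ i\<bar>))"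
      by (rule abs_side_diff_le)
    also have "\<bar>ss j\<bar> = 1" using ss[OF j(1)] by auto
    also have "1 * (\<Sum>i\<in>UNIV. \<bar>Zs j $ i\<bar> * \<bar>?y $ i - ?y' $ i\<bar> + \<bar>Zs j $ i - Zs' j $ i\<bar> * (1 + \<bar>?y' $ i\<bar>))
       \<le> 1 * (\<Sum>i\<in>(UNIV::'n set). 2 * (4 * \<eta>) + \<eta> * 7)"
    proof (intro mult_left_mono sum_mono add_mono mult_mono)
      fix i
      show "\<bar>Zs j $ i\<bar> \<le> 2" using Z(1)[OF j(1), of i] by simp
      show "\<bar>Zs j $ i - Zs' j $ i\<bar> \<le> \<eta>" using Z(2)[OF j(1), of i] \<eta> by linarith
      show "1 + \<bar>?y' $ i\<bar> \<le> 7" using yb(2)[of i] by linarith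
    qed (use yy \<eta> in auto)
    also have "\<dots> = 75 * real CARD('n) * R ^ 3 * \<delta>" by (simp add: \<eta>_def)
    finally have "\<bar>side (As j) (ss j) (Zs j) ?y\<bar> \<le> 75 * real CARD('n) * R ^ 3 * \<delta>"
      using j(2) by linarith
    moreover have "\<bar>side (As j) (ss j) (Zs j) ?y\<bar> = \<bar>Zs j \<bullet> reflect (As j) ?y - 1\<bar>"
      using ss[OF j(1)] by (auto simp: side_def)
    moreover have "?y \<in> big_cube 10"
      unfolding mem_big_cube
    proof
      show "\<bar>?y $ i\<bar> \<le> 10" for i using yb(1)[of i] by linarith
    qed
    ultimately have "?y \<in> strip (As j) (Zs j) (75 * real CARD('n) * R ^ 3 * \<delta>)"
      by (simp add: strip_def)
    then show ?thesis using j(1) by blast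
  qed
qed

text \<open>The parts of a necklace depend on the parameters in a Lipschitz way. The scaling factors \<open>z\<close> have
  to stay away from zero: the preimage of a strip under the coordinate map has a volume of order
  \<open>1 / (z\<^sub>1 \<cdots> z\<^sub>d)\<close>.\<close>

lemma framed_part_perturb:
  fixes R e :: real
  assumes R: "R \<ge> 1" and e: "e > 0"
  shows "\<exists>C>0. \<forall>\<delta> A\<^sub>0 a a' r r' z z' As ss (Zs :: nat \<Rightarrow> real ^ 'n) Zs' L.
    0 < \<delta> \<longrightarrow> C * \<delta> \<le> 1 \<longrightarrow> 1 / R \<le> r \<longrightarrow> r \<le> R \<longrightarrow> 1 / R \<le> r' \<longrightarrow> r' \<le> R \<longrightarrow> \<bar>r - r'\<bar> \<le> \<delta> \<longrightarrow>
    (\<forall>i. \<bar>a $ i\<bar> \<le> R \<and> \<bar>a $ i - a' $ i\<bar> \<le> \<delta> \<and> e \<le> z $ i \<and> z $ i \<le> 2 \<and> \<bar>z $ i - z' $ i\<bar> \<le> \<delta>) \<longrightarrow>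
    (\<forall>j<t. ss j \<in> {1, - 1} \<and> (\<forall>i. 0 \<le> Zs j $ i \<and> Zs j $ i \<le> 2 \<and> \<bar>Zs j $ i - Zs' j $ i\<bar> \<le> \<delta>)) \<longrightarrow>
    measure lebesgue (symdiff (framed_part A\<^sub>0 a r z t As ss Zs L) (framed_part A\<^sub>0 a' r' z' t As ss Zs' L)) \<le> C * \<delta>"
proof -
  obtain C where C: "C > 0" "\<And>A (\<zeta> :: real ^ 'n) \<eta>. \<eta> > 0 \<Longrightarrow> (\<And>i. 0 \<le> \<zeta> $ i) \<Longrightarrow>
      measure lebesgue (strip A \<zeta> \<eta>) \<le> C * \<eta>"
    using measure_strip_le by metis
  define d where "d = real CARD('n)"
  have d: "d \<ge> 1" by (simp add: d_def Suc_leI)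
  define K where "K = (R / e) ^ CARD('n) * (C * (75 * d * R ^ 3))"
  define K' where "K' = R ^ CARD('n) * (C * (5 * R ^ 3))"
  define M where "M = t * K + d * (K' + K') + 5 * R ^ 3"
  have R3: "R ^ 3 \<ge> 1" using R by (rule one_le_power)
  have K: "K \<ge> 0" "K' \<ge> 0" using R e C d by (auto simp: K_def K'_def)
  have M0: "M > 0" using K d R3 R unfolding M_def by (intro add_nonneg_pos) (auto)
  have "measure lebesgue (symdiff (framed_part A\<^sub>0 a r z t As ss Zs L) (framed_part A\<^sub>0 a' r' z' t As ss Zs' L)) \<le> M * \<delta>"
    if \<delta>: "0 < \<delta>" "M * \<delta> \<le> 1" and r: "1 / R \<le> r" "r \<le> R" "1 / R \<le> r'" "r' \<le> R" "\<bar>r - r'\<bar> \<le> \<delta>"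
      and az: "\<forall>i. \<bar>a $ i\<bar> \<le> R \<and> \<bar>a $ i - a' $ i\<bar> \<le> \<delta> \<and> e \<le> z $ i \<and> z $ i \<le> 2 \<and> \<bar>z $ i - z' $ i\<bar> \<le> \<delta>"
      and Z: "\<forall>j<t. ss j \<in> {1, - 1} \<and> (\<forall>i. 0 \<le> Zs j $ i \<and> Zs j $ i \<le> 2 \<and> \<bar>Zs j $ i - Zs' j $ i\<bar> \<le> \<delta>)"
    for \<delta> A\<^sub>0 a a' r r' z z' As ss and Zs :: "nat \<Rightarrow> real ^ 'n" and Zs' L
  proof -
    have "5 * R ^ 3 * \<delta> \<le> M * \<delta>" using K d \<delta> by (intro mult_right_mono) (auto simp: M_def)
    then have \<delta>': "5 * R ^ 3 * \<delta> \<le> 1" using \<delta> by linarith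
    have "1 / R > 0" using R by simp
    then have rp: "r > 0" using r by linarith
    have zp: "z $ i > 0" for i using az e by (meson less_le_trans)
    define T where "T j = coord A\<^sub>0 a r z -` strip (As j) (Zs j) (75 * d * R ^ 3 * \<delta>)" for j
    define U where "U A i = coord {} a r (\<chi> i. 1) -` strip A (axis i 1) (5 * R ^ 3 * \<delta>)" for A i
    have T: "T j \<in> lmeasurable" for j
      unfolding T_def by (intro measure_coord_vimage strip_lmeasurable rp zp)
    have U: "U A i \<in> lmeasurable" for A i
      unfolding U_def by (intro measure_coord_vimage strip_lmeasurable rp) simp
    have mT: "measure lebesgue (T j) \<le> K * \<delta>" if j: "j < t" for j
    proof -
      have "measure lebesgue (T j) = (\<Prod>i\<in>UNIV. r / z $ i) * measure lebesgue (strip (As j) (Zs j) (75 * d * R ^ 3 * \<delta>))"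
        unfolding T_def by (intro measure_coord_vimage strip_lmeasurable rp zp)
      also have "\<dots> \<le> (\<Prod>i\<in>(UNIV::'n set). R / e) * (C * (75 * d * R ^ 3 * \<delta>))"
      proof (intro mult_mono prod_mono C conjI)
        fix i
        show "r / z $ i \<le> R / e" using az r rp e R by (intro frac_le) auto
        show "0 \<le> r / z $ i" using rp zp[of i] by simp
      qed (use Z j \<delta> R d e in \<open>auto intro!: prod_nonneg\<close>)
      also have "\<dots> = K * \<delta>" by (simp add: K_def)
      finally show ?thesis .
    qed
    have mU: "measure lebesgue (U A i) \<le> K' * \<delta>" for A i
    proof -
      have "measure lebesgue (U A i) = (\<Prod>i\<in>(UNIV::'n set). r / (\<chi> i. 1) $ i) * measure lebesgue (strip A (axis i 1) (5 * R ^ 3 * \<delta>))"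
        unfolding U_def by (intro measure_coord_vimage strip_lmeasurable rp) simp
      also have "\<dots> \<le> R ^ CARD('n) * (C * (5 * R ^ 3 * \<delta>))"
      proof (intro mult_mono C)
        show "(\<Prod>i\<in>(UNIV::'n set). r / (\<chi> i. 1) $ i) \<le> R ^ CARD('n)"
          using r rp by (simp add: power_mono)
      qed (use \<delta> R in \<open>auto simp: axis_def\<close>)
      also have "\<dots> = K' * \<delta>" by (simp add: K'_def)
      finally show ?thesis .
    qed
    let ?S = "(\<Union>j<t. T j) \<union> (\<Union>i\<in>UNIV. U {} i \<union> U {i} i)"
    have S1: "(\<Union>j<t. T j) \<in> lmeasurable" "(\<Union>i\<in>UNIV. U {} i \<union> U {i} i) \<in> lmeasurable"
      using T U by (auto intro!: fmeasurable.finite_UN fmeasurable.Un)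
    have "measure lebesgue (symdiff (framed_part A\<^sub>0 a r z t As ss Zs L) (framed_part A\<^sub>0 a' r' z' t As ss Zs' L))
        \<le> measure lebesgue ?S"
    proof (rule measure_mono_fmeasurable)
      show "symdiff (framed_part A\<^sub>0 a r z t As ss Zs L) (framed_part A\<^sub>0 a' r' z' t As ss Zs' L) \<subseteq> ?S"
        unfolding T_def U_def d_def
        by (rule symdiff_subset_strips[OF R \<delta>(1) \<delta>' r]) (use az zp Z in auto)
    qed (use S1 in \<open>auto intro!: fmeasurableD symdiff_lmeasurable fmeasurable.Un\<close>)
    also have "\<dots> \<le> measure lebesgue (\<Union>j<t. T j) + measure lebesgue (\<Union>i\<in>UNIV. U {} i \<union> U {i} i)"
      using S1 by (intro measure_Un_le) auto
    also have "\<dots> \<le> (\<Sum>j<t. measure lebesgue (T j)) + (\<Sum>i\<in>UNIV. measure lebesgue (U {} i \<union> U {i} i))"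
      using T U by (intro add_mono measure_UNION_le) (auto intro!: fmeasurableD fmeasurable.Un)
    also have "\<dots> \<le> (\<Sum>j<t. K * \<delta>) + (\<Sum>i\<in>(UNIV::'n set). K' * \<delta> + K' * \<delta>)"
    proof (intro add_mono sum_mono)
      fix i
      have "measure lebesgue (U {} i \<union> U {i} i) \<le> measure lebesgue (U {} i) + measure lebesgue (U {i} i)"
        using U by (intro measure_Un_le) auto
      then show "measure lebesgue (U {} i \<union> U {i} i) \<le> K' * \<delta> + K' * \<delta>"
        using mU[of "{}" i] mU[of "{i}" i] by linarith
    qed (use mT in auto)
    also have "\<dots> = (t * K + d * (K' + K')) * \<delta>" by (simp add: d_def algebra_simps)
    also have "\<dots> \<le> M * \<delta>" using \<delta> R by (intro mult_right_mono) (auto simp: M_def)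
    finally show ?thesis .
  qed
  then show ?thesis using M0 by (intro exI[of _ M] conjI allI impI) assumption+
qed

section \<open>Normal forms of hyperplanes and parameter grids\<close>

text \<open>The coefficients are bounded because the corner is chosen farthest from the hyperplane. If
  \<open>m\<close> and \<open>p\<close> are the minimum and the maximum of the linear form on the unit cube, then
  \<open>\<bar>\<alpha>\<^sub>i\<bar> \<le> p - m\<close>, while the distance of \<open>b\<close> from the farther one of \<open>m\<close> and \<open>p\<close> is at
  least \<open>(p - m) / 2\<close>.\<close>

lemma halfspace_side_form:
  fixes \<alpha> :: "real ^ 'n"
  assumes "\<alpha> \<noteq> 0"
  obtains A s \<zeta> where "s \<in> {1, - 1 :: real}" "\<And>i. 0 \<le> \<zeta> $ i \<and> \<zeta> $ i \<le> 2"
    "\<And>y. b < \<alpha> \<bullet> y \<longleftrightarrow> 0 < side A s \<zeta> y"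
proof -
  define p where "p = (\<Sum>i\<in>UNIV. max (\<alpha> $ i) 0)"
  define m where "m = (\<Sum>i\<in>UNIV. min (\<alpha> $ i) 0)"
  have pm: "p - m = (\<Sum>i\<in>UNIV. \<bar>\<alpha> $ i\<bar>)"
    unfolding p_def m_def sum_subtractf[symmetric] by (intro sum.cong) (auto simp: max_def min_def)
  obtain i\<^sub>0 where "\<alpha> $ i\<^sub>0 \<noteq> 0" using assms by (auto simp: vec_eq_iff)
  have le: "\<bar>\<alpha> $ i\<bar> \<le> p - m" for i
    unfolding pm by (rule member_le_sum) auto
  have pos: "p - m > 0" using le[of i\<^sub>0] \<open>\<alpha> $ i\<^sub>0 \<noteq> 0\<close> by linarith
  show ?thesis
  proof (cases "p - b \<le> b - m")
    case True
    define \<beta> where "\<beta> = b - m"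
    have \<beta>: "\<beta> > 0" "p - m \<le> 2 * \<beta>" using True pos by (auto simp: \<beta>_def)
    define A where "A = {i. \<alpha> $ i < 0}"
    define \<zeta> where "\<zeta> = (\<chi> i. \<bar>\<alpha> $ i\<bar> / \<beta>)"
    have "\<alpha> \<bullet> y - b = \<beta> * side A 1 \<zeta> y" for y
    proof -
      have "\<alpha> \<bullet> y = (\<Sum>i\<in>UNIV. \<bar>\<alpha> $ i\<bar> * reflect A y $ i + min (\<alpha> $ i) 0)"
        unfolding inner_cart_sum
        by (intro sum.cong) (auto simp: reflect_def A_def algebra_simps)
      also have "\<dots> = \<beta> * (\<zeta> \<bullet> reflect A y) + m"
        unfolding inner_cart_sum sum_distrib_left sum.distrib m_def using \<beta>(1) by (simp add: \<zeta>_def)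
      finally show ?thesis by (simp add: side_def \<beta>_def algebra_simps)
    qed
    then have "b < \<alpha> \<bullet> y \<longleftrightarrow> 0 < side A 1 \<zeta> y" for y
      using \<beta>(1) by (metis diff_gt_0_iff_gt zero_less_mult_pos mult_pos_pos)
    moreover have "0 \<le> \<zeta> $ i \<and> \<zeta> $ i \<le> 2" for i
      using \<beta> le[of i] by (auto simp: \<zeta>_def field_simps)
    ultimately show ?thesis using that[of 1 \<zeta> A] by simp
  next
    case False
    define \<beta> where "\<beta> = p - b"
    have \<beta>: "\<beta> > 0" "p - m \<le> 2 * \<beta>" using False pos by (auto simp: \<beta>_def)
    define A where "A = {i. \<alpha> $ i > 0}"
    define \<zeta> where "\<zeta> = (\<chi> i. \<bar>\<alpha> $ i\<bar> / \<beta>)"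
    have "\<alpha> \<bullet> y - b = \<beta> * side A (- 1) \<zeta> y" for y
    proof -
      have "\<alpha> \<bullet> y = (\<Sum>i\<in>UNIV. max (\<alpha> $ i) 0 - \<bar>\<alpha> $ i\<bar> * reflect A y $ i)"
        unfolding inner_cart_sum
        by (intro sum.cong) (auto simp: reflect_def A_def algebra_simps)
      also have "\<dots> = p - \<beta> * (\<zeta> \<bullet> reflect A y)"
        unfolding inner_cart_sum sum_distrib_left sum_subtractf p_def using \<beta>(1) by (simp add: \<zeta>_def)
      finally show ?thesis by (simp add: side_def \<beta>_def algebra_simps)
    qed
    then have "b < \<alpha> \<bullet> y \<longleftrightarrow> 0 < side A (- 1) \<zeta> y" for y
      using \<beta>(1) by (metis diff_gt_0_iff_gt zero_less_mult_pos mult_pos_pos)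
    moreover have "0 \<le> \<zeta> $ i \<and> \<zeta> $ i \<le> 2" for i
      using \<beta> le[of i] by (auto simp: \<zeta>_def field_simps)
    ultimately show ?thesis using that[of "- 1" \<zeta> A] by simp
  qed
qed

lemma halfspace_side_form_coord:
  fixes \<alpha> z :: "real ^ 'n"
  assumes "\<alpha> \<noteq> 0" and r: "r > 0" and z: "\<And>i. z $ i > 0"
  obtains A s \<zeta> where "s \<in> {1, - 1 :: real}" "\<And>i. 0 \<le> \<zeta> $ i \<and> \<zeta> $ i \<le> 2"
    "\<And>x. b < \<alpha> \<bullet> x \<longleftrightarrow> 0 < side A s \<zeta> (coord A\<^sub>0 a r z x)"
proof -
  define m where "m i = (if i \<in> A\<^sub>0 then - (r / z $ i) else r / z $ i)" for i
  define c :: "real ^ 'n" where "c = (\<chi> i. a $ i + (if i \<in> A\<^sub>0 then r else 0))"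
  define \<alpha>' where "\<alpha>' = (\<chi> i. \<alpha> $ i * m i)"
  have m0: "m i \<noteq> 0" for i using r z[of i] by (simp add: m_def)
  have x: "x $ i = c $ i + m i * coord A\<^sub>0 a r z x $ i" for x i
    using r z[of i] by (simp add: coord_component c_def m_def field_simps)
  have eq: "\<alpha> \<bullet> x = \<alpha> \<bullet> c + \<alpha>' \<bullet> coord A\<^sub>0 a r z x" for x
  proof -
    have "\<alpha> \<bullet> x = (\<Sum>i\<in>UNIV. \<alpha> $ i * (c $ i + m i * coord A\<^sub>0 a r z x $ i))"
      unfolding inner_cart_sum by (rule sum.cong) (simp_all only: x[of x, symmetric])
    then show ?thesis
      by (simp add: inner_cart_sum \<alpha>'_def algebra_simps sum.distrib)
  qed
  have iff: "b < \<alpha> \<bullet> x \<longleftrightarrow> b - \<alpha> \<bullet> c < \<alpha>' \<bullet> coord A\<^sub>0 a r z x" for x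
    using eq[of x] by linarith
  have "\<alpha>' \<noteq> 0" using assms(1) m0 by (auto simp: \<alpha>'_def vec_eq_iff)
  then obtain A s \<zeta> where *: "s \<in> {1, - 1 :: real}" "\<And>i. 0 \<le> \<zeta> $ i \<and> \<zeta> $ i \<le> 2"
    "\<And>y. b - \<alpha> \<bullet> c < \<alpha>' \<bullet> y \<longleftrightarrow> 0 < side A s \<zeta> y"
    by (rule halfspace_side_form[of \<alpha>' "b - \<alpha> \<bullet> c"]) blast
  show ?thesis
    by (rule that[of s \<zeta> A]) (use * iff in simp_all)
qed

definition ones :: "real ^ 'n" where "ones = (\<chi> i. 1)"

lemma ones_nth [simp]: "ones $ i = 1"
  by (simp add: ones_def)

text \<open>For a single hyperplane, the farthest corner can be made the origin of the coordinates.\<close>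

lemma first_halfspace_form:
  fixes \<alpha> :: "real ^ 'n"
  assumes "\<alpha> \<noteq> 0" and r: "r > 0"
  obtains A\<^sub>0 s \<zeta> where "s \<in> {1, - 1 :: real}" "\<And>i. 0 \<le> \<zeta> $ i \<and> \<zeta> $ i \<le> 2"
    "\<And>x. b < \<alpha> \<bullet> x \<longleftrightarrow> 0 < side {} s \<zeta> (coord A\<^sub>0 a r ones x)"
proof -
  obtain A s \<zeta> where *: "s \<in> {1, - 1 :: real}" "\<And>i. 0 \<le> \<zeta> $ i \<and> \<zeta> $ i \<le> 2"
    "\<And>x. b < \<alpha> \<bullet> x \<longleftrightarrow> 0 < side A s \<zeta> (coord {} a r ones x)"
    by (rule halfspace_side_form_coord[OF assms(1) r, of ones b "{}" a]) (simp, blast)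
  have "reflect A (coord {} a r ones x) = reflect {} (coord A a r ones x)" for x
    by (simp add: vec_eq_iff reflect_def coord_component)
  then have "side A s \<zeta> (coord {} a r ones x) = side {} s \<zeta> (coord A a r ones x)" for x
    by (simp add: side_def)
  with * show ?thesis by (intro that[of s \<zeta> A]) simp_all
qed

text \<open>Scaling the coordinates by the coefficients of a hyperplane makes all its coefficients \<open>1\<close>.\<close>

lemma side_rescale: "side {} s \<zeta> (coord A\<^sub>0 a r ones x) = side {} s ones (coord A\<^sub>0 a r \<zeta> x)"
  by (simp add: side_def inner_cart_sum reflect_def coord_component)

definition ngrid :: "nat \<Rightarrow> nat \<Rightarrow> (real ^ 'n) set" where
  "ngrid M B = (\<lambda>g. \<chi> i. real (g i) / real M) ` (UNIV \<rightarrow>\<^sub>E {..B})"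

lemma finite_ngrid [simp]: "finite (ngrid M B)"
  by (simp add: ngrid_def finite_PiE)

lemma card_ngrid_le: "card (ngrid M B :: (real ^ 'n) set) \<le> (B + 1) ^ CARD('n)"
proof -
  have "card (ngrid M B :: (real ^ 'n) set) \<le> card ((UNIV :: 'n set) \<rightarrow>\<^sub>E {..B})"
    unfolding ngrid_def by (intro card_image_le finite_PiE) auto
  then show ?thesis by (simp add: card_PiE)
qed

lemma ngrid_approx:
  fixes v :: "real ^ 'n"
  assumes M: "M > 0" and v: "\<And>i. 0 \<le> v $ i" "\<And>i. v $ i \<le> real B / real M"
  obtains v' where "v' \<in> ngrid M B" "\<And>i. v' $ i \<le> v $ i" "\<And>i. v $ i \<le> v' $ i + 1 / M"
proof -
  define g where "g i = nat \<lfloor>v $ i * M\<rfloor>" for i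
  have g: "real (g i) \<le> v $ i * M" "v $ i * M \<le> real (g i) + 1" for i
    using v(1)[of i] unfolding g_def by (simp_all add: of_nat_nat)
  have "g i \<le> B" for i
  proof -
    have "v $ i * M \<le> B" using v(2)[of i] M by (simp add: field_simps)
    then show ?thesis using g(1)[of i] by linarith
  qed
  then have "(\<chi> i. real (g i) / real M) \<in> ngrid M B"
    unfolding ngrid_def by (intro image_eqI[of _ _ g]) auto
  moreover have "real (g i) / M \<le> v $ i" "v $ i \<le> real (g i) / M + 1 / M" for i
    using g[of i] M by (simp_all add: field_simps)
  ultimately show ?thesis using that by simp
qed

lemma ngrid_nonneg: "v \<in> ngrid M B \<Longrightarrow> 0 \<le> v $ i"
  by (auto simp: ngrid_def)

lemma ngrid_le: "v \<in> ngrid M B \<Longrightarrow> v $ i \<le> real B / real M"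
  by (auto simp: ngrid_def PiE_def Pi_def intro!: divide_right_mono)

text \<open>Confining one coordinate to a short range saves a factor.\<close>

lemma card_ngrid_thin_le:
  "card {v \<in> ngrid M B :: (real ^ 'n) set. \<exists>i. v $ i \<le> real N / real M}
    \<le> CARD('n) * ((N + 1) * (B + 1) ^ (CARD('n) - 1))"
proof (cases "M = 0")
  case True
  have "ngrid M B \<subseteq> {0 :: real ^ 'n}" using True by (auto simp: ngrid_def vec_eq_iff)
  then have "card {v \<in> ngrid M B :: (real ^ 'n) set. \<exists>i. v $ i \<le> real N / real M} \<le> card {0 :: real ^ 'n}"
    by (intro card_mono) auto
  also have "\<dots> \<le> CARD('n) * ((N + 1) * (B + 1) ^ (CARD('n) - 1))"
    by (simp add: Suc_le_eq)
  finally show ?thesis .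
next
  case False
  define pt :: "('n \<Rightarrow> nat) \<Rightarrow> real ^ 'n" where "pt g = (\<chi> i. real (g i) / real M)" for g
  define T where "T i = (\<Pi>\<^sub>E j\<in>(UNIV :: 'n set). if j = i then {..N} else {..B})" for i :: 'n
  have "{v \<in> ngrid M B :: (real ^ 'n) set. \<exists>i. v $ i \<le> real N / real M}
      \<subseteq> (\<Union>i\<in>UNIV. pt ` T i)"
  proof
    fix v :: "real ^ 'n" assume "v \<in> {v \<in> ngrid M B. \<exists>i. v $ i \<le> real N / real M}"
    then obtain g i where g: "g \<in> UNIV \<rightarrow>\<^sub>E {..B}" "v = (\<chi> i. real (g i) / real M)" "v $ i \<le> real N / real M"
      by (auto simp: ngrid_def)
    then have "g i \<le> N" using False by (simp add: divide_le_cancel)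
    then have "g \<in> T i" using g(1) by (auto simp: T_def PiE_def Pi_def)
    then show "v \<in> (\<Union>i\<in>UNIV. pt ` T i)"
      using g(2) unfolding pt_def by blast
  qed
  then have "card {v \<in> ngrid M B :: (real ^ 'n) set. \<exists>i. v $ i \<le> real N / real M}
      \<le> card (\<Union>i\<in>UNIV. pt ` T i)"
    by (intro card_mono) (auto simp: T_def intro!: finite_PiE)
  also have "\<dots> \<le> (\<Sum>i\<in>UNIV. card (pt ` T i))"
    by (intro card_UN_le) simp
  also have "\<dots> \<le> (\<Sum>i\<in>(UNIV :: 'n set). (N + 1) * (B + 1) ^ (CARD('n) - 1))"
  proof (rule sum_mono)
    fix i :: 'n
    have "card (pt ` T i) \<le> card (T i)"
      by (intro card_image_le) (auto simp: T_def intro!: finite_PiE)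
    also have "\<dots> = (\<Prod>j\<in>UNIV. card (if j = i then {..N} else {..B}))"
      by (simp add: T_def card_PiE)
    also have "\<dots> = (\<Prod>j\<in>insert i (UNIV - {i}). if j = i then N + 1 else B + 1)"
      by (intro prod.cong) auto
    also have "\<dots> = (N + 1) * (\<Prod>j\<in>UNIV - {i}. if j = i then N + 1 else B + 1)"
      by (subst prod.insert) auto
    also have "(\<Prod>j\<in>UNIV - {i}. if j = i then N + 1 else B + 1) = (\<Prod>j\<in>UNIV - {i}. B + 1)"
      by (intro prod.cong) auto
    finally show "card (pt ` T i) \<le> (N + 1) * (B + 1) ^ (CARD('n) - 1)"
      by (simp add: card_Diff_subset)
  qed
  finally show ?thesis by simp
qed

text \<open>The cells of the grid at the points where a union of regions takes nearly the share \<open>c\<close> of the box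
  \<open>[0, z]\<close> are disjoint and lie in a thin set, so there are few of them.\<close>

lemma card_fair_ngrid_le:
  fixes c \<epsilon> :: real
  assumes c: "0 < c" "c < 1" and \<epsilon>: "\<epsilon> > 0"
  shows "\<exists>\<tau>>0. \<exists>M\<^sub>0. \<forall>M\<ge>M\<^sub>0. \<forall>As ss (Zs :: nat \<Rightarrow> real ^ 'n) L.
     (\<forall>j<t. ss j \<in> {1, - 1} \<and> (\<forall>i. 0 \<le> Zs j $ i \<and> Zs j $ i \<le> 2)) \<longrightarrow>
     card {v \<in> ngrid M (2 * M). \<bar>measure lebesgue ({y. L (pattern t As ss Zs y)} \<inter> cbox 0 v)
               - c * measure lebesgue (cbox 0 v)\<bar> \<le> \<tau>} \<le> \<epsilon> * real M ^ CARD('n)"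
proof -
  define d where "d = CARD('n)"
  obtain \<delta> where \<delta>: "\<delta> > 0" and thin: "\<And>As ss (Zs :: nat \<Rightarrow> real ^ 'n) L E.
     (\<forall>j<t. ss j \<in> {1, - 1} \<and> (\<forall>i. 0 \<le> Zs j $ i \<and> Zs j $ i \<le> 2)) \<Longrightarrow>
     E \<in> lmeasurable \<Longrightarrow> E \<subseteq> {z. \<forall>i. 0 \<le> z $ i \<and> z $ i \<le> 3} \<Longrightarrow>
     (\<forall>z\<in>E. \<bar>measure lebesgue ({y. L (pattern t As ss Zs y)} \<inter> cbox 0 z)
               - c * measure lebesgue (cbox 0 z)\<bar> \<le> \<delta>) \<Longrightarrow>
     measure lebesgue E < \<epsilon>"
    using fair_boxes_thin[OF c \<epsilon>, of t, where 'n='n] by blast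
  obtain M\<^sub>1 :: nat where M1: "4 * 3 ^ d * d / \<delta> < M\<^sub>1" using reals_Archimedean2 by blast
  have "card {v \<in> ngrid M (2 * M). \<bar>measure lebesgue ({y. L (pattern t As ss Zs y)} \<inter> cbox 0 v)
               - c * measure lebesgue (cbox 0 v)\<bar> \<le> \<delta> / 2} \<le> \<epsilon> * real M ^ d"
    if M: "M \<ge> max 1 M\<^sub>1" and Z: "\<forall>j<t. ss j \<in> {1, - 1} \<and> (\<forall>i. 0 \<le> Zs j $ i \<and> Zs j $ i \<le> 2)"
    for M As ss and Zs :: "nat \<Rightarrow> real ^ 'n" and L
  proof -
    define P where "P = {y. L (pattern t As ss Zs y)}"
    define V where "V = {v \<in> ngrid M (2 * M). \<bar>measure lebesgue (P \<inter> cbox 0 v) - c * measure lebesgue (cbox 0 v)\<bar> \<le> \<delta> / 2}"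
    define cell where "cell v = box v (v + (\<chi> i. 1 / M))" for v :: "real ^ 'n"
    define E where "E = (\<Union>v\<in>V. cell v)"
    have finV: "finite V" by (simp add: V_def)
    have M1': "real M \<ge> 1" using M by simp
    have Vb: "0 \<le> v $ i" "v $ i \<le> 2" if "v \<in> V" for v i
      using that ngrid_nonneg[of v M "2 * M" i] ngrid_le[of v M "2 * M" i] M by (auto simp: V_def)
    have cell_meas: "measure lebesgue (cell v) = (1 / M) ^ d" for v
    proof -
      have "measure lebesgue (cell v) = measure lborel (box v (v + (\<chi> i. 1 / M)))"
        unfolding cell_def by (simp add: measure_completion)
      also have "\<dots> = measure lborel (cbox v (v + (\<chi> i. 1 / M)))"
        by (simp add: measure_lborel_box_eq measure_lborel_cbox_eq)
      also have "\<dots> = (1 / M) ^ d"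
        by (subst content_cbox_cart) (auto simp: interval_ne_empty_cart d_def)
      finally show ?thesis .
    qed
    have disj: "disjoint_family_on cell V"
      unfolding disjoint_family_on_def
    proof (intro ballI impI)
      fix v w assume "v \<in> V" "w \<in> V" "v \<noteq> w"
      obtain g where g: "v = (\<chi> i. real (g i) / M)" using \<open>v \<in> V\<close> by (auto simp: V_def ngrid_def)
      obtain h where h: "w = (\<chi> i. real (h i) / M)" using \<open>w \<in> V\<close> by (auto simp: V_def ngrid_def)
      obtain i where "g i \<noteq> h i" using \<open>v \<noteq> w\<close> by (auto simp: g h vec_eq_iff)
      note gh = g h this
      show "cell v \<inter> cell w = {}"
      proof (rule ccontr)
        assume "cell v \<inter> cell w \<noteq> {}"
        then obtain x where x: "x \<in> cell v" "x \<in> cell w" by blast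
        then have "real (g i) / M < x $ i" "x $ i < real (g i) / M + 1 / M"
          "real (h i) / M < x $ i" "x $ i < real (h i) / M + 1 / M"
          by (simp_all add: cell_def mem_box_cart gh)
        then have "real (g i) / M < real (h i) / M + 1 / M" "real (h i) / M < real (g i) / M + 1 / M"
          by linarith+
        then have "real (g i) < real (h i) + 1" "real (h i) < real (g i) + 1"
          using M1' by (simp_all add: field_simps)
        then show False using gh(3) by linarith
      qed
    qed
    have "E \<in> lmeasurable" unfolding E_def using finV by (intro fmeasurable.finite_UN) (auto simp: cell_def)
    moreover have "E \<subseteq> {z. \<forall>i. 0 \<le> z $ i \<and> z $ i \<le> 3}"
    proof
      fix x assume "x \<in> E"
      then obtain v where v: "v \<in> V" "x \<in> cell v" by (auto simp: E_def)
      have "0 \<le> x $ i \<and> x $ i \<le> 3" for i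
      proof -
        have "v $ i < x $ i" "x $ i < v $ i + 1 / M" using v(2) by (simp_all add: cell_def mem_box_cart)
        moreover have "1 / M \<le> 1" using M1' by simp
        ultimately show ?thesis using Vb[OF v(1), of i] by linarith
      qed
      then show "x \<in> {z. \<forall>i. 0 \<le> z $ i \<and> z $ i \<le> 3}" by simp
    qed
    moreover have "\<forall>x\<in>E. \<bar>measure lebesgue ({y. L (pattern t As ss Zs y)} \<inter> cbox 0 x)
               - c * measure lebesgue (cbox 0 x)\<bar> \<le> \<delta>"
    proof
      fix x assume "x \<in> E"
      then obtain v where v: "v \<in> V" "x \<in> cell v" by (auto simp: E_def)
      have vx: "0 \<le> v $ i" "v $ i \<le> x $ i" "x $ i \<le> v $ i + 1 / M" "v $ i \<le> 3" "x $ i \<le> 3" for i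
      proof -
        have "v $ i < x $ i" "x $ i < v $ i + 1 / M" using v(2) by (simp_all add: cell_def mem_box_cart)
        moreover have "1 / M \<le> 1" using M1' by simp
        ultimately show "0 \<le> v $ i" "v $ i \<le> x $ i" "x $ i \<le> v $ i + 1 / M" "v $ i \<le> 3" "x $ i \<le> 3"
          using Vb[OF v(1), of i] by linarith+
      qed
      have vol: "measure lebesgue (cbox 0 w) = (\<Prod>i\<in>UNIV. w $ i)" if "\<And>i. 0 \<le> w $ i" for w :: "real ^ 'n"
        unfolding measure_completion[OF borel_closed[OF closed_cbox, folded sets_lborel]]
        using that by (subst content_cbox_cart) (auto simp: interval_ne_empty_cart)
      have sub: "cbox 0 v \<subseteq> cbox 0 x"
      proof
        fix w assume "w \<in> cbox 0 v"
        then show "w \<in> cbox 0 x"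
          unfolding mem_box_cart using vx(2) by (meson order_trans)
      qed
      define D where "D = measure lebesgue (cbox 0 x) - measure lebesgue (cbox 0 v)"
      have DD: "D = measure lebesgue (cbox 0 x - cbox 0 v)"
        unfolding D_def by (rule measurable_measure_Diff[symmetric]) (use sub in auto)
      have D0: "D \<ge> 0" by (simp add: DD)
      have PD: "\<bar>measure lebesgue (P \<inter> cbox 0 x) - measure lebesgue (P \<inter> cbox 0 v)\<bar> \<le> D"
      proof -
        have Pm: "P \<inter> cbox 0 w \<in> lmeasurable" for w :: "real ^ 'n"
          using fmeasurable_Int_fmeasurable[OF lmeasurable_cbox sets_pattern, of 0 w] by (simp add: P_def Int_commute)
        have "measure lebesgue (P \<inter> cbox 0 x) - measure lebesgue (P \<inter> cbox 0 v) = measure lebesgue (P \<inter> cbox 0 x - P \<inter> cbox 0 v)"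
          by (rule measurable_measure_Diff[symmetric, OF Pm]) (use sub Pm in \<open>auto intro: fmeasurableD\<close>)
        also have "\<dots> \<le> D" unfolding DD
          by (rule measure_mono_fmeasurable) (use Pm in \<open>auto intro: fmeasurableD fmeasurable.Diff\<close>)
        finally have "measure lebesgue (P \<inter> cbox 0 x) - measure lebesgue (P \<inter> cbox 0 v) \<le> D" .
        moreover have "measure lebesgue (P \<inter> cbox 0 v) \<le> measure lebesgue (P \<inter> cbox 0 x)"
          by (rule measure_mono_fmeasurable) (use sub Pm in \<open>auto intro: fmeasurableD\<close>)
        ultimately show ?thesis by linarith
      qed
      have "D \<le> 3 ^ d * (d / M)"
      proof -
        have "\<bar>(\<Prod>i\<in>UNIV. x $ i / 3) - (\<Prod>i\<in>UNIV. v $ i / 3)\<bar> \<le> (\<Sum>i\<in>(UNIV :: 'n set). \<bar>x $ i / 3 - v $ i / 3\<bar>)"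
        proof -
          have x0: "0 \<le> x $ i" for i using vx(1,2)[of i] by linarith
          have "norm (x $ i / 3) \<le> 1" "norm (v $ i / 3) \<le> 1" for i
            using vx(1,4,5)[of i] x0[of i] by simp_all
          then show ?thesis
            using norm_prod_diff[of "UNIV :: 'n set" "\<lambda>i. x $ i / 3" "\<lambda>i. v $ i / 3"]
            by (simp only: real_norm_def)
        qed
        also have "\<dots> \<le> (\<Sum>i\<in>(UNIV :: 'n set). 1 / M)"
        proof (rule sum_mono)
          fix i
          show "\<bar>x $ i / 3 - v $ i / 3\<bar> \<le> 1 / M" using vx(2,3)[of i] by linarith
        qed
        finally have "(\<Prod>i\<in>UNIV. x $ i / 3) - (\<Prod>i\<in>UNIV. v $ i / 3) \<le> d / M" by (simp add: d_def)
        then have "(\<Prod>i\<in>UNIV. x $ i) / 3 ^ d - (\<Prod>i\<in>UNIV. v $ i) / 3 ^ d \<le> d / M"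
          by (simp add: prod_dividef d_def)
        moreover have "D = (\<Prod>i\<in>UNIV. x $ i) - (\<Prod>i\<in>UNIV. v $ i)"
          unfolding D_def using vol[of x] vol[of v] vx(1) order_trans[OF vx(1,2)] by simp
        ultimately have "D / 3 ^ d \<le> d / M" by (simp only: diff_divide_distrib)
        then have "D \<le> d / M * 3 ^ d" by (simp only: pos_divide_le_eq zero_less_power zero_less_numeral)
        then show ?thesis by (simp only: mult.commute)
      qed
      also have "\<dots> \<le> \<delta> / 4"
      proof -
        have "real M\<^sub>1 \<le> real M" using M by simp
        then have "4 * 3 ^ d * d / \<delta> \<le> M" using M1 by linarith
        then have "4 * 3 ^ d * d \<le> M * \<delta>" by (simp only: pos_divide_le_eq[OF \<delta>])
        then have "3 ^ d * d \<le> \<delta> / 4 * M" by (simp add: mult.commute mult.left_commute)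
        moreover have "real M > 0" using M1' by linarith
        ultimately have "3 ^ d * d / M \<le> \<delta> / 4" by (simp only: pos_divide_le_eq)
        then show ?thesis by simp
      qed
      finally have "D \<le> \<delta> / 4" .
      moreover have "\<bar>measure lebesgue (P \<inter> cbox 0 v) - c * measure lebesgue (cbox 0 v)\<bar> \<le> \<delta> / 2"
        using v(1) by (simp add: V_def)
      moreover have "c * D \<le> 1 * D" using c D0 by (intro mult_right_mono) auto
      moreover have "c * D \<ge> 0" using c D0 by simp
      moreover have "c * measure lebesgue (cbox 0 x) = c * measure lebesgue (cbox 0 v) + c * D"
        by (simp add: D_def algebra_simps)
      ultimately have "\<bar>measure lebesgue (P \<inter> cbox 0 x) - c * measure lebesgue (cbox 0 x)\<bar> \<le> \<delta>"
        using PD by linarith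
      then show "\<bar>measure lebesgue ({y. L (pattern t As ss Zs y)} \<inter> cbox 0 x)
               - c * measure lebesgue (cbox 0 x)\<bar> \<le> \<delta>" by (simp only: P_def)
    qed
    ultimately have "measure lebesgue E < \<epsilon>" by (rule thin[OF Z])
    moreover have "measure lebesgue E = (\<Sum>v\<in>V. measure lebesgue (cell v))"
      unfolding E_def
    proof (rule measure_finite_Union[OF finV _ disj])
      show "emeasure lebesgue (cell v) \<noteq> \<infinity>" for v
        unfolding cell_def using fmeasurableD2[OF lmeasurable_box] by simp
    qed (auto simp: cell_def)
    ultimately have "card V * (1 / M) ^ d < \<epsilon>" by (simp add: cell_meas)
    then have "card V \<le> \<epsilon> * real M ^ d" using M1' by (simp add: power_one_over field_simps)
    then show ?thesis by (simp add: V_def P_def)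
  qed
  note bound = this
  show ?thesis
    unfolding d_def[symmetric]
  proof (intro exI[of _ "\<delta> / 2"] conjI exI[of _ "max 1 M\<^sub>1"] allI impI)
    show "0 < \<delta> / 2" using \<delta> by simp
  qed (rule bound)
qed

section \<open>Approximating arrangements by grid arrangements\<close>

text \<open>The conclusion of \<open>framed_part_perturb\<close> with a given constant.\<close>

definition perturb_const :: "'n::finite itself \<Rightarrow> real \<Rightarrow> real \<Rightarrow> nat \<Rightarrow> real \<Rightarrow> bool" where
  "perturb_const TYPE('n) R e t C \<longleftrightarrow> (\<forall>\<delta> A\<^sub>0 a a' r r' z z' As ss (Zs :: nat \<Rightarrow> real ^ 'n) Zs' L.
    0 < \<delta> \<longrightarrow> C * \<delta> \<le> 1 \<longrightarrow> 1 / R \<le> r \<longrightarrow> r \<le> R \<longrightarrow> 1 / R \<le> r' \<longrightarrow> r' \<le> R \<longrightarrow> \<bar>r - r'\<bar> \<le> \<delta> \<longrightarrow>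
    (\<forall>i. \<bar>a $ i\<bar> \<le> R \<and> \<bar>a $ i - a' $ i\<bar> \<le> \<delta> \<and> e \<le> z $ i \<and> z $ i \<le> 2 \<and> \<bar>z $ i - z' $ i\<bar> \<le> \<delta>) \<longrightarrow>
    (\<forall>j<t. ss j \<in> {1, - 1} \<and> (\<forall>i. 0 \<le> Zs j $ i \<and> Zs j $ i \<le> 2 \<and> \<bar>Zs j $ i - Zs' j $ i\<bar> \<le> \<delta>)) \<longrightarrow>
    measure lebesgue (symdiff (framed_part A\<^sub>0 a r z t As ss Zs L) (framed_part A\<^sub>0 a' r' z' t As ss Zs' L)) \<le> C * \<delta>)"

lemma perturb_const_exists:
  assumes "R \<ge> 1" "e > 0"
  shows "\<exists>C>0. perturb_const TYPE('n::finite) R e t C"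
  using framed_part_perturb[OF assms, of t, where 'n='n] unfolding perturb_const_def .

lemma perturb_constD:
  fixes Zs :: "nat \<Rightarrow> real ^ 'n"
  assumes "perturb_const TYPE('n) R e t C"
    and "0 < \<delta>" "C * \<delta> \<le> 1" "1 / R \<le> r" "r \<le> R" "1 / R \<le> r'" "r' \<le> R" "\<bar>r - r'\<bar> \<le> \<delta>"
    and "\<And>i. \<bar>a $ i\<bar> \<le> R" "\<And>i. \<bar>a $ i - a' $ i\<bar> \<le> \<delta>"
    and "\<And>i. e \<le> z $ i" "\<And>i. z $ i \<le> 2" "\<And>i. \<bar>z $ i - z' $ i\<bar> \<le> \<delta>"
    and "\<And>j. j < t \<Longrightarrow> ss j \<in> {1, - 1}"
    and "\<And>j i. j < t \<Longrightarrow> 0 \<le> Zs j $ i" "\<And>j i. j < t \<Longrightarrow> Zs j $ i \<le> 2"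
    and "\<And>j i. j < t \<Longrightarrow> \<bar>Zs j $ i - Zs' j $ i\<bar> \<le> \<delta>"
  shows "measure lebesgue (symdiff (framed_part A\<^sub>0 a r z t As ss Zs L) (framed_part A\<^sub>0 a' r' z' t As ss Zs' L)) \<le> C * \<delta>"
proof -
  have "\<forall>i. \<bar>a $ i\<bar> \<le> R \<and> \<bar>a $ i - a' $ i\<bar> \<le> \<delta> \<and> e \<le> z $ i \<and> z $ i \<le> 2 \<and> \<bar>z $ i - z' $ i\<bar> \<le> \<delta>"
    "\<forall>j<t. ss j \<in> {1, - 1} \<and> (\<forall>i. 0 \<le> Zs j $ i \<and> Zs j $ i \<le> 2 \<and> \<bar>Zs j $ i - Zs' j $ i\<bar> \<le> \<delta>)"
    using assms(9-) by simp_all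
  show ?thesis
    by (rule assms(1)[unfolded perturb_const_def, THEN spec, THEN spec, THEN spec, THEN spec, THEN spec,
          THEN spec, THEN spec, THEN spec, THEN spec, THEN spec, THEN spec, THEN spec, THEN spec,
          THEN mp, THEN mp, THEN mp, THEN mp, THEN mp, THEN mp, THEN mp, THEN mp, THEN mp]) fact+
qed

definition rgrid :: "nat \<Rightarrow> nat \<Rightarrow> real set" where
  "rgrid M B = (\<lambda>g. real g / real M) ` {..B}"

lemma rgrid_approx:
  assumes M: "M > 0" and v: "0 \<le> v" "v \<le> real B / real M"
  obtains v' where "v' \<in> rgrid M B" "v' \<le> v" "v \<le> v' + 1 / M" "0 \<le> v'"
proof -
  define g where "g = nat \<lfloor>v * M\<rfloor>"
  have g: "real g \<le> v * M" "v * M \<le> real g + 1"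
    using v(1) unfolding g_def by (simp_all add: of_nat_nat)
  have "v * M \<le> B" using v(2) M by (simp add: field_simps)
  then have "g \<le> B" using g(1) by linarith
  then have "real g / M \<in> rgrid M B" by (auto simp: rgrid_def)
  moreover have "real g / M \<le> v" "v \<le> real g / M + 1 / M"
    using g M by (simp_all add: field_simps)
  ultimately show ?thesis using that[of "real g / M"] by simp
qed

text \<open>All data of an arrangement of grid type except for the vector that describes the first
  hyperplane or the scaling factors. The second to fourth components give the corners and
  orientations of the hyperplanes and the labelling of the patterns by parts. The necklace is
  given by the displacement of its lower corner from \<open>(- R, \<dots>, - R)\<close> and of its side from
  \<open>1 / R\<close>, so that all grids consist of nonnegative numbers.\<close>

type_synonym 'n frame =
  "'n set \<times> (nat \<Rightarrow> 'n set) \<times> (nat \<Rightarrow> real) \<times> (nat set \<Rightarrow> nat) \<times> (real ^ 'n) \<times> real \<times> (nat \<Rightarrow> real ^ 'n)"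

definition frames :: "nat \<Rightarrow> nat \<Rightarrow> nat \<Rightarrow> nat \<Rightarrow> ('n::finite) frame set" where
  "frames R t q M = UNIV \<times> ({..<t} \<rightarrow>\<^sub>E UNIV) \<times> ({..<t} \<rightarrow>\<^sub>E {1, - 1}) \<times> (Pow {..<t} \<rightarrow>\<^sub>E {1..q})
     \<times> ngrid M (2 * R * M) \<times> rgrid M (R * M) \<times> ({1..<t} \<rightarrow>\<^sub>E ngrid M (2 * M))"

lemma finite_frames: "finite (frames R t q M :: ('n::finite) frame set)"
  unfolding frames_def by (intro finite_cartesian_product finite_PiE) (auto simp: rgrid_def)

text \<open>The exponent is the number of parameters of the necklace and of all hyperplanes but the first.\<close>

lemma card_frames_le:
  assumes "t \<ge> 1" "R \<ge> 1"
  shows "\<exists>W>0. \<forall>M\<ge>1. real (card (frames R t q M :: ('n::finite) frame set))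
     \<le> W * real M ^ (CARD('n) + 1 + CARD('n) * (t - 1))"
proof -
  define d where "d = CARD('n)"
  define D where "D = card (UNIV :: 'n set set) * card ({..<t} \<rightarrow>\<^sub>E (UNIV :: 'n set set))
     * card ({..<t} \<rightarrow>\<^sub>E {1, - 1 :: real}) * card (Pow {..<t} \<rightarrow>\<^sub>E {1..q})"
  define W where "W = (real D + 1) * (3 * R) ^ d * (2 * R) * 3 ^ (d * (t - 1))"
  have "real (card (frames R t q M :: 'n frame set)) \<le> W * real M ^ (d + 1 + d * (t - 1))" if M: "M \<ge> 1" for M
  proof -
    have le1: "2 * R * M + 1 \<le> 3 * R * M" "R * M + 1 \<le> 2 * R * M" "2 * M + 1 \<le> 3 * M"
      using M assms by simp_all
    have c1: "card (ngrid M (2 * R * M) :: (real ^ 'n) set) \<le> (3 * R * M) ^ d"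
      using order_trans[OF card_ngrid_le power_mono[OF le1(1)]] by (simp add: d_def)
    have "card (rgrid M (R * M)) \<le> card {..R * M}" unfolding rgrid_def by (rule card_image_le) simp
    then have "card (rgrid M (R * M)) \<le> R * M + 1" by simp
    then have c2: "card (rgrid M (R * M)) \<le> 2 * R * M" using le1(2) by (rule order_trans)
    have c3: "card ({1..<t} \<rightarrow>\<^sub>E (ngrid M (2 * M) :: (real ^ 'n) set)) \<le> ((3 * M) ^ d) ^ (t - 1)"
    proof -
      have "card (ngrid M (2 * M) :: (real ^ 'n) set) \<le> (3 * M) ^ d"
        using order_trans[OF card_ngrid_le power_mono[OF le1(3)]] by (simp add: d_def)
      then show ?thesis by (simp add: card_PiE power_mono)
    qed
    have "card (frames R t q M :: 'n frame set) = D * (card (ngrid M (2 * R * M) :: (real ^ 'n) set)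
        * (card (rgrid M (R * M)) * card ({1..<t} \<rightarrow>\<^sub>E (ngrid M (2 * M) :: (real ^ 'n) set))))"
      unfolding frames_def D_def card_cartesian_product by (simp only: mult.assoc)
    also have "\<dots> \<le> (D + 1) * ((3 * R * M) ^ d * (2 * R * M * ((3 * M) ^ d) ^ (t - 1)))"
      by (intro mult_le_mono c1 c2 c3) simp
    finally have "real (card (frames R t q M :: 'n frame set))
        \<le> real ((D + 1) * ((3 * R * M) ^ d * (2 * R * M * ((3 * M) ^ d) ^ (t - 1))))"
      by (simp only: of_nat_le_iff)
    also have "\<dots> = W * real M ^ (d + 1 + d * (t - 1))"
      by (simp add: W_def power_mult_distrib power_add power_mult[symmetric] algebra_simps)
    finally show ?thesis .
  qed
  moreover have "W > 0" using assms by (simp add: W_def)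
  ultimately show ?thesis unfolding d_def by blast
qed

text \<open>Without scaling, the first hyperplane has the coefficients \<open>v\<close>.\<close>

definition rep_degenerate :: "nat \<Rightarrow> nat \<Rightarrow> ('n::finite) frame \<Rightarrow> real ^ 'n \<Rightarrow> nat \<Rightarrow> (real ^ 'n) set" where
  "rep_degenerate R t \<iota> v = (case \<iota> of (A\<^sub>0, As, ss, lam, a, r, Zs) \<Rightarrow>
     (\<lambda>l. framed_part A\<^sub>0 (a - real R *\<^sub>R ones) (1 / real R + r) ones t As ss (Zs(0 := v)) (\<lambda>X. lam X = l)))"

text \<open>With scaling by \<open>v\<close>, all the coefficients of the first hyperplane are \<open>1\<close>.\<close>

definition rep_scaled :: "nat \<Rightarrow> nat \<Rightarrow> ('n::finite) frame \<Rightarrow> real ^ 'n \<Rightarrow> nat \<Rightarrow> (real ^ 'n) set" where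
  "rep_scaled R t \<iota> v = (case \<iota> of (A\<^sub>0, As, ss, lam, a, r, Zs) \<Rightarrow>
     (\<lambda>l. framed_part A\<^sub>0 (a - real R *\<^sub>R ones) (1 / real R + r) v t As ss (Zs(0 := ones)) (\<lambda>X. lam X = l)))"

lemma frame_approx:
  fixes a :: "real ^ 'n" and Zs :: "nat \<Rightarrow> real ^ 'n"
  assumes M: "M \<ge> 1" and R: "R \<ge> 1"
    and a: "\<And>i. \<bar>a $ i\<bar> \<le> real R" and r: "1 / real R \<le> r" "r \<le> real R"
    and Z: "\<And>j i. j < t \<Longrightarrow> 0 \<le> Zs j $ i" "\<And>j i. j < t \<Longrightarrow> Zs j $ i \<le> 2"
  obtains a' r' Zs' where
    "a' \<in> ngrid M (2 * R * M)" "\<And>i. \<bar>a $ i - (a' - real R *\<^sub>R ones) $ i\<bar> \<le> 1 / M"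
    "r' \<in> rgrid M (R * M)" "\<bar>r - (1 / real R + r')\<bar> \<le> 1 / M" "1 / real R \<le> 1 / real R + r'" "1 / real R + r' \<le> real R"
    "Zs' \<in> {1..<t} \<rightarrow>\<^sub>E ngrid M (2 * M)"
    "\<And>j i. 0 < j \<Longrightarrow> j < t \<Longrightarrow> \<bar>Zs j $ i - Zs' j $ i\<bar> \<le> 1 / M"
proof -
  have M0: "M > 0" using M by simp
  obtain a' where a': "a' \<in> ngrid M (2 * R * M)" "\<And>i. a' $ i \<le> (a + real R *\<^sub>R ones) $ i"
    "\<And>i. (a + real R *\<^sub>R ones) $ i \<le> a' $ i + 1 / M"
  proof (rule ngrid_approx[OF M0, of "a + real R *\<^sub>R ones" "2 * R * M"])
    show "0 \<le> (a + real R *\<^sub>R ones) $ i" "(a + real R *\<^sub>R ones) $ i \<le> real (2 * R * M) / real M" for i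
      using a[of i] M0 by simp_all
  qed blast
  obtain r' where r': "r' \<in> rgrid M (R * M)" "r' \<le> r - 1 / real R" "r - 1 / real R \<le> r' + 1 / M" "0 \<le> r'"
  proof (rule rgrid_approx[OF M0, of "r - 1 / real R" "R * M"])
    show "0 \<le> r - 1 / real R" using r by simp
    have "1 / real R \<ge> 0" by simp
    then have "r - 1 / real R \<le> real R" using r by linarith
    then show "r - 1 / real R \<le> real (R * M) / real M" using M0 by simp
  qed blast
  have "\<exists>v. v \<in> ngrid M (2 * M) \<and> (\<forall>i. v $ i \<le> Zs j $ i \<and> Zs j $ i \<le> v $ i + 1 / M)" if jt: "j < t" for j
  proof -
    obtain v where "v \<in> ngrid M (2 * M)" "\<And>i. v $ i \<le> Zs j $ i" "\<And>i. Zs j $ i \<le> v $ i + 1 / M"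
      by (rule ngrid_approx[OF M0, of "Zs j" "2 * M"]) (use Z[OF jt] M0 in auto)
    then show ?thesis by blast
  qed
  then obtain g where g: "\<And>j. j < t \<Longrightarrow> g j \<in> ngrid M (2 * M)"
     "\<And>j i. j < t \<Longrightarrow> g j $ i \<le> Zs j $ i \<and> Zs j $ i \<le> g j $ i + 1 / M"
    by metis
  define Zs' where "Zs' = restrict g {1..<t}"
  have Zs': "Zs' \<in> {1..<t} \<rightarrow>\<^sub>E ngrid M (2 * M)" using g(1) by (auto simp: Zs'_def)
  have Zg: "Zs' j = g j" if "0 < j" "j < t" for j using that by (simp add: Zs'_def)
  have 1: "\<bar>Zs j $ i - Zs' j $ i\<bar> \<le> 1 / M" if "0 < j" "j < t" for j i
    using g(2)[OF that(2), of i] by (simp add: Zg[OF that] abs_le_iff)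
  have 4: "\<bar>a $ i - (a' - real R *\<^sub>R ones) $ i\<bar> \<le> 1 / M" for i
    using a'(2,3)[of i] by (simp add: abs_le_iff)
  have 5: "\<bar>r - (1 / real R + r')\<bar> \<le> 1 / M" "1 / real R \<le> 1 / real R + r'" "1 / real R + r' \<le> real R"
    using r' r by linarith+
  show ?thesis
    by (rule that[of a' r' Zs']) (fact a'(1) 4 r'(1) 5 Zs' 1)+
qed

text \<open>This covers the arrangements whose first hyperplane has a small coefficient. They need few
  representatives since one of the grid coordinates is small as well.\<close>

lemma cover_degenerate:
  fixes a :: "real ^ 'n" and Zs :: "nat \<Rightarrow> real ^ 'n"
  assumes M: "M \<ge> 1" and R: "R \<ge> 1" and t: "t \<ge> 1" and C: "C * (1 / M) \<le> 1"
    and pert: "perturb_const TYPE('n) R 1 t C"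
    and a: "\<And>i. \<bar>a $ i\<bar> \<le> real R" and r: "1 / real R \<le> r" "r \<le> real R"
    and As: "As \<in> {..<t} \<rightarrow>\<^sub>E UNIV" and ss: "ss \<in> {..<t} \<rightarrow>\<^sub>E {1, - 1}"
    and Z: "\<And>j i. j < t \<Longrightarrow> 0 \<le> Zs j $ i" "\<And>j i. j < t \<Longrightarrow> Zs j $ i \<le> 2"
    and lam: "lam \<in> Pow {..<t} \<rightarrow>\<^sub>E {1..q}"
    and small: "Zs 0 $ i\<^sub>0 \<le> real N / real M"
  shows "\<exists>\<iota>\<in>frames R t q M. \<exists>v\<in>{v \<in> ngrid M (2 * M). \<exists>i. v $ i \<le> real N / real M}.
     \<forall>l. measure lebesgue (symdiff (framed_part A\<^sub>0 a r ones t As ss Zs (\<lambda>X. lam X = l)) (rep_degenerate R t \<iota> v l)) \<le> C * (1 / M)"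
proof -
  obtain a' r' Zs' where *: "a' \<in> ngrid M (2 * R * M)" "\<And>i. \<bar>a $ i - (a' - real R *\<^sub>R ones) $ i\<bar> \<le> 1 / M"
    "r' \<in> rgrid M (R * M)" "\<bar>r - (1 / real R + r')\<bar> \<le> 1 / M" "1 / real R \<le> 1 / real R + r'" "1 / real R + r' \<le> real R"
    "Zs' \<in> {1..<t} \<rightarrow>\<^sub>E ngrid M (2 * M)"
    "\<And>j i. 0 < j \<Longrightarrow> j < t \<Longrightarrow> \<bar>Zs j $ i - Zs' j $ i\<bar> \<le> 1 / M"
    by (rule frame_approx[OF M R a r Z]) blast+
  obtain v where v: "v \<in> ngrid M (2 * M)" "\<And>i. v $ i \<le> Zs 0 $ i" "\<And>i. Zs 0 $ i \<le> v $ i + 1 / M"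
    by (rule ngrid_approx[of M "Zs 0" "2 * M"]) (use Z t M in auto)
  have "(A\<^sub>0, As, ss, lam, a', r', Zs') \<in> frames R t q M"
    using *(1,3,7) As ss lam by (simp add: frames_def)
  moreover have "v \<in> {v \<in> ngrid M (2 * M). \<exists>i. v $ i \<le> real N / real M}"
    using v(1) order_trans[OF v(2)[of i\<^sub>0] small] by auto
  moreover have "measure lebesgue (symdiff (framed_part A\<^sub>0 a r ones t As ss Zs (\<lambda>X. lam X = l))
      (rep_degenerate R t (A\<^sub>0, As, ss, lam, a', r', Zs') v l)) \<le> C * (1 / M)" for l
    unfolding rep_degenerate_def prod.case
  proof (rule perturb_constD[OF pert _ C r *(5,6,4) a *(2)])
    show "ss j \<in> {1, - 1}" if "j < t" for j using PiE_mem[OF ss] that by simp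
    show "\<bar>Zs j $ i - (Zs'(0 := v)) j $ i\<bar> \<le> 1 / M" if "j < t" for j i
    proof (cases "j = 0")
      case True
      then show ?thesis using v(2,3)[of i] by (simp add: abs_le_iff)
    next
      case False
      then show ?thesis using *(8)[of j i] that by simp
    qed
  qed (use M Z in simp_all)
  ultimately show ?thesis by blast
qed

definition fair_grid_points :: "nat \<Rightarrow> nat \<Rightarrow> nat \<Rightarrow> real \<Rightarrow> ('n::finite) frame \<Rightarrow> (real ^ 'n) set" where
  "fair_grid_points t q M \<tau> \<iota> = (case \<iota> of (A\<^sub>0, As, ss, lam, a, r, Zs) \<Rightarrow>
     {v \<in> ngrid M (2 * M). \<bar>measure lebesgue ({y. lam (pattern t As ss (Zs(0 := ones)) y) = 1} \<inter> cbox 0 v)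
               - 1 / q * measure lebesgue (cbox 0 v)\<bar> \<le> \<tau>})"

text \<open>This covers the nearly fair arrangements whose first hyperplane has no small coefficient. The
  grid arrangement that approximates such an arrangement is nearly fair, too, so it suffices to
  keep the grid points in \<^const>\<open>fair_grid_points\<close>.\<close>

lemma cover_scaled:
  fixes a z :: "real ^ 'n" and Zs :: "nat \<Rightarrow> real ^ 'n"
  assumes M: "M \<ge> 1" and R: "R \<ge> 1" and t: "t \<ge> 1" and C: "C * (1 / M) \<le> 1"
    and pert: "perturb_const TYPE('n) R e t C"
    and a: "\<And>i. \<bar>a $ i\<bar> \<le> real R" and r: "1 / real R \<le> r" "r \<le> real R"
    and As: "As \<in> {..<t} \<rightarrow>\<^sub>E UNIV" and ss: "ss \<in> {..<t} \<rightarrow>\<^sub>E {1, - 1}"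
    and Z: "\<And>j i. j < t \<Longrightarrow> 0 \<le> Zs j $ i" "\<And>j i. j < t \<Longrightarrow> Zs j $ i \<le> 2" and Z0: "Zs 0 = ones"
    and z: "\<And>i. e \<le> z $ i" "\<And>i. z $ i \<le> 2" and e: "1 / M < e"
    and lam: "lam \<in> Pow {..<t} \<rightarrow>\<^sub>E {1..q}"
    and fair: "\<bar>measure lebesgue (framed_part A\<^sub>0 a r z t As ss Zs (\<lambda>X. lam X = 1)) - r ^ CARD('n) / q\<bar> \<le> \<kappa>"
    and \<tau>: "(2 * real R) ^ CARD('n) * (\<kappa> + C * (1 / M)) \<le> \<tau>"
  shows "\<exists>\<iota>\<in>frames R t q M. \<exists>v\<in>fair_grid_points t q M \<tau> \<iota>.
     \<forall>l. measure lebesgue (symdiff (framed_part A\<^sub>0 a r z t As ss Zs (\<lambda>X. lam X = l)) (rep_scaled R t \<iota> v l)) \<le> C * (1 / M)"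
proof -
  obtain a' r' Zs' where *: "a' \<in> ngrid M (2 * R * M)" "\<And>i. \<bar>a $ i - (a' - real R *\<^sub>R ones) $ i\<bar> \<le> 1 / M"
    "r' \<in> rgrid M (R * M)" "\<bar>r - (1 / real R + r')\<bar> \<le> 1 / M" "1 / real R \<le> 1 / real R + r'" "1 / real R + r' \<le> real R"
    "Zs' \<in> {1..<t} \<rightarrow>\<^sub>E ngrid M (2 * M)"
    "\<And>j i. 0 < j \<Longrightarrow> j < t \<Longrightarrow> \<bar>Zs j $ i - Zs' j $ i\<bar> \<le> 1 / M"
    by (rule frame_approx[OF M R a r Z]) blast+
  have M0: "1 / real M > 0" using M by simp
  have z0: "z $ i > 0" for i using z(1)[of i] e M0 by linarith
  obtain v where v: "v \<in> ngrid M (2 * M)" "\<And>i. v $ i \<le> z $ i" "\<And>i. z $ i \<le> v $ i + 1 / M"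
    by (rule ngrid_approx[of M z "2 * M"]) (use z z0 M in \<open>auto simp: less_imp_le\<close>)
  have v0: "v $ i > 0" for i using v(3)[of i] z(1)[of i] e by linarith
  have v2: "v $ i \<le> 2" for i using v(2)[of i] z(2)[of i] by linarith
  have zv: "\<bar>z $ i - v $ i\<bar> \<le> 1 / M" for i using v(2,3)[of i] by (simp add: abs_le_iff)
  let ?\<iota> = "(A\<^sub>0, As, ss, lam, a', r', Zs')"
  have ss': "ss j \<in> {1, - 1}" if "j < t" for j using PiE_mem[OF ss] that by simp
  have ZZ: "\<bar>Zs j $ i - (Zs'(0 := ones)) j $ i\<bar> \<le> 1 / M" if "j < t" for j i
  proof (cases "j = 0")
    case True
    then show ?thesis using Z0 by simp
  next
    case False
    then show ?thesis using *(8)[of j i] that by simp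
  qed
  have 1: "measure lebesgue (symdiff (framed_part A\<^sub>0 a r z t As ss Zs (\<lambda>X. lam X = l)) (rep_scaled R t ?\<iota> v l)) \<le> C * (1 / M)" for l
    unfolding rep_scaled_def prod.case
    by (rule perturb_constD[OF pert M0 C r *(5,6,4) a *(2) z zv ss' Z ZZ])
  have 2: "measure lebesgue (symdiff (framed_part A\<^sub>0 a r z t As ss Zs (\<lambda>X. lam X = 1))
      (framed_part A\<^sub>0 a r v t As ss (Zs'(0 := ones)) (\<lambda>X. lam X = 1))) \<le> C * (1 / M)"
    by (rule perturb_constD[OF pert M0 C r r _ a _ z zv ss' Z ZZ]) (use M0 in auto)
  have rp: "r > 0" using r(1) R by (meson divide_pos_pos less_le_trans of_nat_0_less_iff zero_less_one less_le_trans)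
  define G where "G = framed_part A\<^sub>0 a r v t As ss (Zs'(0 := ones)) (\<lambda>X. lam X = 1)"
  have G: "\<bar>measure lebesgue G - r ^ CARD('n) / q\<bar> \<le> \<kappa> + C * (1 / M)"
    using fair 2 measure_diff_le_symdiff[OF framed_part_lmeasurable framed_part_lmeasurable,
        of A\<^sub>0 a r z t As ss Zs "\<lambda>X. lam X = 1" A\<^sub>0 a r v t As ss "Zs'(0 := ones)" "\<lambda>X. lam X = 1"]
    unfolding G_def by linarith
  define P where "P = {y. lam (pattern t As ss (Zs'(0 := ones)) y) = 1}"
  define \<pi> where "\<pi> = (\<Prod>i\<in>UNIV. v $ i / r)"
  have \<pi>0: "\<pi> \<ge> 0" unfolding \<pi>_def using v0 rp by (intro prod_nonneg) (simp add: less_imp_le)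
  have mG: "measure lebesgue (P \<inter> cbox 0 v) = \<pi> * measure lebesgue G"
  proof -
    have "\<pi> * (\<Prod>i\<in>UNIV. r / v $ i) = (\<Prod>i\<in>UNIV. (v $ i / r) * (r / v $ i))"
      by (simp only: \<pi>_def prod.distrib)
    also have "\<dots> = 1" using v0 rp by (intro prod.neutral) (simp add: less_imp_neq[symmetric])
    finally show ?thesis
      unfolding G_def P_def using measure_framed_part[OF rp v0, of A\<^sub>0 a t As ss "Zs'(0 := ones)" "\<lambda>X. lam X = 1"] by simp
  qed
  have mB: "measure lebesgue (cbox 0 v) = \<pi> * r ^ CARD('n)"
  proof -
    have "measure lebesgue (cbox 0 v) = (\<Prod>i\<in>UNIV. v $ i)"
      unfolding measure_completion[OF borel_closed[OF closed_cbox, folded sets_lborel]]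
      using v0 by (subst content_cbox_cart) (auto simp: interval_ne_empty_cart less_imp_le)
    then show ?thesis using rp by (simp add: \<pi>_def prod_dividef)
  qed
  have "\<bar>measure lebesgue (P \<inter> cbox 0 v) - 1 / q * measure lebesgue (cbox 0 v)\<bar>
      = \<pi> * \<bar>measure lebesgue G - r ^ CARD('n) / q\<bar>"
  proof -
    have "measure lebesgue (P \<inter> cbox 0 v) - 1 / q * measure lebesgue (cbox 0 v)
        = \<pi> * (measure lebesgue G - r ^ CARD('n) / q)"
      by (simp add: mG mB right_diff_distrib)
    then show ?thesis using \<pi>0 by (simp only: abs_mult abs_of_nonneg)
  qed
  also have "\<dots> \<le> (2 * real R) ^ CARD('n) * (\<kappa> + C * (1 / M))"
  proof (rule mult_mono)
    have "\<pi> \<le> (\<Prod>i\<in>(UNIV :: 'n set). 2 * real R)"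
      unfolding \<pi>_def
    proof (rule prod_mono)
      fix i
      have "1 / r \<le> R" using r(1) rp R by (simp add: field_simps)
      then have "v $ i * (1 / r) \<le> 2 * real R" using v2[of i] v0[of i] rp by (intro mult_mono) auto
      then show "0 \<le> v $ i / r \<and> v $ i / r \<le> 2 * real R" using v0[of i] rp by simp
    qed
    then show "\<pi> \<le> (2 * real R) ^ CARD('n)" by simp
  qed (use G in auto)
  also have "\<dots> \<le> \<tau>" by (rule \<tau>)
  finally have "v \<in> fair_grid_points t q M \<tau> ?\<iota>"
    using v(1) by (simp add: fair_grid_points_def P_def)
  moreover have "?\<iota> \<in> frames R t q M"
    using *(1,3,7) As ss lam by (simp add: frames_def)
  ultimately show ?thesis using 1 by blast
qed

section \<open>A small cover of the nearly fair arrangements\<close>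

text \<open>Here an arrangement is a sequence of pairs of a normal vector and an offset.\<close>

definition upper_pattern :: "nat \<Rightarrow> (nat \<Rightarrow> (real ^ 'n) \<times> real) \<Rightarrow> real ^ 'n \<Rightarrow> nat set" where
  "upper_pattern t H x = {j. j < t \<and> snd (H j) < fst (H j) \<bullet> x}"

definition part :: "real ^ 'n \<Rightarrow> real \<Rightarrow> nat \<Rightarrow> (nat \<Rightarrow> (real ^ 'n) \<times> real) \<Rightarrow> (nat set \<Rightarrow> bool) \<Rightarrow> (real ^ 'n) set" where
  "part a r t H L = {x \<in> ncube a r. L (upper_pattern t H x)}"

definition in_form :: "'n set \<Rightarrow> real ^ 'n \<Rightarrow> real \<Rightarrow> real ^ 'n \<Rightarrow> (real ^ 'n) \<times> real \<Rightarrow> 'n set \<Rightarrow> real \<Rightarrow> real ^ 'n \<Rightarrow> bool" where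
  "in_form A\<^sub>0 a r z h A s \<zeta> \<longleftrightarrow> s \<in> {1, - 1} \<and> (\<forall>i. 0 \<le> \<zeta> $ i \<and> \<zeta> $ i \<le> 2) \<and>
     (\<forall>x. snd h < fst h \<bullet> x \<longleftrightarrow> 0 < side A s \<zeta> (coord A\<^sub>0 a r z x))"

lemma part_eq_framed_part:
  assumes "\<And>j. j < t \<Longrightarrow> in_form A\<^sub>0 a r z (H j) (As j) (ss j) (Zs j)"
  shows "part a r t H L = framed_part A\<^sub>0 a r z t As ss Zs L"
proof -
  have "upper_pattern t H x = pattern t As ss Zs (coord A\<^sub>0 a r z x)" for x
    using assms by (auto simp: upper_pattern_def pattern_def in_form_def)
  then show ?thesis by (simp add: part_def framed_part_def)
qed

lemma all_in_form:
  fixes H :: "nat \<Rightarrow> (real ^ 'n) \<times> real"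
  assumes r: "r > 0" and z: "\<And>i. z $ i > 0" and H: "\<And>j. j < t \<Longrightarrow> fst (H j) \<noteq> 0"
    and first: "in_form A\<^sub>0 a r z (H 0) A s \<zeta>"
  obtains As ss Zs where "As \<in> {..<t} \<rightarrow>\<^sub>E UNIV" "ss \<in> {..<t} \<rightarrow>\<^sub>E {1, - 1}" "Zs 0 = \<zeta>"
    "\<And>j. j < t \<Longrightarrow> in_form A\<^sub>0 a r z (H j) (As j) (ss j) (Zs j)"
proof -
  have "\<exists>A' s' \<zeta>'. in_form A\<^sub>0 a r z (H j) A' s' \<zeta>' \<and> (j = 0 \<longrightarrow> \<zeta>' = \<zeta>)" if j: "j < t" for j
  proof (cases "j = 0")
    case True
    then show ?thesis using first by blast
  next
    case False
    obtain A' s' \<zeta>' where "s' \<in> {1, - 1 :: real}" "\<And>i. 0 \<le> \<zeta>' $ i \<and> \<zeta>' $ i \<le> 2"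
      "\<And>x. snd (H j) < fst (H j) \<bullet> x \<longleftrightarrow> 0 < side A' s' \<zeta>' (coord A\<^sub>0 a r z x)"
      by (rule halfspace_side_form_coord[OF H[OF j] r z, of "snd (H j)" A\<^sub>0 a]) blast
    then have "in_form A\<^sub>0 a r z (H j) A' s' \<zeta>'" by (simp add: in_form_def)
    then show ?thesis using False by blast
  qed
  then obtain As ss Zs where *: "\<And>j. j < t \<Longrightarrow> in_form A\<^sub>0 a r z (H j) (As j) (ss j) (Zs j)"
    "\<And>j. j < t \<Longrightarrow> j = 0 \<Longrightarrow> Zs j = \<zeta>"
    by metis
  show ?thesis
  proof (rule that[of "restrict As {..<t}" "restrict ss {..<t}" "Zs(0 := \<zeta>)"])
    show "restrict ss {..<t} \<in> {..<t} \<rightarrow>\<^sub>E {1, - 1}"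
      using * by (auto simp: in_form_def)
    show "in_form A\<^sub>0 a r z (H j) (restrict As {..<t} j) (restrict ss {..<t} j) ((Zs(0 := \<zeta>)) j)" if "j < t" for j
      using *(1)[OF that] *(2)[OF that] that by (cases "j = 0") simp_all
  qed auto
qed

lemma card_family_le:
  assumes "finite I" "\<And>\<iota>. \<iota> \<in> I \<Longrightarrow> finite (T \<iota>)" "\<And>\<iota>. \<iota> \<in> I \<Longrightarrow> real (card (T \<iota>)) \<le> x"
  shows "finite (\<Union>\<iota>\<in>I. f \<iota> ` T \<iota>)" "real (card (\<Union>\<iota>\<in>I. f \<iota> ` T \<iota>)) \<le> real (card I) * x"
proof -
  show "finite (\<Union>\<iota>\<in>I. f \<iota> ` T \<iota>)" using assms by auto
  have "card (\<Union>\<iota>\<in>I. f \<iota> ` T \<iota>) \<le> (\<Sum>\<iota>\<in>I. card (f \<iota> ` T \<iota>))"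
    by (rule card_UN_le[OF assms(1)])
  also have "\<dots> \<le> (\<Sum>\<iota>\<in>I. card (T \<iota>))"
    using assms(2) by (intro sum_mono card_image_le)
  finally have "real (card (\<Union>\<iota>\<in>I. f \<iota> ` T \<iota>)) \<le> (\<Sum>\<iota>\<in>I. real (card (T \<iota>)))"
    by (metis of_nat_le_iff of_nat_sum)
  also have "\<dots> \<le> (\<Sum>\<iota>\<in>I. x)" using assms(3) by (rule sum_mono)
  finally show "real (card (\<Union>\<iota>\<in>I. f \<iota> ` T \<iota>)) \<le> real (card I) * x" by simp
qed

definition bounded_arrangement :: "nat \<Rightarrow> nat \<Rightarrow> real ^ 'n \<Rightarrow> real \<Rightarrow> (nat \<Rightarrow> (real ^ 'n) \<times> real) \<Rightarrow> bool" where
  "bounded_arrangement R t a r H \<longleftrightarrow> (\<forall>i. \<bar>a $ i\<bar> \<le> real R) \<and> 1 / real R \<le> r \<and> r \<le> real R \<and> (\<forall>j<t. fst (H j) \<noteq> 0)"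

definition covers :: "(nat \<Rightarrow> (real ^ 'n) set) set \<Rightarrow> real \<Rightarrow> (nat \<Rightarrow> (real ^ 'n) set) \<Rightarrow> bool" where
  "covers \<R> \<delta> S \<longleftrightarrow> (\<exists>Q\<in>\<R>. \<forall>l. measure lebesgue (symdiff (S l) (Q l)) \<le> \<delta>)"

definition nearly_fair_cover :: "nat \<Rightarrow> nat \<Rightarrow> nat \<Rightarrow> nat \<Rightarrow> nat \<Rightarrow> (nat \<Rightarrow> (real ^ 'n) set) set \<Rightarrow> bool" where
  "nearly_fair_cover R t q k K \<R> \<longleftrightarrow> finite \<R> \<and> (\<forall>Q\<in>\<R>. \<forall>l. Q l \<in> lmeasurable) \<and>
     (\<forall>a r H lam. bounded_arrangement R t a r H \<longrightarrow> lam \<in> Pow {..<t} \<rightarrow>\<^sub>E {1..q} \<longrightarrow>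
        \<bar>measure lebesgue (part a r t H (\<lambda>X. lam X = 1)) - r ^ CARD('n) / q\<bar> \<le> real k / real K \<longrightarrow>
        covers \<R> (1 / K) (\<lambda>l. part a r t H (\<lambda>X. lam X = l)))"

text \<open>Up to a constant factor, \<open>K\<close> to the number of parameters counts all cells of size \<open>1 / K\<close>. The factor
  \<open>\<epsilon>\<close> is what the volume condition gains; it makes up for the dimension that is missing in the
  comparison with the number of equations.

  The bound \<open>e\<close> below which a coefficient counts as small is chosen first. The Lipschitz constant \<open>CB\<close> for
  the arrangements without small coefficients depends on it, so the thin set of the scaling
  factors has to be made small afterwards.\<close>

lemma nearly_fair_covering:
  fixes R t q k :: nat and \<epsilon> :: real
  assumes R: "R \<ge> 1" and t: "t \<ge> 1" and q: "q \<ge> 2" and \<epsilon>: "\<epsilon> > 0"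
  shows "\<exists>K\<^sub>0. \<forall>K\<ge>K\<^sub>0. \<exists>\<R> :: (nat \<Rightarrow> (real ^ 'n) set) set.
     nearly_fair_cover R t q k K \<R> \<and> real (card \<R>) \<le> \<epsilon> * real K ^ (CARD('n) * t + CARD('n) + 1)"
proof -
  define d where "d = CARD('n)"
  define m' where "m' = d + 1 + d * (t - 1)"
  define m where "m = d * t + d + 1"
  have m: "m = m' + d" using t by (cases t) (simp_all add: m_def m'_def)
  have d1: "d \<ge> 1" by (simp add: d_def Suc_leI)
  have R1: "real R \<ge> 1" using R by simp
  obtain W where W: "W > 0" "\<And>M. M \<ge> 1 \<Longrightarrow> real (card (frames R t q M :: 'n frame set)) \<le> W * real M ^ m'"
    using card_frames_le[OF t R, of q, where 'n='n] unfolding m'_def d_def by blast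
  obtain CA where CA: "CA > 0" "perturb_const TYPE('n) R 1 t CA"
    using perturb_const_exists[OF R1, of 1 t, where 'n='n] by auto
  define LA where "LA = nat \<lceil>CA\<rceil>"
  have LA: "real LA \<ge> CA" "LA \<ge> 1" using CA(1) unfolding LA_def by (linarith, simp add: le_nat_iff)
  \<comment> \<open>below \<open>e\<close> a coefficient counts as small; half of \<open>\<epsilon>\<close> is spent on such arrangements\<close>
  define e where "e = min 1 (\<epsilon> / (2 * W * d * 3 ^ d * real LA ^ m))"
  have e: "e > 0" "e \<le> 1" using \<epsilon> W d1 LA by (simp_all add: e_def)
  have eW: "W * (d * e * 3 ^ d) * real LA ^ m \<le> \<epsilon> / 2"
  proof -
    have "2 * W * d * 3 ^ d * real LA ^ m > 0" using W d1 LA by simp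
    then have "e * (2 * W * d * 3 ^ d * real LA ^ m) \<le> \<epsilon>"
      by (simp add: e_def pos_le_divide_eq[symmetric])
    then show ?thesis by (simp add: algebra_simps)
  qed
  obtain CB where CB: "CB > 0" "perturb_const TYPE('n) R e t CB"
    using perturb_const_exists[OF R1 e(1), of t, where 'n='n] by auto
  define LB where "LB = nat \<lceil>CB\<rceil>"
  have LB: "real LB \<ge> CB" "LB \<ge> 1" using CB(1) unfolding LB_def by (linarith, simp add: le_nat_iff)
  define \<epsilon>' where "\<epsilon>' = \<epsilon> / (2 * W * real LB ^ m)"
  have \<epsilon>': "\<epsilon>' > 0" using \<epsilon> W LB by (simp add: \<epsilon>'_def)
  have eB: "W * \<epsilon>' * real LB ^ m = \<epsilon> / 2" using W LB by (simp add: \<epsilon>'_def)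
  have q': "0 < 1 / real q" "1 / real q < 1" using q by simp_all
  obtain \<tau> M\<^sub>0 where \<tau>: "\<tau> > 0" and thin: "\<And>M As ss (Zs :: nat \<Rightarrow> real ^ 'n) L. M \<ge> M\<^sub>0 \<Longrightarrow>
     (\<forall>j<t. ss j \<in> {1, - 1} \<and> (\<forall>i. 0 \<le> Zs j $ i \<and> Zs j $ i \<le> 2)) \<Longrightarrow>
     card {v \<in> ngrid M (2 * M). \<bar>measure lebesgue ({y. L (pattern t As ss Zs y)} \<inter> cbox 0 v)
               - 1 / real q * measure lebesgue (cbox 0 v)\<bar> \<le> \<tau>} \<le> \<epsilon>' * real M ^ d"
    using card_fair_ngrid_le[OF q' \<epsilon>', of t, where 'n='n] unfolding d_def by blast
  obtain K\<^sub>1 :: nat where K1: "1 / e < K\<^sub>1" using reals_Archimedean2 by blast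
  obtain K\<^sub>2 :: nat where K2: "(2 * real R) ^ d * (k + 1) / \<tau> < K\<^sub>2" using reals_Archimedean2 by blast
  define K\<^sub>0 where "K\<^sub>0 = max (max 1 K\<^sub>1) (max K\<^sub>2 M\<^sub>0)"
  have "\<exists>\<R> :: (nat \<Rightarrow> (real ^ 'n) set) set.
     nearly_fair_cover R t q k K \<R> \<and> real (card \<R>) \<le> \<epsilon> * real K ^ m" if K: "K \<ge> K\<^sub>0" for K
  proof -
    have K': "K \<ge> 1" "K \<ge> K\<^sub>1" "K \<ge> K\<^sub>2" "K \<ge> M\<^sub>0" using K by (simp_all add: K\<^sub>0_def)
    have Kr: "real K \<ge> 1" "real K > 1 / e" "real K > (2 * real R) ^ d * (k + 1) / \<tau>"
      using K'(1) K1 K2 of_nat_mono[OF K'(2), where 'a=real] of_nat_mono[OF K'(3), where 'a=real] by linarith+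
    \<comment> \<open>the representatives for arrangements whose first hyperplane is nearly parallel to an axis\<close>
    define MA where "MA = LA * K"
    define N where "N = nat \<lceil>e * MA\<rceil>"
    define TA where "TA = {v \<in> ngrid MA (2 * MA) :: (real ^ 'n) set. \<exists>i. v $ i \<le> real N / real MA}"
    define RA where "RA = (\<Union>\<iota>\<in>frames R t q MA. rep_degenerate R t \<iota> ` TA)"
    have MA1: "MA \<ge> 1" using LA K' by (simp add: MA_def Suc_le_eq)
    have KMA: "real K \<le> real MA" using LA(2) Kr by (simp add: MA_def mult_le_cancel_right1)
    have CMA: "CA * (1 / MA) \<le> 1 / K" using LA Kr by (simp add: MA_def field_simps)
    have eM: "e * MA \<ge> 1"
    proof -
      have "1 / e \<le> MA" using Kr(2) KMA by linarith
      then show ?thesis using e by (simp add: field_simps)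
    qed
    have N: "real N \<ge> e * MA" "real N + 1 \<le> 3 * (e * MA)"
      using eM unfolding N_def by linarith+
    have cTA: "real (card TA) \<le> d * e * 3 ^ d * real MA ^ d"
    proof -
      have "real (card TA) \<le> real (d * ((N + 1) * (2 * MA + 1) ^ (d - 1)))"
        unfolding TA_def d_def of_nat_le_iff by (rule card_ngrid_thin_le)
      also have "\<dots> = d * ((real N + 1) * (2 * real MA + 1) ^ (d - 1))" by (simp add: algebra_simps)
      also have "\<dots> \<le> d * ((3 * (e * MA)) * (3 * real MA) ^ (d - 1))"
        using N MA1 e by (intro mult_left_mono mult_mono power_mono) auto
      also have "\<dots> = d * (e * ((3 * real MA) * (3 * real MA) ^ (d - 1)))" by simp
      also have "(3 * real MA) * (3 * real MA) ^ (d - 1) = (3 * real MA) ^ d"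
        using d1 by (cases d) simp_all
      finally show ?thesis by (simp add: power_mult_distrib algebra_simps)
    qed
    have RA: "finite RA" "real (card RA) \<le> real (card (frames R t q MA :: 'n frame set)) * (d * e * 3 ^ d * real MA ^ d)"
      unfolding RA_def by (rule card_family_le[OF finite_frames]; use cTA in \<open>simp add: TA_def\<close>)+
    have "real (card RA) \<le> (W * real MA ^ m') * (d * e * 3 ^ d * real MA ^ d)"
      by (rule order_trans[OF RA(2)], intro mult_right_mono W MA1) (use e in simp)
    also have "\<dots> = (W * (d * e * 3 ^ d) * real LA ^ m) * real K ^ m"
      by (simp add: m MA_def power_mult_distrib power_add)
    also have "\<dots> \<le> \<epsilon> / 2 * real K ^ m" by (intro mult_right_mono eW) simp
    finally have cRA: "real (card RA) \<le> \<epsilon> / 2 * real K ^ m" .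
    \<comment> \<open>the representatives for all other arrangements\<close>
    define MB where "MB = LB * K"
    define RB where "RB = (\<Union>\<iota>\<in>frames R t q MB. rep_scaled R t \<iota> ` (fair_grid_points t q MB \<tau> \<iota> :: (real ^ 'n) set))"
    have MB1: "MB \<ge> 1" using LB K' by (simp add: MB_def Suc_le_eq)
    have KMB: "real K \<le> real MB" using LB(2) Kr by (simp add: MB_def mult_le_cancel_right1)
    have CMB: "CB * (1 / MB) \<le> 1 / K" using LB Kr by (simp add: MB_def field_simps)
    have cTB: "real (card (fair_grid_points t q MB \<tau> \<iota>)) \<le> \<epsilon>' * real MB ^ d" "finite (fair_grid_points t q MB \<tau> \<iota>)"
      if \<iota>: "\<iota> \<in> frames R t q MB" for \<iota> :: "'n frame"
    proof -
      obtain A\<^sub>0 As ss lam a r Zs where eq: "\<iota> = (A\<^sub>0, As, ss, lam, a, r, Zs)" by (cases \<iota>)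
      have ss: "ss \<in> {..<t} \<rightarrow>\<^sub>E {1, - 1}" and Zs: "Zs \<in> {1..<t} \<rightarrow>\<^sub>E ngrid MB (2 * MB)"
        using \<iota> by (simp_all add: eq frames_def)
      have "\<forall>j<t. ss j \<in> {1, - 1} \<and> (\<forall>i. 0 \<le> (Zs(0 := ones)) j $ i \<and> (Zs(0 := ones)) j $ i \<le> 2)"
      proof (intro allI impI conjI)
        fix j i assume j: "j < t"
        show "ss j \<in> {1, - 1}" using PiE_mem[OF ss] j by simp
        have "0 \<le> Zs j $ i" "Zs j $ i \<le> 2" if "j \<noteq> 0"
        proof -
          have "Zs j \<in> ngrid MB (2 * MB)" using PiE_mem[OF Zs, of j] j that by simp
          then show "0 \<le> Zs j $ i" "Zs j $ i \<le> 2"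
            using ngrid_nonneg[of "Zs j"] ngrid_le[of "Zs j" MB "2 * MB" i] MB1 by simp_all
        qed
        then show "0 \<le> (Zs(0 := ones)) j $ i" "(Zs(0 := ones)) j $ i \<le> 2"
          by (cases "j = 0"; simp)+
      qed
      moreover have "MB \<ge> M\<^sub>0" using KMB K'(4) by linarith
      ultimately show "real (card (fair_grid_points t q MB \<tau> \<iota>)) \<le> \<epsilon>' * real MB ^ d"
        unfolding eq fair_grid_points_def prod.case by (intro thin)
      show "finite (fair_grid_points t q MB \<tau> \<iota>)" by (simp add: eq fair_grid_points_def)
    qed
    have RB: "finite RB" "real (card RB) \<le> real (card (frames R t q MB :: 'n frame set)) * (\<epsilon>' * real MB ^ d)"
      unfolding RB_def by (rule card_family_le[OF finite_frames cTB(2,1)]; assumption)+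
    have "real (card RB) \<le> (W * real MB ^ m') * (\<epsilon>' * real MB ^ d)"
      by (rule order_trans[OF RB(2)], intro mult_right_mono W MB1) (use \<epsilon>' in simp)
    also have "\<dots> = (W * \<epsilon>' * real LB ^ m) * real K ^ m"
      by (simp add: m MB_def power_mult_distrib power_add)
    also have "\<dots> = \<epsilon> / 2 * real K ^ m" by (simp only: eB)
    finally have cRB: "real (card RB) \<le> \<epsilon> / 2 * real K ^ m" .
    have card: "real (card (RA \<union> RB)) \<le> \<epsilon> * real K ^ m"
    proof -
      have "real (card (RA \<union> RB)) \<le> real (card RA) + real (card RB)"
        using card_Un_le[of RA RB] by linarith
      also have "\<dots> \<le> \<epsilon> / 2 * real K ^ m + \<epsilon> / 2 * real K ^ m" by (intro add_mono cRA cRB)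
      finally show ?thesis by (simp add: field_simps)
    qed
    have meas: "Q l \<in> lmeasurable" if "Q \<in> RA \<union> RB" for Q l
      using that by (auto simp: RA_def RB_def rep_degenerate_def rep_scaled_def split: prod.splits)
    have "covers (RA \<union> RB) (1 / K) (\<lambda>l. part a r t H (\<lambda>X. lam X = l))"
      if cl: "bounded_arrangement R t a r H" and lam: "lam \<in> Pow {..<t} \<rightarrow>\<^sub>E {1..q}"
        and fair: "\<bar>measure lebesgue (part a r t H (\<lambda>X. lam X = 1)) - r ^ d / q\<bar> \<le> real k / real K"
      for a r and H :: "nat \<Rightarrow> (real ^ 'n) \<times> real" and lam
    proof -
      have a: "\<And>i. \<bar>a $ i\<bar> \<le> real R" and r: "1 / real R \<le> r" "r \<le> real R"
        and H: "\<And>j. j < t \<Longrightarrow> fst (H j) \<noteq> 0"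
        using cl by (simp_all add: bounded_arrangement_def)
      have "1 / real R > 0" using R by simp
      then have rp: "r > 0" using r by linarith
      have t0: "0 < t" using t by simp
      obtain A\<^sub>0 s \<zeta> where \<zeta>: "s \<in> {1, - 1 :: real}" "\<And>i. 0 \<le> \<zeta> $ i \<and> \<zeta> $ i \<le> 2"
        "\<And>x. snd (H 0) < fst (H 0) \<bullet> x \<longleftrightarrow> 0 < side {} s \<zeta> (coord A\<^sub>0 a r ones x)"
        by (rule first_halfspace_form[OF H[OF t0] rp, of "snd (H 0)" a]) blast
      show ?thesis
      proof (cases "\<exists>i. \<zeta> $ i < e")
        case True
        then obtain i\<^sub>0 where "\<zeta> $ i\<^sub>0 < e" ..
        moreover have "e \<le> real N / real MA" using N(1) MA1 by (simp add: field_simps)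
        ultimately have small: "\<zeta> $ i\<^sub>0 \<le> real N / real MA" by linarith
        have "in_form A\<^sub>0 a r ones (H 0) {} s \<zeta>" using \<zeta> by (simp add: in_form_def)
        then obtain As ss Zs where *: "As \<in> {..<t} \<rightarrow>\<^sub>E UNIV" "ss \<in> {..<t} \<rightarrow>\<^sub>E {1, - 1}" "Zs 0 = \<zeta>"
          "\<And>j. j < t \<Longrightarrow> in_form A\<^sub>0 a r ones (H j) (As j) (ss j) (Zs j)"
          by (rule all_in_form[rotated 3]) (use rp H in auto)
        have Z: "\<And>j i. j < t \<Longrightarrow> 0 \<le> Zs j $ i" "\<And>j i. j < t \<Longrightarrow> Zs j $ i \<le> 2"
          using *(4) by (simp_all add: in_form_def)
        have C1: "CA * (1 / MA) \<le> 1" using CMA Kr(1) by (smt (verit) divide_le_eq_1)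
        have small': "Zs 0 $ i\<^sub>0 \<le> real N / real MA" using small *(3) by simp
        obtain \<iota> v where \<iota>: "\<iota> \<in> frames R t q MA" "v \<in> TA"
          "\<forall>l. measure lebesgue (symdiff (framed_part A\<^sub>0 a r ones t As ss Zs (\<lambda>X. lam X = l)) (rep_degenerate R t \<iota> v l)) \<le> CA * (1 / MA)"
          using cover_degenerate[where Zs = Zs and t = t and A\<^sub>0 = A\<^sub>0, OF MA1 R t C1 CA(2) a r *(1,2) Z lam small']
          unfolding TA_def[symmetric] by blast
        have "\<forall>l. measure lebesgue (symdiff (part a r t H (\<lambda>X. lam X = l)) (rep_degenerate R t \<iota> v l)) \<le> 1 / K"
          using \<iota>(3) CMA part_eq_framed_part[OF *(4)] by (auto intro: order_trans)
        moreover have "rep_degenerate R t \<iota> v \<in> RA \<union> RB" using \<iota>(1,2) unfolding RA_def by blast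
        ultimately show ?thesis unfolding covers_def by blast
      next
        case False
        then have \<zeta>e: "e \<le> \<zeta> $ i" for i by (simp add: not_less)
        have \<zeta>2: "\<zeta> $ i \<le> 2" for i using \<zeta>(2)[of i] by simp
        have \<zeta>0: "\<zeta> $ i > 0" for i using \<zeta>e[of i] e by linarith
        have "in_form A\<^sub>0 a r \<zeta> (H 0) {} s ones"
          using \<zeta> by (simp add: in_form_def side_rescale)
        then obtain As ss Zs where *: "As \<in> {..<t} \<rightarrow>\<^sub>E UNIV" "ss \<in> {..<t} \<rightarrow>\<^sub>E {1, - 1}" "Zs 0 = ones"
          "\<And>j. j < t \<Longrightarrow> in_form A\<^sub>0 a r \<zeta> (H j) (As j) (ss j) (Zs j)"
          by (rule all_in_form[rotated 3]) (use rp H \<zeta>0 in auto)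
        have Z: "\<And>j i. j < t \<Longrightarrow> 0 \<le> Zs j $ i" "\<And>j i. j < t \<Longrightarrow> Zs j $ i \<le> 2"
          using *(4) by (simp_all add: in_form_def)
        have C1: "CB * (1 / MB) \<le> 1" using CMB Kr(1) by (smt (verit) divide_le_eq_1)
        have eMB: "1 / MB < e"
        proof -
          have "1 / e < MB" using Kr(2) KMB by linarith
          then show ?thesis using e MB1 by (simp add: field_simps)
        qed
        have \<tau>': "(2 * real R) ^ CARD('n) * (real k / real K + CB * (1 / MB)) \<le> \<tau>"
        proof -
          have "(2 * real R) ^ d * (real k / real K + CB * (1 / MB)) \<le> (2 * real R) ^ d * (real k / real K + 1 / K)"
            using CMB by (intro mult_left_mono) auto
          also have "\<dots> = (2 * real R) ^ d * (k + 1) / K"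
            by (simp only: of_nat_add of_nat_1 add_divide_distrib[symmetric] times_divide_eq_right)
          also have "\<dots> \<le> \<tau>"
          proof -
            have "(2 * real R) ^ d * (k + 1) < K * \<tau>" using Kr(3) by (simp only: pos_divide_less_eq[OF \<tau>])
            then show ?thesis using Kr(1) by (simp add: pos_divide_le_eq mult.commute)
          qed
          finally show ?thesis by (simp only: d_def)
        qed
        have fair': "\<bar>measure lebesgue (framed_part A\<^sub>0 a r \<zeta> t As ss Zs (\<lambda>X. lam X = 1)) - r ^ CARD('n) / q\<bar> \<le> real k / real K"
          using fair part_eq_framed_part[OF *(4)] by (simp add: d_def)
        obtain \<iota> v where \<iota>: "\<iota> \<in> frames R t q MB" "v \<in> fair_grid_points t q MB \<tau> \<iota>"
          "\<forall>l. measure lebesgue (symdiff (framed_part A\<^sub>0 a r \<zeta> t As ss Zs (\<lambda>X. lam X = l)) (rep_scaled R t \<iota> v l)) \<le> CB * (1 / MB)"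
          using cover_scaled[where Zs = Zs and t = t and A\<^sub>0 = A\<^sub>0, OF MB1 R t C1 CB(2) a r *(1,2) Z *(3) \<zeta>e \<zeta>2 eMB lam fair' \<tau>']
          by blast
        have "\<forall>l. measure lebesgue (symdiff (part a r t H (\<lambda>X. lam X = l)) (rep_scaled R t \<iota> v l)) \<le> 1 / K"
          using \<iota>(3) CMB part_eq_framed_part[OF *(4)] by (auto intro: order_trans)
        moreover have "rep_scaled R t \<iota> v \<in> RA \<union> RB" using \<iota>(1,2) unfolding RB_def by blast
        ultimately show ?thesis unfolding covers_def by blast
      qed
    qed
    then have "nearly_fair_cover R t q k K (RA \<union> RB)"
      unfolding nearly_fair_cover_def d_def[symmetric] using RA(1) RB(1) meas by simp
    then show ?thesis using card by blast
  qed
  then show ?thesis unfolding m_def d_def by blast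
qed

section \<open>Cubes inside large parts, recolorings, and a counting lemma\<close>

text \<open>Otherwise the part would lie in the union of thin strips around the cuts and around the faces of
  the necklace.\<close>

lemma large_part_contains_cube:
  fixes R t :: nat and v\<^sub>0 :: real
  assumes R: "R \<ge> 1" and t: "t \<ge> 1" and v0: "v\<^sub>0 > 0"
  shows "\<exists>\<rho>>0. \<forall>a r (H :: nat \<Rightarrow> (real ^ 'n) \<times> real) L. bounded_arrangement R t a r H \<longrightarrow>
     v\<^sub>0 \<le> measure lebesgue (part a r t H L) \<longrightarrow> (\<exists>x. {x'. \<forall>i. \<bar>x' $ i - x $ i\<bar> \<le> \<rho>} \<subseteq> part a r t H L)"
proof -
  obtain C where C: "C > 0" "\<And>A (\<zeta> :: real ^ 'n) \<eta>. \<eta> > 0 \<Longrightarrow> (\<And>i. 0 \<le> \<zeta> $ i) \<Longrightarrow>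
      measure lebesgue (strip A \<zeta> \<eta>) \<le> C * \<eta>"
    using measure_strip_le by metis
  define d where "d = real CARD('n)"
  have d: "d \<ge> 1" by (simp add: d_def Suc_leI)
  have R1: "real R \<ge> 1" using R by simp
  define M where "M = (t + 2 * d) * (real R ^ CARD('n) * C)"
  have M: "M > 0" using C d R by (simp add: M_def add_nonneg_pos)
  define \<eta> where "\<eta> = v\<^sub>0 / (2 * M)"
  have \<eta>: "\<eta> > 0" "M * \<eta> < v\<^sub>0" using v0 M by (simp_all add: \<eta>_def)
  define \<rho> where "\<rho> = \<eta> / (4 * d * R)"
  have \<rho>: "\<rho> > 0" using \<eta> d R1 by (simp add: \<rho>_def)
  have "\<exists>x. {x'. \<forall>i. \<bar>x' $ i - x $ i\<bar> \<le> \<rho>} \<subseteq> part a r t H L"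
    if cl: "bounded_arrangement R t a r H" and large: "v\<^sub>0 \<le> measure lebesgue (part a r t H L)"
    for a r and H :: "nat \<Rightarrow> (real ^ 'n) \<times> real" and L
  proof -
    have a: "\<And>i. \<bar>a $ i\<bar> \<le> real R" and r: "1 / real R \<le> r" "r \<le> real R"
      and H: "\<And>j. j < t \<Longrightarrow> fst (H j) \<noteq> 0"
      using cl by (simp_all add: bounded_arrangement_def)
    have "1 / real R > 0" using R by simp
    then have rp: "r > 0" using r by linarith
    have t0: "0 < t" using t by simp
    have one: "\<And>i. (ones :: real ^ 'n) $ i > 0" by simp
    obtain A s \<zeta> where "s \<in> {1, - 1 :: real}" "\<And>i. 0 \<le> \<zeta> $ i \<and> \<zeta> $ i \<le> 2"
        "\<And>x. snd (H 0) < fst (H 0) \<bullet> x \<longleftrightarrow> 0 < side A s \<zeta> (coord {} a r ones x)"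
      by (rule halfspace_side_form_coord[OF H[OF t0] rp one, of "snd (H 0)" "{}" a]) blast
    then have "in_form {} a r ones (H 0) A s \<zeta>" by (simp add: in_form_def)
    then obtain As ss Zs where F: "\<And>j. j < t \<Longrightarrow> in_form {} a r ones (H j) (As j) (ss j) (Zs j)"
      by (rule all_in_form[OF rp one H, rotated]) blast+
    have Z: "\<And>j i. j < t \<Longrightarrow> 0 \<le> Zs j $ i" "\<And>j i. j < t \<Longrightarrow> Zs j $ i \<le> 2"
      and ss: "\<And>j. j < t \<Longrightarrow> ss j \<in> {1, - 1}"
      using F by (simp_all add: in_form_def)
    have pg: "part a r t H L = framed_part {} a r ones t As ss Zs L"
      by (rule part_eq_framed_part) (rule F)
    let ?u = "coord {} a r ones"
    have u: "?u x $ i = (x $ i - a $ i) / r" for x i by (simp add: coord_component)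
    define V where "V A \<zeta> = ?u -` strip A \<zeta> \<eta>" for A \<zeta>
    have V: "V A \<zeta> \<in> lmeasurable" for A \<zeta>
      unfolding V_def by (intro measure_coord_vimage strip_lmeasurable rp one)
    have mV: "measure lebesgue (V A \<zeta>) \<le> real R ^ CARD('n) * C * \<eta>" if "\<And>i. 0 \<le> \<zeta> $ i" for A \<zeta>
    proof -
      have "measure lebesgue (V A \<zeta>) = (\<Prod>i\<in>(UNIV :: 'n set). r / ones $ i) * measure lebesgue (strip A \<zeta> \<eta>)"
        unfolding V_def by (intro measure_coord_vimage strip_lmeasurable rp one)
      also have "\<dots> \<le> real R ^ CARD('n) * (C * \<eta>)"
      proof (rule mult_mono)
        show "(\<Prod>i\<in>(UNIV::'n set). r / ones $ i) \<le> real R ^ CARD('n)"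
          using r rp by (simp add: power_mono)
      qed (use C(2)[OF \<eta>(1) that] in auto)
      finally show ?thesis by simp
    qed
    define W where "W = (\<Union>j<t. V (As j) (Zs j)) \<union> (\<Union>i\<in>UNIV. V {} (axis i 1) \<union> V {i} (axis i 1))"
    have W1: "(\<Union>j<t. V (As j) (Zs j)) \<in> lmeasurable" "(\<Union>i\<in>UNIV. V {} (axis i 1) \<union> V {i} (axis i 1)) \<in> lmeasurable"
      using V by (auto intro!: fmeasurable.finite_UN fmeasurable.Un)
    have "measure lebesgue W \<le> measure lebesgue (\<Union>j<t. V (As j) (Zs j))
        + measure lebesgue (\<Union>i\<in>UNIV. V {} (axis i 1) \<union> V {i} (axis i 1))"
      unfolding W_def using W1 by (intro measure_Un_le) auto
    also have "\<dots> \<le> (\<Sum>j<t. measure lebesgue (V (As j) (Zs j)))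
        + (\<Sum>i\<in>UNIV. measure lebesgue (V {} (axis i 1) \<union> V {i} (axis i 1)))"
      using V by (intro add_mono measure_UNION_le) (auto intro!: fmeasurableD fmeasurable.Un)
    also have "\<dots> \<le> (\<Sum>j<t. real R ^ CARD('n) * C * \<eta>)
        + (\<Sum>i\<in>(UNIV::'n set). real R ^ CARD('n) * C * \<eta> + real R ^ CARD('n) * C * \<eta>)"
    proof (intro add_mono sum_mono)
      fix i :: 'n
      have ax: "0 \<le> (axis i 1 :: real ^ 'n) $ l" for l by (simp add: axis_def)
      have "measure lebesgue (V {} (axis i 1) \<union> V {i} (axis i 1))
          \<le> measure lebesgue (V {} (axis i 1)) + measure lebesgue (V {i} (axis i 1))"
        using V by (intro measure_Un_le) auto
      then show "measure lebesgue (V {} (axis i 1) \<union> V {i} (axis i 1))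
          \<le> real R ^ CARD('n) * C * \<eta> + real R ^ CARD('n) * C * \<eta>"
        using mV[OF ax, of "{}"] mV[OF ax, of "{i}"] by linarith
    next
      fix j assume "j \<in> {..<t}"
      then show "measure lebesgue (V (As j) (Zs j)) \<le> real R ^ CARD('n) * C * \<eta>"
        using mV[OF Z(1)] by simp
    qed
    also have "\<dots> = M * \<eta>" by (simp add: M_def d_def algebra_simps)
    finally have "measure lebesgue W < v\<^sub>0" using \<eta>(2) by linarith
    moreover have "measure lebesgue (part a r t H L) \<le> measure lebesgue W" if "part a r t H L \<subseteq> W"
      using that W1 pg
      by (intro measure_mono_fmeasurable) (auto simp: W_def intro!: fmeasurable.Un fmeasurableD)
    ultimately obtain x where x: "x \<in> part a r t H L" "x \<notin> W"
      using large by (meson not_le order_trans subsetI)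
    have xN: "x \<in> ncube a r" using x(1) by (simp add: part_def)
    have ux: "0 \<le> ?u x $ i" "?u x $ i \<le> 1" for i using xN by (simp_all add: mem_ncube[OF rp] u)
    have ubig: "?u x \<in> big_cube 10" unfolding mem_big_cube
    proof
      show "\<bar>?u x $ i\<bar> \<le> 10" for i using ux[of i] by linarith
    qed
    have face: "\<eta> < ?u x $ i" "?u x $ i < 1 - \<eta>" for i
    proof -
      have "?u x \<notin> strip {} (axis i 1) \<eta>" "?u x \<notin> strip {i} (axis i 1) \<eta>"
        using x(2) by (auto simp: W_def V_def)
      then show "\<eta> < ?u x $ i" "?u x $ i < 1 - \<eta>"
        using ubig ux[of i] by (auto simp: strip_def inner_axis' reflect_def)
    qed
    have cut: "\<eta> < \<bar>side (As j) (ss j) (Zs j) (?u x)\<bar>" if j: "j < t" for j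
    proof -
      have "?u x \<notin> strip (As j) (Zs j) \<eta>" using x(2) j by (auto simp: W_def V_def)
      then show ?thesis using ubig ss[OF j] by (auto simp: strip_def side_def)
    qed
    have "x' \<in> part a r t H L" if x': "\<forall>i. \<bar>x' $ i - x $ i\<bar> \<le> \<rho>" for x'
    proof -
      have uu: "\<bar>?u x $ i - ?u x' $ i\<bar> \<le> \<eta> / (4 * d)" for i
      proof -
        have "?u x $ i - ?u x' $ i = (x $ i - x' $ i) * (1 / r)" by (simp add: u diff_divide_distrib)
        also have "\<bar>\<dots>\<bar> = \<bar>x' $ i - x $ i\<bar> * (1 / r)" using rp by (simp add: abs_mult abs_minus_commute)
        also have "\<dots> \<le> \<rho> * R"
        proof (rule mult_mono)
          show "1 / r \<le> real R" using r(1) rp R1 by (simp add: field_simps)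
        qed (use x' rp \<rho> in auto)
        also have "\<dots> = \<eta> / (4 * d)" using R1 by (simp add: \<rho>_def)
        finally show ?thesis .
      qed
      have small: "\<eta> / (4 * d) < \<eta>" using \<eta> d by (simp add: divide_less_eq)
      have "x' \<in> ncube a r" unfolding mem_ncube[OF rp] u[symmetric]
      proof
        show "0 \<le> ?u x' $ i \<and> ?u x' $ i \<le> 1" for i using uu[of i] small face[of i] by linarith
      qed
      moreover have "pattern t As ss Zs (?u x') = pattern t As ss Zs (?u x)"
      proof -
        have "(0 < side (As j) (ss j) (Zs j) (?u x')) = (0 < side (As j) (ss j) (Zs j) (?u x))" if j: "j < t" for j
        proof -
          have "\<bar>side (As j) (ss j) (Zs j) (?u x) - side (As j) (ss j) (Zs j) (?u x')\<bar>
              \<le> \<bar>ss j\<bar> * (\<Sum>i\<in>UNIV. \<bar>Zs j $ i\<bar> * \<bar>?u x $ i - ?u x' $ i\<bar>)"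
            using abs_side_diff_le[of "As j" "ss j" "Zs j" "?u x" "Zs j" "?u x'"] by simp
          also have "\<bar>ss j\<bar> = 1" using ss[OF j] by auto
          also have "1 * (\<Sum>i\<in>UNIV. \<bar>Zs j $ i\<bar> * \<bar>?u x $ i - ?u x' $ i\<bar>) \<le> 1 * (\<Sum>i\<in>(UNIV::'n set). 2 * (\<eta> / (4 * d)))"
          proof (intro mult_left_mono sum_mono mult_mono uu)
            show "\<bar>Zs j $ i\<bar> \<le> 2" for i using Z[OF j, of i] by simp
          qed (use \<eta> d in auto)
          also have "\<dots> = \<eta> / 2" using d by (simp add: d_def)
          finally show ?thesis using cut[OF j] \<eta>(1) by linarith
        qed
        then show ?thesis by (auto simp: pattern_def)
      qed
      ultimately show ?thesis
        using x(1) unfolding pg framed_part_def by simp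
    qed
    then show ?thesis by blast
  qed
  then show ?thesis using \<rho> by (intro exI[of _ \<rho>]) simp
qed

text \<open>Within the set \<open>Q g\<close> the first \<open>k - 1\<close> colors can be prescribed arbitrarily; the last color fills
  the rest.\<close>

lemma recolor_exists:
  assumes f: "f \<in> colorings k" and k: "k \<ge> 1" and fin: "finite G"
    and Q: "\<And>g. g \<in> G \<Longrightarrow> Q g \<in> sets lebesgue"
    and dQ: "\<And>g h. g \<in> G \<Longrightarrow> h \<in> G \<Longrightarrow> g \<noteq> h \<Longrightarrow> Q g \<inter> Q h = {}"
    and T: "\<And>g i. g \<in> G \<Longrightarrow> i \<in> {1..<k} \<Longrightarrow> T g i \<in> sets lebesgue"
      "\<And>g i. g \<in> G \<Longrightarrow> i \<in> {1..<k} \<Longrightarrow> T g i \<subseteq> Q g"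
    and dT: "\<And>g i j. g \<in> G \<Longrightarrow> i \<in> {1..<k} \<Longrightarrow> j \<in> {1..<k} \<Longrightarrow> i \<noteq> j \<Longrightarrow> T g i \<inter> T g j = {}"
  shows "\<exists>f'\<in>colorings k. (\<forall>x. x \<notin> (\<Union>g\<in>G. Q g) \<longrightarrow> f' x = f x) \<and>
     (\<forall>g\<in>G. \<forall>i\<in>{1..<k}. Q g \<inter> f' -` {i} = T g i)"
proof -
  define X where "X = (\<Union>g\<in>G. Q g)"
  define Y where "Y i = (\<Union>g\<in>G. T g i)" for i
  define f' where "f' x = (if x \<in> X then (if \<exists>i\<in>{1..<k}. x \<in> Y i then SOME i. i \<in> {1..<k} \<and> x \<in> Y i else k) else f x)" for x
  have uniq: "i = j" if ij: "i \<in> {1..<k}" "j \<in> {1..<k}" "x \<in> Y i" "x \<in> Y j" for i j x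
  proof -
    obtain g h where g: "g \<in> G" "x \<in> T g i" and h: "h \<in> G" "x \<in> T h j" using ij(3,4) by (auto simp: Y_def)
    have "x \<in> Q g" "x \<in> Q h" using T(2)[OF g(1) ij(1)] T(2)[OF h(1) ij(2)] g h by auto
    then have "g = h" using dQ[OF g(1) h(1)] by blast
    then show ?thesis using dT[OF g(1) ij(1,2)] g(2) h(2) by blast
  qed
  have YX: "Y i \<subseteq> X" if "i \<in> {1..<k}" for i
    unfolding X_def Y_def using T(2)[OF _ that] by blast
  have fY: "f' x = i" if "i \<in> {1..<k}" "x \<in> Y i" for i x
  proof -
    have "(SOME i. i \<in> {1..<k} \<and> x \<in> Y i) = i"
      using that uniq by (intro some_equality) blast+
    then show ?thesis using that YX by (auto simp: f'_def)
  qed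
  have fX: "f' x = k" if "x \<in> X" "\<And>i. i \<in> {1..<k} \<Longrightarrow> x \<notin> Y i" for x
    using that by (auto simp: f'_def)
  have fn: "f' x = f x" if "x \<notin> X" for x using that by (simp add: f'_def)
  have Xm: "X \<in> sets lebesgue" unfolding X_def using fin Q by (intro sets.finite_UN) auto
  have Ym: "Y i \<in> sets lebesgue" if "i \<in> {1..<k}" for i
    unfolding Y_def using fin T(1) that by (intro sets.finite_UN) auto
  have small: "f' -` {i} = (f -` {i} - X) \<union> Y i" if i: "i \<in> {1..<k}" for i
  proof (intro equalityI subsetI)
    fix x assume x: "x \<in> f' -` {i}"
    show "x \<in> (f -` {i} - X) \<union> Y i"
    proof (cases "x \<in> X")
      case True
      then obtain j where j: "j \<in> {1..<k}" "x \<in> Y j" using fX[of x] x i by fastforce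
      then show ?thesis using fY[OF j] x by auto
    next
      case False
      then show ?thesis using fn x by auto
    qed
  next
    fix x assume "x \<in> (f -` {i} - X) \<union> Y i"
    then show "x \<in> f' -` {i}" using fn fY[OF i] by auto
  qed
  have range: "f' x \<in> {1..k}" for x
  proof (cases "x \<in> X")
    case True
    then show ?thesis using fX[of x] fY k by (cases "\<exists>i\<in>{1..<k}. x \<in> Y i") auto
  next
    case False
    then show ?thesis using fn[OF False] f unfolding colorings_def by (metis (no_types, lifting) mem_Collect_eq range_subsetD)
  qed
  have big: "f' -` {k} = - (\<Union>i\<in>{1..<k}. f' -` {i})"
  proof (intro equalityI subsetI)
    fix x assume "x \<in> - (\<Union>i\<in>{1..<k}. f' -` {i})"
    then have "f' x \<notin> {1..<k}" by auto
    then show "x \<in> f' -` {k}" using range[of x] by auto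
  qed auto
  have fm: "f -` {i} \<in> sets lebesgue" for i by (rule coloring_measurable_vimage[OF f])
  have sm: "f' -` {i} \<in> sets lebesgue" if "i \<in> {1..<k}" for i
    unfolding small[OF that] using fm Xm Ym[OF that] by (intro sets.Un sets.Diff)
  have "(\<Union>i\<in>{1..<k}. f' -` {i}) \<in> sets lebesgue" using sm by (intro sets.finite_UN) auto
  then have "f' -` {k} \<in> sets lebesgue" unfolding big
    using sets.compl_sets[of "\<Union>i\<in>{1..<k}. f' -` {i}" lebesgue] by (simp add: Compl_eq_Diff_UNIV)
  then have "f' -` {i} \<in> sets lebesgue" if "i \<in> {1..k}" for i
    using that sm by (cases "i = k") auto
  then have "f' \<in> colorings k" using range by (auto simp: colorings_def)
  moreover have "\<forall>x. x \<notin> (\<Union>g\<in>G. Q g) \<longrightarrow> f' x = f x" using fn unfolding X_def by blast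
  moreover have "Q g \<inter> f' -` {i} = T g i" if g: "g \<in> G" and i: "i \<in> {1..<k}" for g i
  proof -
    have "Q g \<subseteq> X" using g by (auto simp: X_def)
    moreover have "Q g \<inter> Y i = T g i"
      using T(2)[OF _ i] dQ[OF g] g unfolding Y_def by blast
    ultimately show ?thesis unfolding small[OF i] by blast
  qed
  ultimately show ?thesis by blast
qed

text \<open>Let each function \<open>u\<close> determine some discrete data, namely an element \<open>rep u\<close> and places \<open>pl u l\<close>. If
  the data and the values of \<open>u\<close> off the \<open>(q - 1) |I|\<close> arguments that belong to the places
  \<open>pl u 2, \<dots>, pl u q\<close> leave an uncertainty of at most \<open>C\<close> for each remaining value, then \<open>u\<close> is
  determined by these and by the residues of the remaining values modulo \<open>C + 1\<close>.\<close>

lemma count_functions_le: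
  fixes q :: nat and rep :: "('g \<times> 'i \<Rightarrow> nat) \<Rightarrow> 'r" and pl :: "('g \<times> 'i \<Rightarrow> nat) \<Rightarrow> nat \<Rightarrow> 'g"
  defines "J \<equiv> \<lambda>p. \<lambda>I. (\<lambda>(l, i). (p l, i)) ` ({2..q} \<times> I)"
  assumes fin: "finite \<R>" "finite G" "finite I"
    and U: "U = (G \<times> I) \<rightarrow>\<^sub>E {..<K}"
    and rep: "\<And>u. u \<in> U \<Longrightarrow> rep u \<in> \<R>" and pl: "\<And>u. u \<in> U \<Longrightarrow> pl u \<in> {1..q} \<rightarrow>\<^sub>E G"
    and inj: "\<And>u. u \<in> U \<Longrightarrow> inj_on (pl u) {2..q}"
    and close: "\<And>u u' p. u \<in> U \<Longrightarrow> u' \<in> U \<Longrightarrow> rep u = rep u' \<Longrightarrow> pl u = pl u' \<Longrightarrow>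
       (\<And>p. p \<in> G \<times> I \<Longrightarrow> p \<notin> J (pl u) I \<Longrightarrow> u p = u' p) \<Longrightarrow> p \<in> J (pl u) I \<Longrightarrow>
       \<bar>int (u p) - int (u' p)\<bar> \<le> int C"
    and K: "K \<ge> 1"
  shows "K ^ ((q - 1) * card I) \<le> card \<R> * card G ^ q * (C + 1) ^ ((q - 1) * card I)"
proof -
  define D where "D = (q - 1) * card I"
  define P where "P = G \<times> I"
  define PL where "PL = {p \<in> {1..q} \<rightarrow>\<^sub>E G. inj_on p {2..q}}"
  define W where "W p = (\<Pi>\<^sub>E x\<in>P. if x \<in> J p I then {..C} else {..<K})" for p
  define \<Phi> where "\<Phi> u = (rep u, pl u, \<lambda>x\<in>P. if x \<in> J (pl u) I then u x mod (C + 1) else u x)" for u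
  have finP: "finite P" using fin by (simp add: P_def)
  have finPL: "finite PL" unfolding PL_def using fin by (intro finite_subset[OF _ finite_PiE[of "{1..q}" "\<lambda>_. G"]]) auto
  have JP: "J p I \<subseteq> P" "card (J p I) = D" if p: "p \<in> PL" for p
  proof -
    have "p l \<in> G" if "l \<in> {2..q}" for l
      using p that by (intro PiE_mem[of p "{1..q}" "\<lambda>_. G"]) (auto simp: PL_def)
    then show "J p I \<subseteq> P" by (auto simp: J_def P_def)
    have "inj_on (\<lambda>(l, i). (p l, i)) ({2..q} \<times> I)"
      using p by (auto simp: PL_def inj_on_def)
    then have "card (J p I) = card ({2..q} \<times> I)" unfolding J_def by (rule card_image)
    then show "card (J p I) = D" by (simp add: D_def card_cartesian_product)
  qed
  have cW: "card (W p) = (C + 1) ^ D * K ^ (card P - D)" if p: "p \<in> PL" for p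
  proof -
    have "card (W p) = (\<Prod>x\<in>P. card (if x \<in> J p I then {..C} else {..<K}))"
      unfolding W_def by (rule card_PiE[OF finP])
    also have "\<dots> = (\<Prod>x\<in>P. if x \<in> J p I then C + 1 else K)" by (intro prod.cong) auto
    also have "\<dots> = (\<Prod>x\<in>P \<inter> {x. x \<in> J p I}. C + 1) * (\<Prod>x\<in>P \<inter> - {x. x \<in> J p I}. K)"
      by (rule prod.If_cases[OF finP])
    also have "P \<inter> {x. x \<in> J p I} = J p I" using JP[OF p] by auto
    also have "P \<inter> - {x. x \<in> J p I} = P - J p I" by auto
    finally show ?thesis using JP[OF p] finP by (simp add: card_Diff_subset finite_subset)
  qed
  have UP: "U = P \<rightarrow>\<^sub>E {..<K}" by (simp add: U P_def)
  have "inj_on \<Phi> U"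
  proof (rule inj_onI)
    fix u u' assume u: "u \<in> U" "u' \<in> U" and eq: "\<Phi> u = \<Phi> u'"
    have r: "rep u = rep u'" "pl u = pl u'" using eq by (simp_all add: \<Phi>_def)
    have val: "(if x \<in> J (pl u) I then u x mod (C + 1) else u x) = (if x \<in> J (pl u) I then u' x mod (C + 1) else u' x)"
      if "x \<in> P" for x
    proof -
      have "(\<lambda>x\<in>P. if x \<in> J (pl u) I then u x mod (C + 1) else u x)
          = (\<lambda>x\<in>P. if x \<in> J (pl u) I then u' x mod (C + 1) else u' x)"
        using eq r(2) by (simp add: \<Phi>_def)
      from fun_cong[OF this, of x] show ?thesis using that by simp
    qed
    have off: "u x = u' x" if "x \<in> G \<times> I" "x \<notin> J (pl u) I" for x
      using val[of x] that by (simp add: P_def)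
    have on: "u x = u' x" if x: "x \<in> P" "x \<in> J (pl u) I" for x
    proof -
      have "\<bar>int (u x) - int (u' x)\<bar> \<le> int C" by (rule close[OF u r off x(2)])
      moreover have "u x mod (C + 1) = u' x mod (C + 1)" using val[OF x(1)] x(2) by simp
      then have "int (u x) mod int (C + 1) = int (u' x) mod int (C + 1)"
        by (simp only: of_nat_mod[symmetric])
      then have "int (C + 1) dvd int (u x) - int (u' x)" by (simp only: mod_eq_dvd_iff)
      ultimately have "int (u x) - int (u' x) = 0"
        using dvd_imp_le_int[of "int (u x) - int (u' x)" "int (C + 1)"] by auto
      then show ?thesis by simp
    qed
    show "u = u'"
    proof (rule PiE_ext[of u P "\<lambda>_. {..<K}" u'])
      show "u \<in> P \<rightarrow>\<^sub>E {..<K}" "u' \<in> P \<rightarrow>\<^sub>E {..<K}" using u by (simp_all only: UP)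
      show "u x = u' x" if "x \<in> P" for x
        using that on off unfolding P_def by (cases "x \<in> J (pl u) I") simp_all
    qed
  qed
  moreover have "\<Phi> ` U \<subseteq> \<R> \<times> (SIGMA p:PL. W p)"
  proof
    fix y assume "y \<in> \<Phi> ` U"
    then obtain u where u: "u \<in> U" "y = \<Phi> u" by blast
    have "pl u \<in> PL" using pl[OF u(1)] inj[OF u(1)] by (simp add: PL_def)
    moreover have "(\<lambda>x\<in>P. if x \<in> J (pl u) I then u x mod (C + 1) else u x) \<in> W (pl u)"
    proof -
      have uK: "u x \<in> {..<K}" if "x \<in> P" for x using u(1) that by (auto simp: UP)
      have "u x mod (C + 1) \<in> {..C}" for x using mod_less_divisor[of "C + 1" "u x"] by simp
      then show ?thesis unfolding W_def using uK by (intro restrict_PiE_iff[THEN iffD2] ballI) simp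
    qed
    ultimately show "y \<in> \<R> \<times> (SIGMA p:PL. W p)"
      using rep[OF u(1)] by (simp add: u(2) \<Phi>_def)
  qed
  moreover have finW: "finite (W p)" for p unfolding W_def using finP by (intro finite_PiE) auto
  ultimately have "card U \<le> card (\<R> \<times> (SIGMA p:PL. W p))"
    using fin finPL by (intro card_inj_on_le[of \<Phi>]) auto
  also have "\<dots> = card \<R> * (\<Sum>p\<in>PL. card (W p))"
    using finPL finW by (simp add: card_cartesian_product card_SigmaI)
  also have "\<dots> = card \<R> * (card PL * ((C + 1) ^ D * K ^ (card P - D)))"
    using cW by simp
  also have "\<dots> \<le> card \<R> * (card G ^ q * ((C + 1) ^ D * K ^ (card P - D)))"
  proof -
    have "card PL \<le> card ({1..q} \<rightarrow>\<^sub>E G)" unfolding PL_def using fin by (intro card_mono finite_PiE) auto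
    then show ?thesis by (intro mult_le_mono) (simp_all add: card_PiE)
  qed
  finally have le: "K ^ card P \<le> card \<R> * (card G ^ q * ((C + 1) ^ D * K ^ (card P - D)))"
    using finP by (simp add: UP card_PiE)
  show ?thesis
  proof (cases "D \<le> card P")
    case True
    then have "K ^ card P = K ^ D * K ^ (card P - D)" by (simp add: power_add[symmetric])
    then have "K ^ D * K ^ (card P - D) \<le> (card \<R> * card G ^ q * (C + 1) ^ D) * K ^ (card P - D)"
      using le by (simp add: mult.assoc)
    then show ?thesis using K by (simp add: D_def)
  next
    case False
    have "PL = {}"
    proof (rule ccontr)
      assume "PL \<noteq> {}"
      then obtain p where "p \<in> PL" by blast
      then show False using JP[of p] card_mono[OF finP, of "J p I"] False by simp
    qed
    then have "U = {}" using pl inj by (auto simp: PL_def)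
    then have "card U = 0" by simp
    then show ?thesis using K finP by (simp add: UP card_PiE)
  qed
qed

section \<open>Adjustable cells\<close>

lemma measure_box_cart:
  fixes a b :: "real ^ 'n"
  assumes "\<And>i. a $ i \<le> b $ i"
  shows "measure lebesgue (box a b) = (\<Prod>i\<in>UNIV. b $ i - a $ i)"
proof -
  have "measure lebesgue (box a b) = measure lborel (box a b)"
    by (simp add: measure_completion)
  also have "\<dots> = measure lborel (cbox a b)"
    by (simp add: measure_lborel_box_eq measure_lborel_cbox_eq)
  also have "\<dots> = (\<Prod>i\<in>UNIV. b $ i - a $ i)"
    using assms by (subst content_cbox_cart) (auto simp: interval_ne_empty_cart)
  finally show ?thesis .
qed

definition cell :: "real \<Rightarrow> real \<Rightarrow> ('n \<Rightarrow> int) \<Rightarrow> (real ^ 'n) set" where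
  "cell \<rho> s g = box (\<chi> i. \<rho> * g i) (\<chi> i. \<rho> * g i + s)"

text \<open>In the cell \<open>g\<close>, one of the edges is divided into \<open>k\<close> equal intervals; color \<open>i\<close> occupies the share
  \<open>u / K\<close> of the \<open>i\<close>-th layer.\<close>

definition slot :: "real \<Rightarrow> real \<Rightarrow> nat \<Rightarrow> nat \<Rightarrow> 'n \<Rightarrow> ('n \<Rightarrow> int) \<Rightarrow> nat \<Rightarrow> nat \<Rightarrow> (real ^ 'n) set" where
  "slot \<rho> s k K i\<^sub>0 g i u = box (\<chi> j. \<rho> * of_int (g j) + (if j = i\<^sub>0 then s * real (i - 1) / k else 0))
     (\<chi> j. \<rho> * of_int (g j) + (if j = i\<^sub>0 then s * real (i - 1) / k + s * real u / (real k * real K) else s))"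

lemma cell_disjoint:
  assumes "0 < s" "s \<le> \<rho>" "g \<noteq> h"
  shows "cell \<rho> s g \<inter> cell \<rho> s h = {}"
proof (rule ccontr)
  assume "cell \<rho> s g \<inter> cell \<rho> s h \<noteq> {}"
  then obtain x where x: "x \<in> cell \<rho> s g" "x \<in> cell \<rho> s h" by blast
  obtain i where i: "g i \<noteq> h i" using assms(3) by auto
  have *: "real_of_int m < real_of_int n + 1" if "\<rho> * m < y" "y < \<rho> * n + s" for m n y
  proof -
    have "\<rho> * m < \<rho> * (real_of_int n + 1)" using that assms by (simp add: distrib_left)
    then show ?thesis using assms by simp
  qed
  have "\<rho> * g i < x $ i" "x $ i < \<rho> * g i + s" "\<rho> * h i < x $ i" "x $ i < \<rho> * h i + s"
    using x by (simp_all add: cell_def mem_box_cart)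
  then have "real_of_int (g i) < real_of_int (h i) + 1" "real_of_int (h i) < real_of_int (g i) + 1"
    using * by blast+
  then show False using i by linarith
qed

lemma measure_cell: "0 < s \<Longrightarrow> measure lebesgue (cell \<rho> s g :: (real ^ 'n) set) = s ^ CARD('n)"
  unfolding cell_def by (subst measure_box_cart) simp_all

lemma cell_lmeasurable [simp]: "cell \<rho> s g \<in> lmeasurable" "slot \<rho> s k K i\<^sub>0 g i u \<in> lmeasurable"
  by (simp_all add: cell_def slot_def)

lemma slot_bounds:
  fixes s :: real
  assumes "0 < s" "1 \<le> k" "1 \<le> i" "u \<le> K" "1 \<le> K"
  shows "0 \<le> s * real u / (real k * real K)" "s * real (i - 1) / k + s * real u / (real k * real K) \<le> s * real i / k"
proof -
  show "0 \<le> s * real u / (real k * real K)" using assms by simp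
  have "s * real u / (real k * real K) = s / k * (u / K)" by simp
  also have "\<dots> \<le> s / k * 1" using assms by (intro mult_left_mono) simp_all
  finally have "s * real u / (real k * real K) \<le> s / k" by simp
  moreover have "s * real (i - 1) / k + s / k = s * real i / k"
    using assms by (simp add: of_nat_diff diff_divide_distrib right_diff_distrib)
  ultimately show "s * real (i - 1) / k + s * real u / (real k * real K) \<le> s * real i / k" by linarith
qed

lemma slot_subset:
  assumes "0 < s" "1 \<le> k" "1 \<le> i" "i \<le> k" "u \<le> K" "1 \<le> K"
  shows "slot \<rho> s k K i\<^sub>0 g i u \<subseteq> cell \<rho> s g"
proof
  fix x assume x: "x \<in> slot \<rho> s k K i\<^sub>0 g i u"
  have "s * real i / k \<le> s" using assms by (simp add: pos_divide_le_eq)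
  then have up: "s * real (i - 1) / k + s * real u / (real k * real K) \<le> s"
    using slot_bounds(2)[OF assms(1,2,3,5,6)] by linarith
  have lo: "0 \<le> s * real (i - 1) / k" using assms by simp
  have "\<rho> * g j < x $ j \<and> x $ j < \<rho> * g j + s" for j
  proof (cases "j = i\<^sub>0")
    case True
    then show ?thesis using x up lo by (auto simp: slot_def mem_box_cart dest!: spec[of _ i\<^sub>0])
  next
    case False
    then show ?thesis using x by (auto simp: slot_def mem_box_cart dest!: spec[of _ j])
  qed
  then show "x \<in> cell \<rho> s g" by (simp add: cell_def mem_box_cart)
qed

lemma slot_disjoint:
  assumes "0 < s" "1 \<le> k" "1 \<le> i" "1 \<le> j" "i \<noteq> j" "u \<le> K" "v \<le> K" "1 \<le> K"
  shows "slot \<rho> s k K i\<^sub>0 g i u \<inter> slot \<rho> s k K i\<^sub>0 g j v = {}"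
proof -
  have *: "slot \<rho> s k K i\<^sub>0 g i u \<inter> slot \<rho> s k K i\<^sub>0 g j v = {}" if ij: "1 \<le> i" "i < j" "u \<le> K" for i j u v
  proof (rule ccontr)
    assume "\<not> ?thesis"
    then obtain x where x: "x \<in> slot \<rho> s k K i\<^sub>0 g i u" "x \<in> slot \<rho> s k K i\<^sub>0 g j v" by blast
    have "x $ i\<^sub>0 < \<rho> * g i\<^sub>0 + (s * real (i - 1) / k + s * real u / (real k * real K))" "\<rho> * g i\<^sub>0 + s * real (j - 1) / k < x $ i\<^sub>0"
      using x by (auto simp: slot_def mem_box_cart dest!: spec[of _ i\<^sub>0])
    moreover have "s * real i / k \<le> s * real (j - 1) / k"
      using ij assms by (intro divide_right_mono mult_left_mono) (auto simp: of_nat_diff)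
    ultimately show False using slot_bounds(2)[OF assms(1,2) ij(1,3) assms(8)] by linarith
  qed
  show ?thesis
  proof (cases "i < j")
    case True
    then show ?thesis using * assms by simp
  next
    case False
    then show ?thesis using *[of j i v u] assms by (simp add: Int_commute)
  qed
qed

lemma measure_slot:
  fixes i\<^sub>0 :: "'n::finite"
  assumes "0 < s" "1 \<le> k" "1 \<le> i" "u \<le> K" "1 \<le> K"
  shows "measure lebesgue (slot \<rho> s k K i\<^sub>0 g i u) = s ^ CARD('n) / k * (u / K)"
proof -
  have "measure lebesgue (slot \<rho> s k K i\<^sub>0 g i u) = (\<Prod>j\<in>(UNIV :: 'n set). if j = i\<^sub>0 then s * real u / (real k * real K) else s)"
    unfolding slot_def using assms slot_bounds(1)[OF assms]
    by (subst measure_box_cart) (auto intro!: prod.cong)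
  also have "\<dots> = s * real u / (real k * real K) * (\<Prod>j\<in>UNIV - {i\<^sub>0}. if j = i\<^sub>0 then s * real u / (real k * real K) else s)"
    by (subst prod.remove[of UNIV i\<^sub>0]) auto
  also have "(\<Prod>j\<in>UNIV - {i\<^sub>0}. if j = i\<^sub>0 then s * real u / (real k * real K) else s) = (\<Prod>j\<in>UNIV - {i\<^sub>0}. s)"
    by (intro prod.cong) auto
  also have "\<dots> = s ^ (CARD('n) - 1)" by (simp add: card_Diff_subset)
  also have "s * real u / (real k * real K) * s ^ (CARD('n) - 1) = (s * s ^ (CARD('n) - 1)) / k * (u / K)" by simp
  also have "s * s ^ (CARD('n) - 1) = s ^ CARD('n)" using zero_less_card_finite[where 'a='n]
    by (cases "CARD('n)") simp_all
  finally show ?thesis .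
qed

text \<open>No necklace of a bounded range has a splitting that is fair up to the error \<open>\<eta>\<close>. Unlike the
  absence of fair splittings, this is stable under small changes of the coloring.\<close>

definition robust :: "nat \<Rightarrow> nat \<Rightarrow> nat \<Rightarrow> nat \<Rightarrow> (real ^ 'n \<Rightarrow> nat) \<Rightarrow> real \<Rightarrow> bool" where
  "robust k q t R f \<eta> \<longleftrightarrow> (\<forall>a r H lam. bounded_arrangement R t a r H \<longrightarrow> lam \<in> Pow {..<t} \<rightarrow>\<^sub>E {1..q} \<longrightarrow>
     \<not> (\<forall>l\<in>{1..q}. \<forall>i\<in>{1..k}. \<bar>measure lebesgue (part a r t H (\<lambda>X. lam X = l) \<inter> f -` {i})
            - measure lebesgue (ncube a r \<inter> f -` {i}) / q\<bar> \<le> \<eta>))"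

lemma measure_sum_colors:
  assumes f: "f \<in> colorings k" and S: "S \<in> lmeasurable"
  shows "measure lebesgue S = (\<Sum>i\<in>{1..k}. measure lebesgue (S \<inter> f -` {i}))"
proof -
  have "S = (\<Union>i\<in>{1..k}. S \<inter> f -` {i})" using f by (auto simp: colorings_def)
  moreover have "measure lebesgue (\<Union>i\<in>{1..k}. S \<inter> f -` {i}) = (\<Sum>i\<in>{1..k}. measure lebesgue (S \<inter> f -` {i}))"
  proof (rule measure_finite_Union)
    show "disjoint_family_on (\<lambda>i. S \<inter> f -` {i}) {1..k}" by (auto simp: disjoint_family_on_def)
    have m: "S \<inter> f -` {i} \<in> lmeasurable" for i
      by (rule fmeasurable_Int_fmeasurable[OF S coloring_measurable_vimage[OF f]])
    show "(\<lambda>i. S \<inter> f -` {i}) ` {1..k} \<subseteq> sets lebesgue" using m by auto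
    show "emeasure lebesgue (S \<inter> f -` {i}) \<noteq> \<infinity>" for i using fmeasurableD2[OF m] by simp
  qed simp
  ultimately show ?thesis by simp
qed

lemma part_lmeasurable [simp]:
  fixes a :: "real ^ 'n"
  shows "part a r t H L \<in> lmeasurable"
proof -
  have eq: "{x. L (upper_pattern t H x)} = (\<Union>X\<in>{X\<in>Pow {..<t}. L X}. {x. \<forall>j\<in>{..<t}. (snd (H j) < fst (H j) \<bullet> x) = (j \<in> X)})"
    (is "?l = ?r")
  proof (intro equalityI subsetI)
    fix x assume "x \<in> ?l"
    then show "x \<in> ?r" by (intro UN_I[of "upper_pattern t H x"]) (auto simp: upper_pattern_def)
  next
    fix x assume "x \<in> ?r"
    then obtain X where X: "X \<subseteq> {..<t}" "L X" "\<forall>j\<in>{..<t}. (snd (H j) < fst (H j) \<bullet> x) = (j \<in> X)"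
      by auto
    then have "upper_pattern t H x = X" by (auto simp: upper_pattern_def)
    with X show "x \<in> ?l" by simp
  qed
  have "{x. L (upper_pattern t H x)} \<in> sets borel"
    unfolding eq by (intro sets.finite_UN) auto
  then have "ncube a r \<inter> {x. L (upper_pattern t H x)} \<in> lmeasurable"
    by (intro fmeasurable_Int_fmeasurable) auto
  moreover have "part a r t H L = ncube a r \<inter> {x. L (upper_pattern t H x)}" by (auto simp: part_def)
  ultimately show ?thesis by simp
qed

text \<open>Consider two colorings that differ only on sets \<open>Q l\<close>, one for each part but the first, and
  arrangements with almost the same parts for which the colorings are almost fair. Outside of
  \<open>Q l\<close> the amounts of the color \<open>i\<close> in the \<open>l\<close>-th parts are almost the same, and so are its total
  amounts there, as both are almost equal to those in the first parts. Hence the amounts in \<open>Q l\<close>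
  are almost the same.\<close>

lemma parameters_close:
  fixes F F' :: "real ^ 'n \<Rightarrow> nat" and S S' :: "nat \<Rightarrow> (real ^ 'n) set"
  assumes F: "F \<in> colorings k" "F' \<in> colorings k"
    and S: "\<And>l. S l \<in> lmeasurable" "\<And>l. S' l \<in> lmeasurable"
    and disj: "\<And>l l'. l \<noteq> l' \<Longrightarrow> S l \<inter> S l' = {}" "\<And>l l'. l \<noteq> l' \<Longrightarrow> S' l \<inter> S' l' = {}"
    and Q: "\<And>l. l \<in> {1..q} \<Longrightarrow> Q l \<subseteq> S l" "\<And>l. l \<in> {1..q} \<Longrightarrow> Q l \<subseteq> S' l" "\<And>l. l \<in> {1..q} \<Longrightarrow> Q l \<in> lmeasurable"
    and same: "\<And>x. x \<notin> (\<Union>l\<in>{2..q}. Q l) \<Longrightarrow> F x = F' x"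
    and close: "\<And>l. l \<in> {1..q} \<Longrightarrow> measure lebesgue (symdiff (S l) (S' l)) \<le> 2 * \<delta>"
    and fair: "\<And>l. l \<in> {1..q} \<Longrightarrow> \<bar>measure lebesgue (S l \<inter> F -` {i}) - measure lebesgue (S 1 \<inter> F -` {i})\<bar> \<le> 2 * \<delta>"
      "\<And>l. l \<in> {1..q} \<Longrightarrow> \<bar>measure lebesgue (S' l \<inter> F' -` {i}) - measure lebesgue (S' 1 \<inter> F' -` {i})\<bar> \<le> 2 * \<delta>"
    and l: "l \<in> {2..q}"
  shows "\<bar>measure lebesgue (Q l \<inter> F -` {i}) - measure lebesgue (Q l \<inter> F' -` {i})\<bar> \<le> 8 * \<delta>"
proof -
  have Fm: "X \<inter> F -` {i} \<in> lmeasurable" "X \<inter> F' -` {i} \<in> lmeasurable" if "X \<in> lmeasurable" for X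
    using that F by (auto intro: fmeasurable_Int_fmeasurable coloring_measurable_vimage)
  have Fs: "F -` {i} \<in> sets lebesgue" "F' -` {i} \<in> sets lebesgue"
    using F by (auto intro: coloring_measurable_vimage)
  have lq: "l \<in> {1..q}" "1 \<in> {1..q}" using l by auto
  have eq: "F x = F' x" if "x \<in> S l' \<inter> S' l'" "l' \<in> {1..q}" "l' = 1 \<or> x \<notin> Q l'" for x l'
  proof (rule same)
    show "x \<notin> (\<Union>l\<in>{2..q}. Q l)"
    proof
      assume "x \<in> (\<Union>l\<in>{2..q}. Q l)"
      then obtain m where m: "m \<in> {2..q}" "x \<in> Q m" by blast
      then have "x \<in> S m" using Q(1)[of m] by auto
      then have "m = l'" using disj(1)[of m l'] that(1) by blast
      then show False using that(3) m by auto
    qed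
  qed
  have one: "\<bar>measure lebesgue (S 1 \<inter> F -` {i}) - measure lebesgue (S' 1 \<inter> F' -` {i})\<bar> \<le> 2 * \<delta>"
  proof -
    have "\<bar>measure lebesgue (S 1 \<inter> F -` {i}) - measure lebesgue (S' 1 \<inter> F' -` {i})\<bar>
        \<le> measure lebesgue (symdiff (S 1 \<inter> F -` {i}) (S' 1 \<inter> F' -` {i}))"
      using S by (intro measure_diff_le_symdiff Fm)
    also have "\<dots> \<le> measure lebesgue (symdiff (S 1) (S' 1))"
    proof (rule measure_mono_fmeasurable)
      show "symdiff (S 1 \<inter> F -` {i}) (S' 1 \<inter> F' -` {i}) \<subseteq> symdiff (S 1) (S' 1)"
        using eq[of _ 1] lq by (auto simp: symdiff_def)
    qed (use S in \<open>auto intro!: symdiff_lmeasurable fmeasurableD Fm\<close>)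
    also have "\<dots> \<le> 2 * \<delta>" using lq by (intro close)
    finally show ?thesis .
  qed
  have rest: "\<bar>measure lebesgue ((S l - Q l) \<inter> F -` {i}) - measure lebesgue ((S' l - Q l) \<inter> F' -` {i})\<bar> \<le> 2 * \<delta>"
  proof -
    have D: "S l - Q l \<in> lmeasurable" "S' l - Q l \<in> lmeasurable"
      using S Q(3)[OF lq(1)] by (auto intro: fmeasurable.Diff)
    have "\<bar>measure lebesgue ((S l - Q l) \<inter> F -` {i}) - measure lebesgue ((S' l - Q l) \<inter> F' -` {i})\<bar>
        \<le> measure lebesgue (symdiff ((S l - Q l) \<inter> F -` {i}) ((S' l - Q l) \<inter> F' -` {i}))"
      using D by (intro measure_diff_le_symdiff Fm)
    also have "\<dots> \<le> measure lebesgue (symdiff (S l) (S' l))"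
    proof (rule measure_mono_fmeasurable)
      show "symdiff ((S l - Q l) \<inter> F -` {i}) ((S' l - Q l) \<inter> F' -` {i}) \<subseteq> symdiff (S l) (S' l)"
        using eq[of _ l] lq by (auto simp: symdiff_def)
    qed (use S D in \<open>auto intro!: symdiff_lmeasurable fmeasurableD Fm\<close>)
    also have "\<dots> \<le> 2 * \<delta>" using lq by (intro close)
    finally show ?thesis .
  qed
  have split: "measure lebesgue (X \<inter> E) = measure lebesgue ((X - Q l) \<inter> E) + measure lebesgue (Q l \<inter> E)"
    if "X \<in> lmeasurable" "Q l \<subseteq> X" "E \<in> sets lebesgue" for X E
  proof -
    have e: "((X - Q l) \<inter> E) \<union> (Q l \<inter> E) = X \<inter> E" using that(2) by blast
    have "measure lebesgue (((X - Q l) \<inter> E) \<union> (Q l \<inter> E)) = measure lebesgue ((X - Q l) \<inter> E) + measure lebesgue (Q l \<inter> E)"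
    proof -
      have m: "(X - Q l) \<inter> E \<in> lmeasurable" "Q l \<inter> E \<in> lmeasurable"
        using that Q(3)[OF lq(1)] by (auto intro!: fmeasurable_Int_fmeasurable fmeasurable.Diff)
      show ?thesis
      proof -
        have "((X - Q l) \<inter> E) \<inter> (Q l \<inter> E) = {}" by blast
        then show ?thesis using measure_Un3[OF m] by (simp only: measure_empty diff_zero)
      qed
    qed
    then show ?thesis by (simp only: e)
  qed
  have "measure lebesgue (S l \<inter> F -` {i}) = measure lebesgue ((S l - Q l) \<inter> F -` {i}) + measure lebesgue (Q l \<inter> F -` {i})"
    "measure lebesgue (S' l \<inter> F' -` {i}) = measure lebesgue ((S' l - Q l) \<inter> F' -` {i}) + measure lebesgue (Q l \<inter> F' -` {i})"
    by (rule split[OF S(1) Q(1)[OF lq(1)] Fs(1)], rule split[OF S(2) Q(2)[OF lq(1)] Fs(2)])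
  then show ?thesis using one rest fair(1)[OF lq(1)] fair(2)[OF lq(1)] by linarith
qed

section \<open>Colorings without nearly fair splittings of bounded necklaces\<close>

lemma not_robustE:
  assumes "\<not> robust k q t R f \<eta>"
  obtains a r H lam where "bounded_arrangement R t a r H" "lam \<in> Pow {..<t} \<rightarrow>\<^sub>E {1..q}"
    "\<forall>l\<in>{1..q}. \<forall>i\<in>{1..k}. \<bar>measure lebesgue (part a r t H (\<lambda>X. lam X = l) \<inter> f -` {i})
            - measure lebesgue (ncube a r \<inter> f -` {i}) / q\<bar> \<le> \<eta>"
  using assms unfolding robust_def not_all not_imp not_not by (elim exE conjE) (rule that)

text \<open>If all members of the family of recolorings indexed by \<open>U\<close> were bad, then
  \<open>count_functions_le\<close>, applied to the approximate parts and the cells inside the parts, would give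
  \<open>K ^ D \<le> |\<R>| |G| ^ q (C + 1) ^ D\<close>. This contradicts the bound on the size of \<open>\<R>\<close>, because
  \<open>G\<close> and \<open>C\<close> do not depend on \<open>K\<close>.\<close>

lemma exists_robust_perturbation:
  fixes f :: "real ^ 'n \<Rightarrow> nat" and \<epsilon> :: real
  assumes f: "f \<in> colorings k" and k: "k \<ge> 1" and t: "t \<ge> 1" and q: "q \<ge> 2" and R: "R \<ge> 1"
    and many: "k * (q - 1) > CARD('n) * t + CARD('n) + (q - 1)" and \<epsilon>: "\<epsilon> > 0"
  shows "\<exists>g\<in>colorings k. \<exists>\<eta>>0. {x. f x \<noteq> g x} \<in> lmeasurable \<and> measure lebesgue {x. f x \<noteq> g x} \<le> \<epsilon> \<and>
     robust k q t R g \<eta>"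
proof -
  define d where "d = CARD('n)"
  define D where "D = (q - 1) * (k - 1)"
  have mD: "d * t + d + 1 \<le> D"
  proof -
    have "k * (q - 1) = D + (q - 1)" using k by (cases k) (simp_all add: D_def mult.commute)
    then show ?thesis using many by (simp add: d_def)
  qed
  have R1: "real R \<ge> 1" using R by simp
  \<comment> \<open>half of the share of a part of the smallest necklace considered\<close>
  define v\<^sub>0 where "v\<^sub>0 = 1 / (2 * real q * real R ^ d)"
  have v0: "v\<^sub>0 > 0" using q R by (simp add: v\<^sub>0_def)
  obtain \<rho> where \<rho>: "\<rho> > 0" and cubes: "\<And>a r (H :: nat \<Rightarrow> (real ^ 'n) \<times> real) L. bounded_arrangement R t a r H \<Longrightarrow>
     v\<^sub>0 \<le> measure lebesgue (part a r t H L) \<Longrightarrow> (\<exists>x. {x'. \<forall>i. \<bar>x' $ i - x $ i\<bar> \<le> \<rho>} \<subseteq> part a r t H L)"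
    using large_part_contains_cube[OF R t v0, where 'n='n] by blast
  define m where "m = \<lceil>2 * real R / \<rho>\<rceil> + 1"
  define G where "G = (UNIV :: 'n set) \<rightarrow>\<^sub>E {- m..m}"
  have finG: "finite G" unfolding G_def by (intro finite_PiE) auto
  have "2 * real R / \<rho> \<ge> 0" using \<rho> by simp
  then have "m \<ge> 0" unfolding m_def by linarith
  then have "(\<lambda>_. 0) \<in> G" by (auto simp: G_def)
  then have cardG: "card G \<ge> 1" using finG by (metis One_nat_def Suc_leI card_gt_0_iff empty_iff)
  define s where "s = min \<rho> (min 1 (\<epsilon> / card G))"
  have s: "0 < s" "s \<le> \<rho>" "s \<le> 1" "s \<le> \<epsilon> / card G" using \<rho> \<epsilon> cardG by (simp_all add: s_def)
  define b where "b = s ^ d / k"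
  have b: "b > 0" using s k by (simp add: b_def)
  \<comment> \<open>a step of the parameter of a slot changes the amount of its color by \<open>b / K\<close>, while
    \<open>parameters_close\<close> determines the amounts up to \<open>8 / K\<close>\<close>
  define C where "C = nat \<lceil>8 / b\<rceil>"
  have C: "8 / b \<le> real C" unfolding C_def by linarith
  define \<epsilon>' where "\<epsilon>' = 1 / (2 * real (card G ^ q * (C + 1) ^ D))"
  have GC: "real (card G ^ q * (C + 1) ^ D) > 0" using cardG by simp
  have \<epsilon>': "\<epsilon>' > 0" using GC by (simp add: \<epsilon>'_def)
  obtain K\<^sub>0 where K0: "\<forall>K\<ge>K\<^sub>0. \<exists>\<R> :: (nat \<Rightarrow> (real ^ 'n) set) set.
     nearly_fair_cover R t q k K \<R> \<and> real (card \<R>) \<le> \<epsilon>' * real K ^ (d * t + d + 1)"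
    using nearly_fair_covering[OF R t q \<epsilon>', of k, where 'n='n] unfolding d_def by (rule exE)
  obtain K\<^sub>1 :: nat where K1: "2 * k * q * real R ^ d < K\<^sub>1" using reals_Archimedean2 by blast
  define K where "K = max 1 (max K\<^sub>0 K\<^sub>1)"
  have K: "K \<ge> 1" "K \<ge> K\<^sub>0" "K \<ge> K\<^sub>1" by (simp_all add: K_def)
  have Kr: "real K > 2 * k * q * real R ^ d" "real K \<ge> 1"
    using K1 K(1) of_nat_mono[OF K(3), where 'a=real] by linarith+
  obtain \<R> :: "(nat \<Rightarrow> (real ^ 'n) set) set" where
    nfc: "nearly_fair_cover R t q k K \<R>" and cR: "real (card \<R>) \<le> \<epsilon>' * real K ^ (d * t + d + 1)"
    using K0[rule_format, OF K(2)] by (elim exE conjE)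
  have Rm: "Q l \<in> lmeasurable" if "Q \<in> \<R>" for Q l
    using nfc that by (simp add: nearly_fair_cover_def)
  have finR: "finite \<R>" using nfc by (simp add: nearly_fair_cover_def)
  have cover: "covers \<R> (1 / K) (\<lambda>l. part a r t H (\<lambda>X. lam X = l))"
    if "bounded_arrangement R t a r H" "lam \<in> Pow {..<t} \<rightarrow>\<^sub>E {1..q}"
      "\<bar>measure lebesgue (part a r t H (\<lambda>X. lam X = 1)) - r ^ d / q\<bar> \<le> real k / real K"
    for a r H lam
    using nfc that unfolding nearly_fair_cover_def d_def by simp
  define I where "I = {1..<k}"
  define U where "U = (G \<times> I) \<rightarrow>\<^sub>E {..<K}"
  obtain i\<^sub>0 :: 'n where True by blast
  let ?Q = "\<lambda>g. cell \<rho> s g :: (real ^ 'n) set"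
  let ?T = "\<lambda>u g i. slot \<rho> s k K i\<^sub>0 g i (u (g, i)) :: (real ^ 'n) set"
  have uK: "u (g, i) \<le> K" if "u \<in> U" "g \<in> G" "i \<in> I" for u g i
  proof -
    have "u (g, i) \<in> {..<K}" using that by (intro PiE_mem[of u "G \<times> I" "\<lambda>_. {..<K}"]) (simp_all add: U_def)
    then show ?thesis by simp
  qed
  have "\<exists>f'\<in>colorings k. (\<forall>x. x \<notin> (\<Union>g\<in>G. ?Q g) \<longrightarrow> f' x = f x) \<and>
     (\<forall>g\<in>G. \<forall>i\<in>{1..<k}. ?Q g \<inter> f' -` {i} = ?T u g i)" if u: "u \<in> U" for u
  proof (rule recolor_exists[OF f k finG])
    show "?T u g i \<subseteq> ?Q g" if "g \<in> G" "i \<in> {1..<k}" for g i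
      using that s k K uK[OF u that(1), of i] by (intro slot_subset) (auto simp: I_def)
    show "?T u g i \<inter> ?T u g j = {}" if "g \<in> G" "i \<in> {1..<k}" "j \<in> {1..<k}" "i \<noteq> j" for g i j
      using that s k K uK[OF u that(1)] by (intro slot_disjoint) (auto simp: I_def)
    show "?Q g \<inter> ?Q h = {}" if "g \<noteq> h" for g h using s that by (intro cell_disjoint)
  qed (auto intro: fmeasurableD)
  then have "\<forall>u\<in>U. \<exists>f'. f' \<in> colorings k \<and> (\<forall>x. x \<notin> (\<Union>g\<in>G. ?Q g) \<longrightarrow> f' x = f x) \<and>
     (\<forall>g\<in>G. \<forall>i\<in>I. ?Q g \<inter> f' -` {i} = ?T u g i)"
    unfolding Bex_def I_def by (intro ballI)
  then obtain F where F': "\<forall>u\<in>U. F u \<in> colorings k \<and> (\<forall>x. x \<notin> (\<Union>g\<in>G. ?Q g) \<longrightarrow> F u x = f x) \<and>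
     (\<forall>g\<in>G. \<forall>i\<in>I. ?Q g \<inter> F u -` {i} = ?T u g i)"
    by (rule bchoice[THEN exE])
  have F: "\<And>u. u \<in> U \<Longrightarrow> F u \<in> colorings k"
    "\<And>u x. u \<in> U \<Longrightarrow> x \<notin> (\<Union>g\<in>G. ?Q g) \<Longrightarrow> F u x = f x"
    "\<And>u g i. u \<in> U \<Longrightarrow> g \<in> G \<Longrightarrow> i \<in> I \<Longrightarrow> ?Q g \<inter> F u -` {i} = ?T u g i"
    using F' by blast+
  have small: "{x. f x \<noteq> F u x} \<in> lmeasurable" "measure lebesgue {x. f x \<noteq> F u x} \<le> \<epsilon>" if u: "u \<in> U" for u
  proof -
    have fin: "(\<Union>g\<in>G. ?Q g) \<in> lmeasurable" using finG by (intro fmeasurable.finite_UN) auto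
    have sub: "{x. f x \<noteq> F u x} \<subseteq> (\<Union>g\<in>G. ?Q g)" using F(2)[OF u] by fastforce
    have ms: "{x. f x \<noteq> F u x} \<in> sets lebesgue" by (rule coloring_neq_measurable[OF f F(1)[OF u]])
    then show "{x. f x \<noteq> F u x} \<in> lmeasurable" using fin sub by (rule fmeasurableI2[rotated -1])
    have "measure lebesgue {x. f x \<noteq> F u x} \<le> measure lebesgue (\<Union>g\<in>G. ?Q g)"
      by (rule measure_mono_fmeasurable[OF sub ms fin])
    also have "\<dots> \<le> (\<Sum>g\<in>G. measure lebesgue (?Q g))"
      using finG by (intro measure_UNION_le) (auto intro: fmeasurableD)
    also have "\<dots> = card G * s ^ d" using s by (simp add: measure_cell d_def)
    also have "\<dots> \<le> card G * (\<epsilon> / card G)"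
    proof (rule mult_left_mono)
      have "s ^ d \<le> s ^ 1" using s by (intro power_decreasing) (simp_all add: d_def Suc_leI)
      then show "s ^ d \<le> \<epsilon> / card G" using s by simp
    qed simp
    also have "\<dots> = \<epsilon>" using cardG by simp
    finally show "measure lebesgue {x. f x \<noteq> F u x} \<le> \<epsilon>" .
  qed
  have "\<exists>u\<in>U. robust k q t R (F u) (1 / K)"
  proof (rule ccontr)
    assume "\<not> ?thesis"
    then have bad: "\<not> robust k q t R (F u) (1 / K)" if "u \<in> U" for u using that by blast
    define data where "data u S Q p \<longleftrightarrow> Q \<in> \<R> \<and> p \<in> {1..q} \<rightarrow>\<^sub>E G \<and> (\<forall>l. S l \<in> lmeasurable) \<and> (\<forall>l l'. l \<noteq> l' \<longrightarrow> S l \<inter> S l' = {}) \<and>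
       (\<forall>l. measure lebesgue (symdiff (S l) (Q l)) \<le> 1 / K) \<and> (\<forall>l\<in>{1..q}. ?Q (p l) \<subseteq> S l) \<and>
       (\<forall>l\<in>{1..q}. \<forall>i\<in>I. \<bar>measure lebesgue (S l \<inter> F u -` {i}) - measure lebesgue (S 1 \<inter> F u -` {i})\<bar> \<le> 2 * (1 / K))"
      for u S Q p
    have "\<exists>S Q p. data u S Q p" if u: "u \<in> U" for u
    proof -
      obtain a r H lam where cl: "bounded_arrangement R t a r H" and lam: "lam \<in> Pow {..<t} \<rightarrow>\<^sub>E {1..q}"
        and fair': "\<forall>l\<in>{1..q}. \<forall>i\<in>{1..k}.
          \<bar>measure lebesgue (part a r t H (\<lambda>X. lam X = l) \<inter> F u -` {i}) - measure lebesgue (ncube a r \<inter> F u -` {i}) / q\<bar> \<le> 1 / K"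
        using bad[OF u] by (rule not_robustE)
      have fair: "\<bar>measure lebesgue (part a r t H (\<lambda>X. lam X = l) \<inter> F u -` {i}) - measure lebesgue (ncube a r \<inter> F u -` {i}) / q\<bar> \<le> 1 / K"
        if "l \<in> {1..q}" "i \<in> {1..k}" for l i using fair' that by simp
      define S where "S l = part a r t H (\<lambda>X. lam X = l)" for l
      have r: "1 / real R \<le> r" "r \<le> real R" using cl by (simp_all add: bounded_arrangement_def)
      have "1 / real R > 0" using R by simp
      then have rp: "r > 0" using r by linarith
      have vol: "\<bar>measure lebesgue (S l) - r ^ d / q\<bar> \<le> real k / real K" if l: "l \<in> {1..q}" for l
      proof -
        have "measure lebesgue (S l) - r ^ d / q = (\<Sum>i\<in>{1..k}. measure lebesgue (S l \<inter> F u -` {i}) - measure lebesgue (ncube a r \<inter> F u -` {i}) / q)"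
        proof -
          have "measure lebesgue (S l) = (\<Sum>i\<in>{1..k}. measure lebesgue (S l \<inter> F u -` {i}))"
            by (rule measure_sum_colors[OF F(1)[OF u]]) (simp add: S_def)
          moreover have "r ^ d = (\<Sum>i\<in>{1..k}. measure lebesgue (ncube a r \<inter> F u -` {i}))"
            using measure_sum_colors[OF F(1)[OF u] ncube_lmeasurable, of a r] measure_ncube[OF rp, of a] by (simp add: d_def)
          ultimately show ?thesis by (simp add: sum_subtractf sum_divide_distrib)
        qed
        also have "\<bar>\<dots>\<bar> \<le> (\<Sum>i\<in>{1..k}. 1 / real K)"
          using fair[OF l] by (intro order_trans[OF sum_abs] sum_mono) (simp add: S_def)
        finally show ?thesis by simp
      qed
      have one: "1 \<in> {1..q}" using q by simp
      have "covers \<R> (1 / K) S"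
        unfolding S_def by (rule cover[OF cl lam]) (use vol[OF one] in \<open>simp add: S_def\<close>)
      then obtain Q where Q: "Q \<in> \<R>" "\<forall>l. measure lebesgue (symdiff (S l) (Q l)) \<le> 1 / K"
        unfolding covers_def by blast
      have big: "v\<^sub>0 \<le> measure lebesgue (S l)" if l: "l \<in> {1..q}" for l
      proof -
        have "real k / real K \<le> v\<^sub>0"
          using Kr q R1 by (simp add: v\<^sub>0_def field_simps)
        moreover have "2 * v\<^sub>0 \<le> r ^ d / q"
        proof -
          have "(1 / real R) ^ d \<le> r ^ d" using r by (intro power_mono) simp_all
          then have "(1 / real R) ^ d / q \<le> r ^ d / q" by (intro divide_right_mono) simp_all
          then show ?thesis by (simp add: v\<^sub>0_def power_one_over field_simps)
        qed
        ultimately show ?thesis using vol[OF l] by linarith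
      qed
      have "\<exists>g\<in>G. ?Q g \<subseteq> S l" if l: "l \<in> {1..q}" for l
      proof -
        obtain x where x: "{x'. \<forall>i. \<bar>x' $ i - x $ i\<bar> \<le> \<rho>} \<subseteq> S l"
          using cubes[OF cl] big[OF l] unfolding S_def by blast
        have "x \<in> S l" using x \<rho> by (auto simp: less_imp_le)
        then have xN: "x \<in> ncube a r" by (simp add: S_def part_def)
        have xR: "\<bar>x $ i\<bar> \<le> 2 * real R" for i
        proof -
          have "a $ i \<le> x $ i" "x $ i \<le> a $ i + r" using xN by (auto simp: ncube_def mem_box_cart)
          moreover have "\<bar>a $ i\<bar> \<le> real R" using cl by (simp add: bounded_arrangement_def)
          ultimately show ?thesis using r by linarith
        qed
        define g where "g i = \<lfloor>x $ i / \<rho>\<rfloor>" for i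
        have "g i \<in> {- m..m}" for i
        proof -
          have "\<bar>x $ i / \<rho>\<bar> \<le> 2 * real R / \<rho>" using xR[of i] \<rho> by (simp add: divide_right_mono)
          then have "- (2 * real R / \<rho>) \<le> x $ i / \<rho>" "x $ i / \<rho> \<le> 2 * real R / \<rho>" by linarith+
          then show ?thesis unfolding g_def m_def atLeastAtMost_iff by linarith
        qed
        then have "g \<in> G" by (auto simp: G_def)
        moreover have "?Q g \<subseteq> {x'. \<forall>i. \<bar>x' $ i - x $ i\<bar> \<le> \<rho>}"
        proof clarify
          fix y i assume "y \<in> ?Q g"
          then have y: "\<rho> * g i < y $ i" "y $ i < \<rho> * g i + s" by (simp_all add: cell_def mem_box_cart)
          have "real_of_int (g i) \<le> x $ i / \<rho>" "x $ i / \<rho> < real_of_int (g i) + 1" unfolding g_def by linarith+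
          then have "\<rho> * g i \<le> x $ i" "x $ i < \<rho> * g i + \<rho>" using \<rho> by (simp_all add: field_simps)
          then show "\<bar>y $ i - x $ i\<bar> \<le> \<rho>" using y s(2) by linarith
        qed
        ultimately show ?thesis using x by blast
      qed
      then obtain p where p: "\<And>l. l \<in> {1..q} \<Longrightarrow> p l \<in> G \<and> ?Q (p l) \<subseteq> S l" by metis
      have Sdis: "S l \<inter> S l' = {}" if "l \<noteq> l'" for l l' using that by (auto simp: S_def part_def)
      have Sfa: "\<bar>measure lebesgue (S l \<inter> F u -` {i}) - measure lebesgue (S 1 \<inter> F u -` {i})\<bar> \<le> 2 * (1 / K)"
        if "l \<in> {1..q}" "i \<in> I" for l i
      proof -
        have "i \<in> {1..k}" using that(2) by (auto simp: I_def)
        then show ?thesis using fair[OF that(1), of i] fair[OF one, of i] unfolding S_def by linarith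
      qed
      have Slm: "S l \<in> lmeasurable" for l by (simp add: S_def)
      have pE: "restrict p {1..q} \<in> {1..q} \<rightarrow>\<^sub>E G" using p by auto
      have pQ: "?Q (restrict p {1..q} l) \<subseteq> S l" if "l \<in> {1..q}" for l using p[OF that] that by simp
      have "data u S Q (restrict p {1..q})"
        unfolding data_def
        by (intro conjI allI impI ballI) (rule Q(1) pE Slm Sdis Q(2)[rule_format] pQ Sfa; assumption)+
      then show ?thesis by (intro exI)
    qed
    then obtain S rep pl where data: "\<And>u. u \<in> U \<Longrightarrow> data u (S u) (rep u) (pl u)"
      by metis
    have rep: "rep u \<in> \<R>" and pl: "pl u \<in> {1..q} \<rightarrow>\<^sub>E G" and Sm: "S u l \<in> lmeasurable"
      and Srep: "measure lebesgue (symdiff (S u l) (rep u l)) \<le> 1 / K" if "u \<in> U" for u l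
      using data[OF that] unfolding data_def by simp_all
    have Sd: "S u l \<inter> S u l' = {}" if "u \<in> U" "l \<noteq> l'" for u l l'
      using data[OF that(1)] that(2) unfolding data_def by (elim conjE allE impE)
    have SQ: "?Q (pl u l) \<subseteq> S u l" if "u \<in> U" "l \<in> {1..q}" for u l
      using data[OF that(1)] that(2) unfolding data_def by (elim conjE) (erule bspec)
    have Sfair: "\<bar>measure lebesgue (S u l \<inter> F u -` {i}) - measure lebesgue (S u 1 \<inter> F u -` {i})\<bar> \<le> 2 * (1 / K)"
      if "u \<in> U" "l \<in> {1..q}" "i \<in> I" for u l i
      using data[OF that(1)] that(2,3) unfolding data_def by simp
    have Qne: "?Q g \<noteq> {}" for g
    proof
      assume "?Q g = {}"
      then have "s ^ CARD('n) = 0" using measure_cell[OF s(1), of \<rho> g] by simp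
      then show False using s(1) by simp
    qed
    have inj: "inj_on (pl u) {2..q}" if u: "u \<in> U" for u
    proof (rule inj_onI)
      fix l l' assume l: "l \<in> {2..q}" "l' \<in> {2..q}" "pl u l = pl u l'"
      have "?Q (pl u l) \<subseteq> S u l \<inter> S u l'" using SQ[OF u, of l] SQ[OF u, of l'] l by auto
      then show "l = l'" using Qne[of "pl u l"] Sd[OF u, of l l'] by auto
    qed
    have close: "\<bar>int (u x) - int (u' x)\<bar> \<le> int C"
      if u: "u \<in> U" "u' \<in> U" and eq: "rep u = rep u'" "pl u = pl u'"
        and off: "\<And>x. x \<in> G \<times> I \<Longrightarrow> x \<notin> (\<lambda>(l, i). (pl u l, i)) ` ({2..q} \<times> I) \<Longrightarrow> u x = u' x"
        and x: "x \<in> (\<lambda>(l, i). (pl u l, i)) ` ({2..q} \<times> I)" for u u' x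
    proof -
      obtain l i where li: "l \<in> {2..q}" "i \<in> I" "x = (pl u l, i)" using x by auto
      have plG: "pl u l \<in> G" if "l \<in> {1..q}" for l using PiE_mem[OF pl[OF u(1)] that] .
      have lq: "l \<in> {1..q}" using li by auto
      have colors: "F u y = F u' y" if y: "y \<notin> (\<Union>l\<in>{2..q}. ?Q (pl u l))" for y
      proof (cases "y \<in> (\<Union>g\<in>G. ?Q g)")
        case False
        then show ?thesis using F(2) u by simp
      next
        case True
        then obtain g where g: "g \<in> G" "y \<in> ?Q g" by blast
        have gp: "g \<noteq> pl u l" if "l \<in> {2..q}" for l using g y that by auto
        have T: "?T u g i = ?T u' g i" if "i \<in> I" for i
        proof -
          have "(g, i) \<notin> (\<lambda>(l, i). (pl u l, i)) ` ({2..q} \<times> I)"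
          proof
            assume "(g, i) \<in> (\<lambda>(l, i). (pl u l, i)) ` ({2..q} \<times> I)"
            then obtain l where "l \<in> {2..q}" "g = pl u l" by auto
            then show False using gp by blast
          qed
          then have "u (g, i) = u' (g, i)" using off[of "(g, i)"] g(1) that by blast
          then show ?thesis by simp
        qed
        have iff: "F u y = i \<longleftrightarrow> F u' y = i" if "i \<in> I" for i
        proof -
          have "?Q g \<inter> F u -` {i} = ?Q g \<inter> F u' -` {i}"
            using F(3)[OF u(1) g(1) that] F(3)[OF u(2) g(1) that] T[OF that] by simp
          then show ?thesis using g(2) by blast
        qed
        have "F v y \<in> {1..k}" if "v \<in> U" for v
          using F(1)[OF that] by (simp add: colorings_def range_subsetD del: atLeastAtMost_iff)
        then have "F u y \<in> {1..k}" "F u' y \<in> {1..k}" using u by blast+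
        then have "F u y \<in> I \<or> F u y = k" "F u' y \<in> I \<or> F u' y = k" by (auto simp: I_def)
        then show ?thesis using iff[of "F u y"] iff[of "F u' y"] by metis
      qed
      have "\<bar>measure lebesgue (?Q (pl u l) \<inter> F u -` {i}) - measure lebesgue (?Q (pl u l) \<inter> F u' -` {i})\<bar> \<le> 8 * (1 / K)"
      proof (rule parameters_close[where S = "S u" and S' = "S u'" and Q = "\<lambda>l. ?Q (pl u l)" and k = k and q = q])
        show "?Q (pl u l) \<subseteq> S u' l" if "l \<in> {1..q}" for l using SQ[OF u(2) that] eq by simp
        show "measure lebesgue (symdiff (S u l) (S u' l)) \<le> 2 * (1 / K)" for l
        proof -
          have m: "S u l \<in> lmeasurable" "S u' l \<in> lmeasurable" "rep u l \<in> lmeasurable"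
            using Sm u Rm rep by auto
          have "measure lebesgue (symdiff (S u l) (S u' l)) \<le> measure lebesgue (symdiff (S u l) (rep u l) \<union> symdiff (S u' l) (rep u l))"
          proof (rule measure_mono_fmeasurable)
            show "symdiff (S u l) (S u' l) \<subseteq> symdiff (S u l) (rep u l) \<union> symdiff (S u' l) (rep u l)"
              by (auto simp: symdiff_def)
          qed (use m in \<open>auto intro!: symdiff_lmeasurable fmeasurable.Un fmeasurableD\<close>)
          also have "\<dots> \<le> measure lebesgue (symdiff (S u l) (rep u l)) + measure lebesgue (symdiff (S u' l) (rep u l))"
            using m by (intro measure_Un_le fmeasurableD symdiff_lmeasurable)
          also have "\<dots> \<le> 2 * (1 / K)" using Srep[OF u(1), of l] Srep[OF u(2), of l] eq by simp
          finally show ?thesis .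
        qed
      qed (use F(1) u Sm Sd SQ Sfair colors li in auto)
      moreover have "measure lebesgue (?Q (pl u l) \<inter> F v -` {i}) = b * (v x / K)" if v: "v \<in> U" for v
      proof -
        have "?Q (pl u l) \<inter> F v -` {i} = ?T v (pl u l) i" by (rule F(3)[OF v plG[OF lq] li(2)])
        then show ?thesis
          using measure_slot[of s k i "v (pl u l, i)" K \<rho> i\<^sub>0 "pl u l"] s k K uK[OF v plG[OF lq] li(2)] li(2)
          by (simp add: li(3) b_def d_def I_def)
      qed
      ultimately have "\<bar>b * (u x / K) - b * (u' x / K)\<bar> \<le> 8 * (1 / K)" using u by simp
      moreover have "b * (u x / K) - b * (u' x / K) = (real (u x) - real (u' x)) * (b / K)" by (simp add: algebra_simps diff_divide_distrib)
      ultimately have "\<bar>real (u x) - real (u' x)\<bar> * (b / K) \<le> 8 * (1 / K)" using b by (simp add: abs_mult)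
      then have "\<bar>real (u x) - real (u' x)\<bar> * b \<le> 8" using Kr(2) by (simp add: field_simps)
      then have "\<bar>real (u x) - real (u' x)\<bar> \<le> 8 / b" using b by (simp add: pos_le_divide_eq)
      then have "\<bar>real (u x) - real (u' x)\<bar> \<le> real C" using C by linarith
      then show ?thesis by linarith
    qed
    have "K ^ ((q - 1) * card I) \<le> card \<R> * card G ^ q * (C + 1) ^ ((q - 1) * card I)"
    proof (rule count_functions_le[where rep = rep and pl = pl and U = U, OF finR finG _ U_def])
      show "finite I" by (simp add: I_def)
      show "K \<ge> 1" by (rule K(1))
    qed (fact rep pl inj | rule close; assumption)+
    then have "K ^ D \<le> card \<R> * (card G ^ q * (C + 1) ^ D)" by (simp add: D_def I_def mult.assoc)
    then have "real K ^ D \<le> real (card \<R>) * real (card G ^ q * (C + 1) ^ D)"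
      by (metis of_nat_le_iff of_nat_mult of_nat_power)
    also have "\<dots> \<le> (\<epsilon>' * real K ^ (d * t + d + 1)) * real (card G ^ q * (C + 1) ^ D)"
      by (intro mult_right_mono cR) simp
    also have "\<dots> = real K ^ (d * t + d + 1) / 2"
    proof -
      have "(1 / (2 * x) * y) * x = y / 2" if "x > 0" for x y :: real using that by simp
      then show ?thesis unfolding \<epsilon>'_def using GC by blast
    qed
    also have "\<dots> \<le> real K ^ D / 2" using power_increasing[OF mD Kr(2)] by simp
    finally show False using Kr(2) by simp
  qed
  then obtain u where u: "u \<in> U" "robust k q t R (F u) (1 / K)" by blast
  then show ?thesis using F(1)[OF u(1)] small[OF u(1)] Kr(2)
    by (intro bexI[of _ "F u"] exI[of _ "1 / K"]) simp_all
qed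

section \<open>From splittings to labelled arrangements\<close>

lemma enumerate_hyperplanes:
  fixes \<H> :: "(real ^ 'n) set set"
  assumes fin: "finite \<H>" and card: "card \<H> \<le> t" and hyp: "\<And>h. h \<in> \<H> \<Longrightarrow> is_hyperplane h"
  obtains H :: "nat \<Rightarrow> (real ^ 'n) \<times> real" where "\<And>j. fst (H j) \<noteq> 0"
    "\<And>h. h \<in> \<H> \<Longrightarrow> \<exists>j<t. h = {x. fst (H j) \<bullet> x = snd (H j)}"
proof -
  obtain e where e: "bij_betw e {0..<card \<H>} \<H>" using ex_bij_betw_nat_finite[OF fin] by blast
  have "\<exists>p. fst p \<noteq> 0 \<and> (e j \<in> \<H> \<longrightarrow> e j = {x. fst p \<bullet> x = snd p})" for j
  proof (cases "e j \<in> \<H>")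
    case True
    then obtain a b where "a \<noteq> 0" "e j = {x. a \<bullet> x = b}" using hyp unfolding is_hyperplane_def by blast
    then show ?thesis by (intro exI[of _ "(a, b)"]) simp
  next
    case False
    have "(ones :: real ^ 'n) \<noteq> 0" by (simp add: vec_eq_iff)
    then show ?thesis using False by (intro exI[of _ "(ones, 0)"]) simp
  qed
  then obtain H where H: "\<And>j. fst (H j) \<noteq> 0" "\<And>j. e j \<in> \<H> \<Longrightarrow> e j = {x. fst (H j) \<bullet> x = snd (H j)}"
    by metis
  show ?thesis
  proof (rule that[of H])
    fix h assume h: "h \<in> \<H>"
    then obtain j where "j \<in> {0..<card \<H>}" "e j = h" using e by (metis bij_betw_imp_surj_on imageE)
    then show "\<exists>j<t. h = {x. fst (H j) \<bullet> x = snd (H j)}" using H(2)[of j] h card by (intro exI[of _ j]) auto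
  qed (rule H(1))
qed

text \<open>Two points on the same sides of all hyperplanes are joined by a segment that avoids the
  hyperplanes.\<close>

lemma same_pattern_connected:
  assumes cov: "\<And>h. h \<in> \<H> \<Longrightarrow> \<exists>j<t. h = {x. fst (H j) \<bullet> x = snd (H j)}"
    and x: "\<And>j. j < t \<Longrightarrow> fst (H j) \<bullet> x \<noteq> snd (H j)" and y: "\<And>j. j < t \<Longrightarrow> fst (H j) \<bullet> y \<noteq> snd (H j)"
    and same: "upper_pattern t H x = upper_pattern t H y"
  shows "connected_component_set (- \<Union>\<H>) x = connected_component_set (- \<Union>\<H>) y"
proof -
  have "closed_segment x y \<subseteq> - \<Union>\<H>"
  proof (rule ccontr)
    assume "\<not> ?thesis"
    then obtain z h where z: "z \<in> closed_segment x y" "h \<in> \<H>" "z \<in> h" by blast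
    obtain j where j: "j < t" "h = {x. fst (H j) \<bullet> x = snd (H j)}" using cov[OF z(2)] by blast
    have "snd (H j) < fst (H j) \<bullet> x \<longleftrightarrow> snd (H j) < fst (H j) \<bullet> y"
      using same j(1) by (auto simp: upper_pattern_def)
    then consider "snd (H j) < fst (H j) \<bullet> x" "snd (H j) < fst (H j) \<bullet> y"
      | "fst (H j) \<bullet> x < snd (H j)" "fst (H j) \<bullet> y < snd (H j)"
      using x[OF j(1)] y[OF j(1)] by linarith
    then show False
    proof cases
      case 1
      then have "closed_segment x y \<subseteq> {w. snd (H j) < fst (H j) \<bullet> w}"
        by (intro closed_segment_subset) (auto simp: convex_halfspace_gt)
      then show False using z j by auto
    next
      case 2
      then have "closed_segment x y \<subseteq> {w. fst (H j) \<bullet> w < snd (H j)}"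
        by (intro closed_segment_subset) (auto simp: convex_halfspace_lt)
      then show False using z j by auto
    qed
  qed
  then have "closed_segment x y \<subseteq> connected_component_set (- \<Union>\<H>) x"
    by (intro connected_component_maximal) auto
  then have "y \<in> connected_component_set (- \<Union>\<H>) x" by auto
  then show ?thesis by (rule connected_component_eq[symmetric])
qed

text \<open>By \<open>same_pattern_connected\<close>, the piece containing a point depends only on the pattern of the
  point, so a distribution of the pieces is a labelling of the patterns. The points on the
  hyperplanes form a null set. If there are fewer than \<open>t\<close> cuts, then further hyperplanes are
  added; they do no harm, since regions that they separate may carry the same label.\<close>

lemma fair_splitting_labelling:
  fixes f :: "real ^ 'n \<Rightarrow> nat"
  assumes f: "f \<in> colorings k" and N: "is_necklace N" and s: "s \<le> t" and q: "q \<ge> 1"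
    and split: "has_fair_splitting k q f N s"
  obtains a r H lam where "r > 0" "N = ncube a r" "\<And>j. fst (H j) \<noteq> 0" "lam \<in> Pow {..<t} \<rightarrow>\<^sub>E {1..q}"
    "\<And>l i. l \<in> {1..q} \<Longrightarrow> i \<in> {1..k} \<Longrightarrow>
       measure lebesgue (part a r t H (\<lambda>X. lam X = l) \<inter> f -` {i}) = measure lebesgue (ncube a r \<inter> f -` {i}) / q"
proof -
  obtain a r where r: "r > 0" and Na: "N = ncube a r"
    using N unfolding is_necklace_def ncube_def by blast
  obtain \<H> \<sigma> where fin: "finite \<H>" and cs: "card \<H> = s" and hyp: "\<forall>h\<in>\<H>. is_hyperplane h"
    and fair: "fair_distribution k q f N (pieces N \<H>) \<sigma>"
    using split unfolding has_fair_splitting_def by blast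
  have ct: "card \<H> \<le> t" using cs s by simp
  obtain H :: "nat \<Rightarrow> (real ^ 'n) \<times> real" where H: "\<And>j. fst (H j) \<noteq> 0"
    and cov: "\<And>h. h \<in> \<H> \<Longrightarrow> \<exists>j<t. h = {x. fst (H j) \<bullet> x = snd (H j)}"
    by (rule enumerate_hyperplanes[OF fin ct bspec[OF hyp]]) blast+
  define Z where "Z = (\<Union>j<t. {x. fst (H j) \<bullet> x = snd (H j)})"
  have negZ: "negligible Z" unfolding Z_def
    using H by (intro negligible_Union) (auto intro!: negligible_hyperplane)
  have Zn: "fst (H j) \<bullet> x \<noteq> snd (H j)" if "x \<notin> Z" "j < t" for x j using that by (auto simp: Z_def)
  have HZ: "\<Union>\<H> \<subseteq> Z" using cov unfolding Z_def by blast
  define comp where "comp x = connected_component_set (- \<Union>\<H>) x" for x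
  have comp_eq: "comp x = comp y" if "x \<notin> Z" "y \<notin> Z" "upper_pattern t H x = upper_pattern t H y" for x y
    unfolding comp_def by (rule same_pattern_connected[OF cov Zn[OF that(1)] Zn[OF that(2)] that(3)])
  have piece: "N \<inter> comp x \<in> pieces N \<H>" and x_comp: "x \<in> comp x" if "x \<in> N" "x \<notin> Z" for x
  proof -
    have x: "x \<in> - \<Union>\<H>" using that HZ by blast
    then show "x \<in> comp x" by (simp add: comp_def)
    moreover have "comp x \<in> components (- \<Union>\<H>)" unfolding comp_def using x by (rule componentsI)
    ultimately show "N \<inter> comp x \<in> pieces N \<H>" unfolding pieces_def using that(1) by blast
  qed
  have \<sigma>: "\<sigma> P \<in> {1..q}" if "P \<in> pieces N \<H>" for P
    using fair that unfolding fair_distribution_def by blast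
  define lab where "lab X = (if \<exists>x\<in>N - Z. upper_pattern t H x = X
     then \<sigma> (N \<inter> comp (SOME x. x \<in> N - Z \<and> upper_pattern t H x = X)) else 1)" for X
  have lab: "lab (upper_pattern t H x) = \<sigma> (N \<inter> comp x)" if x: "x \<in> N" "x \<notin> Z" for x
  proof -
    let ?y = "SOME y. y \<in> N - Z \<and> upper_pattern t H y = upper_pattern t H x"
    have "?y \<in> N - Z \<and> upper_pattern t H ?y = upper_pattern t H x"
      by (rule someI[of _ x]) (use x in simp)
    then have "comp ?y = comp x" using comp_eq x by blast
    moreover have "\<exists>y\<in>N - Z. upper_pattern t H y = upper_pattern t H x" using x by blast
    ultimately show ?thesis by (simp add: lab_def)
  qed
  have lab_range: "lab X \<in> {1..q}" for X
  proof (cases "\<exists>x\<in>N - Z. upper_pattern t H x = X")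
    case True
    then obtain x where "x \<in> N" "x \<notin> Z" "upper_pattern t H x = X" by blast
    then show ?thesis using lab \<sigma>[OF piece] by metis
  next
    case False
    then show ?thesis unfolding lab_def using q by simp
  qed
  define lam where "lam = restrict lab (Pow {..<t})"
  have lam_pat: "lam (upper_pattern t H x) = lab (upper_pattern t H x)" for x
    by (auto simp: lam_def upper_pattern_def)
  have same: "x \<in> part a r t H (\<lambda>X. lam X = l) \<longleftrightarrow> x \<in> \<Union>{P \<in> pieces N \<H>. \<sigma> P = l}" if xZ: "x \<notin> Z" for x l
  proof
    assume "x \<in> part a r t H (\<lambda>X. lam X = l)"
    then have "x \<in> N" "\<sigma> (N \<inter> comp x) = l" using lab xZ by (auto simp: part_def lam_pat Na)
    then show "x \<in> \<Union>{P \<in> pieces N \<H>. \<sigma> P = l}" using piece x_comp xZ by blast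
  next
    assume "x \<in> \<Union>{P \<in> pieces N \<H>. \<sigma> P = l}"
    then obtain P C where P: "P \<in> pieces N \<H>" "\<sigma> P = l" "P = N \<inter> C" "C \<in> components (- \<Union>\<H>)" "x \<in> N" "x \<in> C"
      unfolding pieces_def by blast
    obtain w where "C = connected_component_set (- \<Union>\<H>) w" using P(4) by (rule componentsE)
    then have "comp x = C" unfolding comp_def using P(6) connected_component_eq by metis
    then have "lab (upper_pattern t H x) = l" using lab[OF P(5) xZ] P(2,3) by simp
    then show "x \<in> part a r t H (\<lambda>X. lam X = l)" using P(5) by (simp add: part_def lam_pat Na)
  qed
  show ?thesis
  proof (rule that[OF r Na, of H lam])
    show "lam \<in> Pow {..<t} \<rightarrow>\<^sub>E {1..q}" unfolding lam_def using lab_range by (intro restrict_PiE_iff[THEN iffD2] ballI)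
    fix l i assume l: "l \<in> {1..q}" and i: "i \<in> {1..k}"
    let ?S = "part a r t H (\<lambda>X. lam X = l) \<inter> f -` {i}" and ?T = "\<Union>{P \<in> pieces N \<H>. \<sigma> P = l} \<inter> f -` {i}"
    have "?S \<in> lmeasurable"
      by (rule fmeasurable_Int_fmeasurable[OF part_lmeasurable coloring_measurable_vimage[OF f]])
    moreover have "negligible (?S - ?T \<union> (?T - ?S))"
    proof (rule negligible_subset[OF negZ])
      show "?S - ?T \<union> (?T - ?S) \<subseteq> Z"
      proof
        fix x assume "x \<in> ?S - ?T \<union> (?T - ?S)"
        then show "x \<in> Z" using same[of x l] by blast
      qed
    qed
    ultimately have "measure lebesgue ?T = measure lebesgue ?S" by (rule measure_negligible_symdiff)
    moreover have "measure lebesgue ?T = measure lebesgue (N \<inter> f -` {i}) / q"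
      using fair l i unfolding fair_distribution_def by blast
    ultimately show "measure lebesgue ?S = measure lebesgue (ncube a r \<inter> f -` {i}) / q" by (simp add: Na)
  qed (rule H)
qed

section \<open>Passage to the limit\<close>

lemma robust_transfer:
  fixes f g :: "real ^ 'n \<Rightarrow> nat"
  assumes rob: "robust k q t R f \<eta>" and f: "f \<in> colorings k" and g: "g \<in> colorings k" and q: "q \<ge> 1"
    and D: "{x. f x \<noteq> g x} \<in> lmeasurable" "measure lebesgue {x. f x \<noteq> g x} \<le> \<eta> / 4"
  shows "robust k q t R g (\<eta> / 2)"
proof (rule ccontr)
  assume "\<not> ?thesis"
  then obtain a r H lam where cl: "bounded_arrangement R t a r H" and lam: "lam \<in> Pow {..<t} \<rightarrow>\<^sub>E {1..q}"
    and fair: "\<forall>l\<in>{1..q}. \<forall>i\<in>{1..k}. \<bar>measure lebesgue (part a r t H (\<lambda>X. lam X = l) \<inter> g -` {i})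
            - measure lebesgue (ncube a r \<inter> g -` {i}) / q\<bar> \<le> \<eta> / 2"
    by (rule not_robustE)
  have near: "\<bar>measure lebesgue (S \<inter> f -` {i}) - measure lebesgue (S \<inter> g -` {i})\<bar> \<le> \<eta> / 4"
    if S: "S \<in> lmeasurable" for S i
  proof -
    have m: "S \<inter> f -` {i} \<in> lmeasurable" "S \<inter> g -` {i} \<in> lmeasurable"
      using S f g by (auto intro: fmeasurable_Int_fmeasurable coloring_measurable_vimage)
    have "\<bar>measure lebesgue (S \<inter> f -` {i}) - measure lebesgue (S \<inter> g -` {i})\<bar>
        \<le> measure lebesgue (symdiff (S \<inter> f -` {i}) (S \<inter> g -` {i}))"
      using m by (rule measure_diff_le_symdiff)
    also have "\<dots> \<le> measure lebesgue {x. f x \<noteq> g x}"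
      by (rule measure_mono_fmeasurable) (use m D in \<open>auto simp: symdiff_def intro: fmeasurableD\<close>)
    also have "\<dots> \<le> \<eta> / 4" by (rule D)
    finally show ?thesis .
  qed
  have "\<bar>measure lebesgue (part a r t H (\<lambda>X. lam X = l) \<inter> f -` {i}) - measure lebesgue (ncube a r \<inter> f -` {i}) / q\<bar> \<le> \<eta>"
    if l: "l \<in> {1..q}" and i: "i \<in> {1..k}" for l i
  proof -
    let ?y = "measure lebesgue (ncube a r \<inter> f -` {i}) - measure lebesgue (ncube a r \<inter> g -` {i})"
    have "\<bar>?y / q\<bar> \<le> \<bar>?y\<bar>" using q by (simp add: divide_le_eq mult_le_cancel_left1)
    also have "\<dots> \<le> \<eta> / 4" by (rule near) simp
    finally have "\<bar>measure lebesgue (ncube a r \<inter> f -` {i}) / q - measure lebesgue (ncube a r \<inter> g -` {i}) / q\<bar> \<le> \<eta> / 4"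
      by (simp add: diff_divide_distrib)
    moreover have "\<bar>measure lebesgue (part a r t H (\<lambda>X. lam X = l) \<inter> f -` {i})
       - measure lebesgue (part a r t H (\<lambda>X. lam X = l) \<inter> g -` {i})\<bar> \<le> \<eta> / 4"
      by (rule near) simp
    moreover have "\<bar>measure lebesgue (part a r t H (\<lambda>X. lam X = l) \<inter> g -` {i}) - measure lebesgue (ncube a r \<inter> g -` {i}) / q\<bar> \<le> \<eta> / 2"
      using fair l i by blast
    ultimately show ?thesis by linarith
  qed
  then show False using rob cl lam unfolding robust_def by blast
qed

lemma robust_imp_unsplittable:
  fixes g :: "real ^ 'n \<Rightarrow> nat"
  assumes g: "g \<in> colorings k" and q: "q \<ge> 1" and rob: "\<And>n. \<exists>\<eta>>0. robust k q t (Suc n) g \<eta>"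
  shows "g \<in> unsplittable_colorings k q t"
  unfolding unsplittable_colorings_def
proof (intro CollectI conjI allI impI notI g)
  fix N :: "(real ^ 'n) set" assume N: "is_necklace N" and "\<exists>s\<le>t. has_fair_splitting k q g N s"
  then obtain s where s: "s \<le> t" "has_fair_splitting k q g N s" by blast
  obtain a r H lam where *: "r > 0" "N = ncube a r" "\<And>j. fst (H j) \<noteq> 0" "lam \<in> Pow {..<t} \<rightarrow>\<^sub>E {1..q}"
    and fair: "\<And>l i. l \<in> {1..q} \<Longrightarrow> i \<in> {1..k} \<Longrightarrow>
       measure lebesgue (part a r t H (\<lambda>X. lam X = l) \<inter> g -` {i}) = measure lebesgue (ncube a r \<inter> g -` {i}) / q"
    by (rule fair_splitting_labelling[OF g N s(1) q s(2)]) blast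
  obtain n :: nat where n: "norm a + r + 1 / r \<le> n" using real_arch_simple by blast
  have "0 \<le> norm a" "0 < 1 / r" "real (Suc n) = real n + 1" using *(1) by simp_all
  then have nb: "norm a \<le> real (Suc n)" "r \<le> real (Suc n)" "1 / r \<le> real (Suc n)"
    using n *(1) by linarith+
  have "bounded_arrangement (Suc n) t a r H"
    unfolding bounded_arrangement_def
  proof (intro conjI allI impI)
    show "\<bar>a $ i\<bar> \<le> real (Suc n)" for i using component_le_norm_cart[of a i] nb(1) by linarith
    show "1 / real (Suc n) \<le> r" using nb(3) *(1) by (simp add: field_simps)
  qed (use nb * in auto)
  moreover obtain \<eta> where \<eta>: "\<eta> > 0" "robust k q t (Suc n) g \<eta>" using rob by blast
  moreover have "\<bar>measure lebesgue (part a r t H (\<lambda>X. lam X = l) \<inter> g -` {i}) - measure lebesgue (ncube a r \<inter> g -` {i}) / q\<bar> \<le> \<eta>"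
    if "l \<in> {1..q}" "i \<in> {1..k}" for l i using fair[OF that] \<eta>(1) by simp
  ultimately show False using *(4) unfolding robust_def by blast
qed

lemma coloring_dist_le_measure:
  fixes f g :: "real ^ 'n \<Rightarrow> nat"
  assumes fg: "f \<in> colorings k" "g \<in> colorings k" and D: "{x. f x \<noteq> g x} \<in> lmeasurable"
  shows "coloring_dist f g \<le> measure lebesgue {x. f x \<noteq> g x}"
proof -
  let ?\<mu> = "measure lebesgue {x. f x \<noteq> g x}"
  have "coloring_dist_term f g (Suc n) \<le> (1/2) ^ Suc n * ?\<mu>" for n
  proof -
    have "measure lebesgue {x \<in> origin_cube (Suc n). f x \<noteq> g x} \<le> ?\<mu>"
      by (rule measure_mono_fmeasurable) (use D neq_in_cube_lmeasurable[OF fg] in auto)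
    moreover have "1 \<le> (2 * real (Suc n)) ^ CARD('n)" by (rule one_le_power) simp
    ultimately have "measure lebesgue {x \<in> origin_cube (Suc n). f x \<noteq> g x} / (2 * real (Suc n)) ^ CARD('n) \<le> ?\<mu> / 1"
      by (intro frac_le) auto
    then show ?thesis unfolding coloring_dist_term_def by (intro mult_left_mono) simp_all
  qed
  moreover have sums: "(\<lambda>n. (1/2) ^ Suc n * ?\<mu>) sums (1 * ?\<mu>)"
    by (intro sums_mult2) (use power_half_series in simp)
  ultimately have "coloring_dist f g \<le> (\<Sum>n. (1/2) ^ Suc n * ?\<mu>)"
    unfolding coloring_dist_def by (intro suminf_le summable_coloring_dist sums_summable[OF sums])
  also have "\<dots> = ?\<mu>" using sums_unique[OF sums] by simp
  finally show ?thesis .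
qed

text \<open>If the differences of consecutive colorings have quickly decreasing measures, then outside of a
  null set the colors are eventually constant.\<close>

lemma limit_coloring:
  fixes fs :: "nat \<Rightarrow> real ^ 'n \<Rightarrow> nat" and e :: "nat \<Rightarrow> real"
  assumes fs: "\<And>n. fs n \<in> colorings k" and k: "k \<ge> 1"
    and D: "\<And>n. {x. fs n x \<noteq> fs (Suc n) x} \<in> lmeasurable" "\<And>n. measure lebesgue {x. fs n x \<noteq> fs (Suc n) x} \<le> e n / 2"
    and e: "\<And>n. 0 \<le> e n" "\<And>n. e (Suc n) \<le> e n / 2"
  obtains g where "g \<in> colorings k" "\<And>n. {x. fs n x \<noteq> g x} \<in> lmeasurable"
    "\<And>n. measure lebesgue {x. fs n x \<noteq> g x} \<le> e n"
proof -
  define B where "B n = {x. fs n x \<noteq> fs (Suc n) x}" for n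
  define X where "X n = (\<Union>m. B (n + m))" for n
  have e_le: "e (n + m) \<le> e n / 2 ^ m" for n m
  proof (induction m)
    case (Suc m)
    have "e (n + Suc m) \<le> e (n + m) / 2" using e(2)[of "n + m"] by simp
    also have "\<dots> \<le> e n / 2 ^ m / 2" using Suc by (intro divide_right_mono) auto
    finally show ?case by simp
  qed simp
  have part: "measure lebesgue (\<Union>m\<le>M. B (n + m)) \<le> e n" for n M
  proof -
    have "measure lebesgue (\<Union>m\<le>M. B (n + m)) \<le> (\<Sum>m\<le>M. measure lebesgue (B (n + m)))"
      using D(1) by (intro measure_UNION_le) (auto simp: B_def intro: fmeasurableD)
    also have "\<dots> \<le> (\<Sum>m\<le>M. e n * (1/2) ^ Suc m)"
    proof (rule sum_mono)
      fix m
      have "measure lebesgue (B (n + m)) \<le> e (n + m) / 2" using D(2) by (simp add: B_def)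
      also have "\<dots> \<le> e n / 2 ^ m / 2" using e_le by (intro divide_right_mono) auto
      finally show "measure lebesgue (B (n + m)) \<le> e n * (1/2) ^ Suc m" by (simp add: power_one_over field_simps)
    qed
    also have "\<dots> = e n * (\<Sum>m\<le>M. (1/2) ^ Suc m)" by (simp only: sum_distrib_left)
    also have "\<dots> \<le> e n * 1"
    proof (rule mult_left_mono[OF _ e(1)])
      have "(\<Sum>m\<le>M. (1/2 :: real) ^ Suc m) = 1 - (1/2) ^ Suc M" by (induction M) simp_all
      then show "(\<Sum>m\<le>M. (1/2 :: real) ^ Suc m) \<le> 1" by simp
    qed
    finally show ?thesis by simp
  qed
  have Bm: "B n \<in> lmeasurable" for n using D(1) by (simp add: B_def)
  have X: "X n \<in> lmeasurable" "measure lebesgue (X n) \<le> e n" for n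
    unfolding X_def using fmeasurable_countable_Union[OF Bm part] measure_countable_Union_le[OF Bm part] by blast+
  have const: "fs (n + m) x = fs n x" if "x \<notin> X n" for n m x
  proof (induction m)
    case (Suc m)
    have "x \<notin> B (n + m)" using that by (auto simp: X_def)
    then show ?case using Suc by (simp add: B_def)
  qed simp
  define g where "g x = (if \<exists>n. x \<notin> X n then fs (LEAST n. x \<notin> X n) x else 1)" for x
  have g: "g x = fs n x" if x: "x \<notin> X n" for x n
  proof -
    let ?l = "LEAST n. x \<notin> X n"
    have "x \<notin> X ?l" using x by (rule LeastI)
    moreover have "?l \<le> n" using x by (rule Least_le)
    ultimately have "fs n x = fs ?l x" using const[of x ?l "n - ?l"] by simp
    then show ?thesis using x by (auto simp: g_def)
  qed
  have range: "g x \<in> {1..k}" for x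
  proof (cases "\<exists>n. x \<notin> X n")
    case True
    then obtain n where "x \<notin> X n" by blast
    then show ?thesis using g fs[of n] by (simp add: colorings_def range_subsetD del: atLeastAtMost_iff)
  next
    case False
    then show ?thesis using k by (simp add: g_def)
  qed
  have vim: "g -` {i} = (\<Union>n. fs n -` {i} - X n) \<union> (if i = 1 then \<Inter>n. X n else {})" for i
  proof (intro equalityI subsetI)
    fix x assume x: "x \<in> g -` {i}"
    show "x \<in> (\<Union>n. fs n -` {i} - X n) \<union> (if i = 1 then \<Inter>n. X n else {})"
    proof (cases "\<exists>n. x \<notin> X n")
      case True
      then obtain n where "x \<notin> X n" by blast
      then show ?thesis using g x by auto
    next
      case False
      then have "g x = 1" by (simp add: g_def)
      then show ?thesis using x False by auto
    qed
  next
    fix x assume "x \<in> (\<Union>n. fs n -` {i} - X n) \<union> (if i = 1 then \<Inter>n. X n else {})"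
    then consider n where "fs n x = i" "x \<notin> X n" | "i = 1" "\<And>n. x \<in> X n"
      by (auto split: if_splits)
    then show "x \<in> g -` {i}" by cases (use g in \<open>auto simp: g_def\<close>)
  qed
  have "g -` {i} \<in> sets lebesgue" for i
  proof -
    have "(\<Union>n. fs n -` {i} - X n) \<in> sets lebesgue"
      using coloring_measurable_vimage[OF fs] fmeasurableD[OF X(1)] by (intro sets.countable_UN) auto
    moreover have "(\<Inter>n. X n) \<in> sets lebesgue" using fmeasurableD[OF X(1)] by (intro sets.countable_INT) auto
    ultimately show ?thesis unfolding vim by auto
  qed
  then have gc: "g \<in> colorings k" using range by (auto simp: colorings_def)
  have sub: "{x. fs n x \<noteq> g x} \<subseteq> X n" for n using g by fastforce
  have ms: "{x. fs n x \<noteq> g x} \<in> sets lebesgue" for n by (rule coloring_neq_measurable[OF fs gc])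
  show ?thesis
  proof (rule that[OF gc])
    fix n
    show "{x. fs n x \<noteq> g x} \<in> lmeasurable" by (rule fmeasurableI2[OF X(1) sub ms])
    show "measure lebesgue {x. fs n x \<noteq> g x} \<le> e n"
      using measure_mono_fmeasurable[OF sub ms X(1)] X(2) by (rule order_trans)
  qed
qed

text \<open>In step \<open>n\<close> the coloring is made robust for the necklaces of range \<open>n + 1\<close>. The second components
  bound the total measure of all later changes; they are kept so small that the robustness
  achieved so far is not destroyed.\<close>

lemma exists_unsplittable_near:
  fixes f :: "real ^ 'n \<Rightarrow> nat"
  assumes f: "f \<in> colorings k" and k: "k \<ge> 1" and t: "t \<ge> 1" and q: "q \<ge> 2"
    and many: "k * (q - 1) > CARD('n) * t + CARD('n) + (q - 1)" and \<epsilon>: "\<epsilon> > 0"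
  obtains g where "g \<in> unsplittable_colorings k q t" "coloring_dist f g \<le> \<epsilon>"
proof -
  define P where "P n p \<longleftrightarrow> fst p \<in> colorings k \<and> 0 < snd p \<and> (n = 0 \<longrightarrow> p = (f, \<epsilon>))"
    for n :: nat and p :: "(real ^ 'n \<Rightarrow> nat) \<times> real"
  define Q where "Q n p p' \<longleftrightarrow> {x. fst p x \<noteq> fst p' x} \<in> lmeasurable \<and> measure lebesgue {x. fst p x \<noteq> fst p' x} \<le> snd p / 2 \<and>
      snd p' \<le> snd p / 2 \<and> (\<exists>\<eta>>0. robust k q t (Suc n) (fst p') \<eta> \<and> snd p' \<le> \<eta> / 4)"
    for n :: nat and p p' :: "(real ^ 'n \<Rightarrow> nat) \<times> real"
  have "\<exists>s. \<forall>n. P n (s n) \<and> Q n (s n) (s (Suc n))"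
  proof (rule dependent_nat_choice)
    show "\<exists>p. P 0 p" using f \<epsilon> by (intro exI[of _ "(f, \<epsilon>)"]) (simp add: P_def)
    fix p n assume p: "P n p"
    then have "fst p \<in> colorings k" "snd p / 2 > 0" by (simp_all add: P_def)
    then obtain g \<eta> where g: "g \<in> colorings k" "\<eta> > 0" "{x. fst p x \<noteq> g x} \<in> lmeasurable"
      "measure lebesgue {x. fst p x \<noteq> g x} \<le> snd p / 2" "robust k q t (Suc n) g \<eta>"
      using exists_robust_perturbation[OF _ k t q _ many, of "fst p" "Suc n" "snd p / 2"] by auto
    have "P (Suc n) (g, min (snd p / 2) (\<eta> / 4))" using g p by (simp add: P_def)
    moreover have "Q n p (g, min (snd p / 2) (\<eta> / 4))"
      unfolding Q_def using g by (auto intro!: exI[of _ \<eta>])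
    ultimately show "\<exists>p'. P (Suc n) p' \<and> Q n p p'" by blast
  qed
  then obtain s where s: "\<And>n. P n (s n)" "\<And>n. Q n (s n) (s (Suc n))" by blast
  obtain g where g: "g \<in> colorings k" "\<And>n. {x. fst (s n) x \<noteq> g x} \<in> lmeasurable"
    "\<And>n. measure lebesgue {x. fst (s n) x \<noteq> g x} \<le> snd (s n)"
  proof (rule limit_coloring[of "\<lambda>n. fst (s n)" k "\<lambda>n. snd (s n)"])
    show "fst (s n) \<in> colorings k" "0 \<le> snd (s n)" for n using s(1)[of n] by (simp_all add: P_def)
    show "{x. fst (s n) x \<noteq> fst (s (Suc n)) x} \<in> lmeasurable" "snd (s (Suc n)) \<le> snd (s n) / 2"
      "measure lebesgue {x. fst (s n) x \<noteq> fst (s (Suc n)) x} \<le> snd (s n) / 2" for n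
      using s(2)[of n] by (simp_all add: Q_def)
  qed (use k in blast)+
  have q1: "q \<ge> 1" using q by simp
  have "\<exists>\<eta>>0. robust k q t (Suc n) g \<eta>" for n
  proof -
    obtain \<eta> where \<eta>: "\<eta> > 0" "robust k q t (Suc n) (fst (s (Suc n))) \<eta>" "snd (s (Suc n)) \<le> \<eta> / 4"
      using s(2)[of n] unfolding Q_def by blast
    have "fst (s (Suc n)) \<in> colorings k" using s(1)[of "Suc n"] by (simp add: P_def)
    then have "robust k q t (Suc n) g (\<eta> / 2)"
      by (rule robust_transfer[OF \<eta>(2) _ g(1) q1 g(2) order_trans[OF g(3) \<eta>(3)]])
    then show ?thesis using \<eta>(1) by (intro exI[of _ "\<eta> / 2"]) simp
  qed
  then have "g \<in> unsplittable_colorings k q t" by (rule robust_imp_unsplittable[OF g(1) q1])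
  moreover have "coloring_dist f g \<le> \<epsilon>"
  proof -
    have s0: "s 0 = (f, \<epsilon>)" using s(1)[of 0] by (simp add: P_def)
    have "coloring_dist f g \<le> measure lebesgue {x. f x \<noteq> g x}"
      using g(2)[of 0] s0 by (intro coloring_dist_le_measure[OF f g(1)]) simp
    then show ?thesis using g(3)[of 0] s0 by simp
  qed
  ultimately show ?thesis by (rule that)
qed

theorem theorem6p13:
  fixes k t q :: nat
  assumes "k \<ge> 1" and "t \<ge> 1" and "q \<ge> 2"
    and "k * (q - 1) > CARD('n) * t + CARD('n) + (q - 1)"
  shows "(\<exists>f :: real ^ 'n \<Rightarrow> nat. f \<in> colorings k \<and>
            (\<forall>N. is_necklace N \<longrightarrow> \<not> (\<exists>s\<le>t. has_fair_splitting k q f N s)))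
       \<and> (Metric_space.mtopology (coloring_space k) class_dist closure_of
            (unsplittable_classes k q t :: (real ^ 'n \<Rightarrow> nat) set set)) = coloring_space k"
proof
  have "(\<lambda>_. 1) \<in> (colorings k :: (real ^ 'n \<Rightarrow> nat) set)"
    using assms(1) by (auto simp: colorings_def vimage_def)
  then obtain f :: "real ^ 'n \<Rightarrow> nat" where "f \<in> unsplittable_colorings k q t"
    by (rule exists_unsplittable_near[OF _ assms zero_less_one])
  then show "\<exists>f :: real ^ 'n \<Rightarrow> nat. f \<in> colorings k \<and>
            (\<forall>N. is_necklace N \<longrightarrow> \<not> (\<exists>s\<le>t. has_fair_splitting k q f N s))"
    unfolding unsplittable_colorings_def by blast
next
  interpret Metric_space "coloring_space k :: (real ^ 'n \<Rightarrow> nat) set set" class_dist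
    by (rule Metric_space_colorings)
  have "\<exists>G\<in>unsplittable_classes k q t. G \<in> mball F \<epsilon>"
    if F: "F \<in> coloring_space k" and \<epsilon>: "\<epsilon> > 0" for F :: "(real ^ 'n \<Rightarrow> nat) set" and \<epsilon>
  proof -
    obtain f where f: "f \<in> F" using class_some(1)[OF F] by blast
    then have fc: "f \<in> colorings k" using class_some(2)[OF F] by blast
    have "\<epsilon> / 2 > 0" using \<epsilon> by simp
    then obtain g where g: "g \<in> unsplittable_colorings k q t" "coloring_dist f g \<le> \<epsilon> / 2"
      by (rule exists_unsplittable_near[OF fc assms])
    define G where "G = coloring_rel k `` {g}"
    have gc: "g \<in> colorings k" using g(1) by (simp add: unsplittable_colorings_def)
    have "g \<in> G" unfolding G_def by (rule equiv_class_self[OF equiv_coloring_rel gc])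
    have G: "G \<in> coloring_space k" unfolding G_def coloring_space_def by (rule quotientI[OF gc])
    have "class_dist F G = coloring_dist f g" by (rule class_dist_eq[OF F G f \<open>g \<in> G\<close>])
    then have "G \<in> mball F \<epsilon>" using F G g(2) \<epsilon> by simp
    moreover have "G \<in> unsplittable_classes k q t" unfolding unsplittable_classes_def G_def using g(1) by blast
    ultimately show ?thesis by blast
  qed
  then show "mtopology closure_of (unsplittable_classes k q t) = (coloring_space k :: (real ^ 'n \<Rightarrow> nat) set set)"
    unfolding metric_closure_of by blast
qed

end
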